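(* Let $\mathcal{H}$ be a Hilbert space, let $d\in\mathbb{N}$ (so $d\ge 1$), and let $S_0,\dots,S_d$ be bounded operators on $\mathcal{H}$; set $S_{-k}=S_k^*$ for $1\le k\le d$. Consider the truncated operator trigonometric moment problem with data $\{S_n\}_{n=0}^d$ and suppose that $$\sum_{k,l=0}^d (S_{l-k}h_l,h_k)_{\mathcal{H}}\ge 0\qquad\text{for all } h_0,\dots,h_d\in\mathcal{H}.$$ Let the Hilbert space $H$, the closed isometric operator $A$ in $H$ with domain $D(A)$ and range $R(A)$, and the operator-valued functions $\mathcal{A}(\zeta),\mathcal{B}(\zeta),\mathcal{C}(\zeta),\mathcal{D}(\zeta)$, $\zeta\in\mathbb{D}$, be constructed from $\{S_n\}_{n=0}^d$ as described in the context. Then the relation $$\int_0^{2\pi}\frac{1+\zeta e^{it}}{1-\zeta e^{it}}\,dF(t)=\mathcal{A}(\zeta)+\mathcal{B}(\zeta)\,\Phi_\zeta\left(E_{H\ominus D(A)}+\mathcal{C}(\zeta)\Phi_\zeta\right)^{-1}\mathcal{D}(\zeta),\qquad \zeta\in\mathbb{D},$$ establishes a one-to-one correspondence between all functions $\Phi=\Phi_\zeta\in S(\mathbb{D};H\ominus D(A),H\ominus R(A))$ and all solutions $F$ of the moment problem.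
   Context: All Hilbert spaces are complex and not necessarily separable; operators are linear; $[\mathcal{H}]$ is the set of bounded operators on $\mathcal{H}$; scalar products are linear in the first argument. $\mathbb{D}=\{z\in\mathbb{C}:|z|<1\}$. $E_K$ is the identity operator on $K$; $P^H_{K}$ is the orthogonal projection in $H$ onto a closed subspace $K$. Moment problem. The truncated operator trigonometric moment problem with data $\{S_n\}_{n=0}^d\subset[\mathcal{H}]$ consists of finding a non-decreasing $[\mathcal{H}]$-valued function $F(t)$, $t\in[0,2\pi]$ (i.e. $F(t)-F(s)\ge 0$ for $s\le t$), with $F(0)=0$, strongly left-continuous in $(0,2\pi]$, such that $\int_0^{2\pi}e^{int}\,dF(t)=S_n$ for $n=0,1,\dots,d$. Operator Stieltjes integrals are limits of integral (Riemann–Stieltjes) sums in the strong operator topology. Such an $F$ is called a solution. Construction of $H$, $A$, $I$. Let $\mathfrak{B}$ be the complex vector space of formal sums $h=\sum_{j=0}^d h_j\varepsilon_j$ with $h_j\in\mathcal{H}$ ($\varepsilon_0,\dots,\varepsilon_d$ abstract symbols, operations coefficientwise). For $h=\sum_j h_j\varepsilon_j$, $g=\sum_k g_k\varepsilon_k$ put $\langle h,g\rangle=\sum_{j,k=0}^d(S_{j-k}h_j,g_k)_{\mathcal{H}}$, a non-negative Hermitian sesquilinear form under the positivity hypothesis. Identify $h$ and $g$ when $\langle h-g,h-g\rangle=0$, write $[h]$ for the class of $h$, and let $H$ be the Hilbert space obtained by completing the space of classes with the induced scalar product. Put $x_{h,j}=[h\varepsilon_j]$ for $h\in\mathcal{H}$,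 $0\le j\le d$; thus $(x_{h,j},x_{g,k})_H=(S_{j-k}h,g)_{\mathcal{H}}$. Let $A_0$ be the (well-defined, isometric) linear operator in $H$ with domain $D(A_0)=\{\sum_{j=0}^{d-1}x_{h_j,j}: h_0,\dots,h_{d-1}\in\mathcal{H}\}$ given by $A_0\sum_{j=0}^{d-1}x_{h_j,j}=\sum_{j=0}^{d-1}x_{h_j,j+1}$, and let $A=\overline{A_0}$ be its closure; $D(A)$ and $R(A)$ are closed subspaces of $H$. Define $I:\mathcal{H}\to H$ by $Ih=x_{h,0}$; it is linear and bounded, and its range lies in $D(A)$. Coefficients. For $\zeta\in\mathbb{D}$ define $$\mathbf{A}(\zeta)=\left(E_{D(A)}-\zeta P^H_{D(A)}A\right)^{-1}\ (\text{an operator on } D(A)),\qquad \mathbf{B}(\zeta)=-\zeta\,\mathbf{A}(\zeta)P^H_{D(A)},$$ $$\mathbf{D}(\zeta)=-\zeta P^H_{H\ominus D(A)}A\,\mathbf{A}(\zeta),\qquad \mathbf{C}(\zeta)=-\zeta P^H_{H\ominus D(A)}+\zeta\,\mathbf{D}(\zeta)P^H_{D(A)},$$ and $$\mathcal{A}(\zeta)=2I^*\mathbf{A}(\zeta)I-S_0,\quad \mathcal{B}(\zeta)=2I^*\mathbf{B}(\zeta)|_{H\ominus R(A)},\quad \mathcal{C}(\zeta)=\mathbf{C}(\zeta)|_{H\ominus R(A)},\quad \mathcal{D}(\zeta)=\mathbf{D}(\zeta)I.$$ Parameter class. For Hilbert spaces $N,N'$, $S(\mathbb{D};N,N')$ is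 the class of all analytic operator-valued functions $\zeta\mapsto\Phi_\zeta$ in $\mathbb{D}$ whose values are linear non-expanding operators (i.e. of norm at most $1$) mapping the whole of $N$ into $N'$. *)

theory Defs
  imports "HOL-Analysis.Analysis" "HOL-Library.FuncSet"
begin

section \<open>Complex Hilbert spaces\<close>

text \<open>A complex inner product space is a real one (with respect to the real part of the complex
  scalar product) that carries a compatible complex structure; thus norm, topology and completeness
  are those of the library. The scalar product is linear in the first argument.\<close>

class complex_inner = real_inner +
  fixes scaleC :: "complex \<Rightarrow> 'a \<Rightarrow> 'a" (infixr "*\<^sub>C" 75)
    and cinner :: "'a \<Rightarrow> 'a \<Rightarrow> complex"
  assumes scaleC_add_right: "a *\<^sub>C (x + y) = a *\<^sub>C x + a *\<^sub>C y"
    and scaleC_add_left: "(a + b) *\<^sub>C x = a *\<^sub>C x + b *\<^sub>C x"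
    and scaleC_scaleC: "a *\<^sub>C (b *\<^sub>C x) = (a * b) *\<^sub>C x"
    and scaleR_scaleC: "r *\<^sub>R x = complex_of_real r *\<^sub>C x"
    and cinner_add_left: "cinner (x + y) z = cinner x z + cinner y z"
    and cinner_scaleC_left: "cinner (a *\<^sub>C x) y = a * cinner x y"
    and cinner_commute: "cinner x y = cnj (cinner y x)"
    and inner_eq_Re_cinner: "inner x y = Re (cinner x y)"

class chilbert_space = complex_inner + complete_space

instance chilbert_space \<subseteq> banach ..

instantiation complex :: chilbert_space
begin
definition scaleC_complex :: "complex \<Rightarrow> complex \<Rightarrow> complex"
  where "scaleC_complex a x = a * x"
definition cinner_complex :: "complex \<Rightarrow> complex \<Rightarrow> complex"
  where "cinner_complex x y = x * cnj y"
instance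
  by standard (auto simp: scaleC_complex_def cinner_complex_def algebra_simps inner_complex_def
      scaleR_conv_of_real)
end

lemma cinner_self: "cinner x x = complex_of_real ((norm x)\<^sup>2)"
proof (rule complex_eqI)
  show "Re (cinner x x) = Re (complex_of_real ((norm x)\<^sup>2))"
    by (simp add: power2_norm_eq_inner inner_eq_Re_cinner)
  have "Im (cinner x x) = - Im (cinner x x)"
    using arg_cong[OF cinner_commute[of x x], of Im] by simp
  then show "Im (cinner x x) = Im (complex_of_real ((norm x)\<^sup>2))" by simp
qed

definition bounded_clinear :: "('a::complex_inner \<Rightarrow> 'b::complex_inner) \<Rightarrow> bool"
  where "bounded_clinear T \<longleftrightarrow> bounded_linear T \<and> (\<forall>c x. T (c *\<^sub>C x) = c *\<^sub>C T x)"

definition cadjoint :: "('a::chilbert_space \<Rightarrow> 'b::chilbert_space) \<Rightarrow> 'b \<Rightarrow> 'a"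
  where "cadjoint T = (THE T'. \<forall>x y. cinner (T x) y = cinner x (T' y))"

definition positive_op :: "('a::chilbert_space \<Rightarrow> 'a) \<Rightarrow> bool"
  where "positive_op T \<longleftrightarrow> (\<forall>x. cinner (T x) x \<in> \<real>\<^sub>\<ge>\<^sub>0)"

definition ocompl :: "'a::chilbert_space set \<Rightarrow> 'a set"
  where "ocompl K = {x. \<forall>y\<in>K. cinner x y = 0}"

definition oproj :: "'a::chilbert_space set \<Rightarrow> 'a \<Rightarrow> 'a"
  where "oproj K x = (THE y. y \<in> K \<and> x - y \<in> ocompl K)"

section \<open>The truncated moment problem\<close>

text \<open>Riemann-Stieltjes sums run over tagged divisions whose mesh tends to zero;
  convergence is in the strong operator topology.\<close>

definition has_rs_integral ::
  "(real \<Rightarrow> complex) \<Rightarrow> (real \<Rightarrow> 'h \<Rightarrow> 'h::chilbert_space) \<Rightarrow> real \<Rightarrow> real \<Rightarrow> ('h \<Rightarrow> 'h) \<Rightarrow> bool"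
  where "has_rs_integral f F a b T \<longleftrightarrow>
    (\<forall>h. \<forall>\<epsilon>>0. \<exists>\<delta>>0. \<forall>p. p tagged_division_of {a..b} \<and> (\<forall>(t, K)\<in>p. Sup K - Inf K < \<delta>) \<longrightarrow>
      norm ((\<Sum>(t, K)\<in>p. f t *\<^sub>C (F (Sup K) h - F (Inf K) h)) - T h) < \<epsilon>)"

text \<open>A solution is a function on the interval from 0 to \<open>2 * pi\<close> only, so it is taken to be
  extensional there.\<close>

definition solutions :: "nat \<Rightarrow> (nat \<Rightarrow> 'h \<Rightarrow> 'h::chilbert_space) \<Rightarrow> (real \<Rightarrow> 'h \<Rightarrow> 'h) set"
  where "solutions d S = {F \<in> extensional {0..2 * pi}.
    (\<forall>t\<in>{0..2 * pi}. bounded_clinear (F t)) \<and>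
    (\<forall>s\<in>{0..2 * pi}. \<forall>t\<in>{0..2 * pi}. s \<le> t \<longrightarrow> positive_op (\<lambda>h. F t h - F s h)) \<and>
    (\<forall>h. F 0 h = 0) \<and>
    (\<forall>t\<in>{0<..2 * pi}. \<forall>h. ((\<lambda>s. F s h) \<longlongrightarrow> F t h) (at_left t)) \<and>
    (\<forall>n\<le>d. has_rs_integral (\<lambda>t. exp (\<i> * of_nat n * of_real t)) F 0 (2 * pi) (S n))}"

text \<open>The data extended to negative indices by adjoints.\<close>

definition moment_op :: "(nat \<Rightarrow> 'h \<Rightarrow> 'h::chilbert_space) \<Rightarrow> int \<Rightarrow> 'h \<Rightarrow> 'h"
  where "moment_op S n = (if 0 \<le> n then S (nat n) else cadjoint (S (nat (- n))))"

section \<open>The space and the isometry built from the data\<close>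

text \<open>The formal sum of \<open>h\<^sub>j \<epsilon>\<^sub>j\<close> over \<open>j \<le> d\<close> is its coefficient sequence, continued by zero.\<close>

definition formal_sums :: "nat \<Rightarrow> (nat \<Rightarrow> 'h::chilbert_space) set"
  where "formal_sums d = {h. \<forall>j>d. h j = 0}"

definition moment_form ::
  "nat \<Rightarrow> (nat \<Rightarrow> 'h \<Rightarrow> 'h::chilbert_space) \<Rightarrow> (nat \<Rightarrow> 'h) \<Rightarrow> (nat \<Rightarrow> 'h) \<Rightarrow> complex"
  where "moment_form d S h g =
    (\<Sum>j\<le>d. \<Sum>k\<le>d. cinner (moment_op S (int j - int k) (h j)) (g k))"

text \<open>A completion of the space of classes: a complex Hilbert space \<open>'k\<close> with the class map
  \<open>cls\<close>, which is linear, carries the form to the scalar product and has dense range. That \<open>cls\<close>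
  identifies exactly the pairs at distance zero is lemma \<open>cls_eq_iff\<close>. The space depends on the
  data, hence it cannot be a type constructed in the logic; statements are about every
  completion (all of them are unitarily equivalent by a map commuting with \<open>cls\<close>).\<close>

definition is_moment_space ::
  "nat \<Rightarrow> (nat \<Rightarrow> 'h \<Rightarrow> 'h::chilbert_space) \<Rightarrow> ((nat \<Rightarrow> 'h) \<Rightarrow> 'k::chilbert_space) \<Rightarrow> bool"
  where "is_moment_space d S cls \<longleftrightarrow>
    (\<forall>h\<in>formal_sums d. \<forall>g\<in>formal_sums d. cls (\<lambda>j. h j + g j) = cls h + cls g) \<and>
    (\<forall>c. \<forall>h\<in>formal_sums d. cls (\<lambda>j. c *\<^sub>C h j) = c *\<^sub>C cls h) \<and>
    (\<forall>h\<in>formal_sums d. \<forall>g\<in>formal_sums d. cinner (cls h) (cls g) = moment_form d S h g) \<and>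
    closure (cls ` formal_sums d) = UNIV"

lemma cls_eq_iff:
  assumes "is_moment_space d S cls" and h: "h \<in> formal_sums d" and g: "g \<in> formal_sums d"
  shows "cls h = cls g \<longleftrightarrow> moment_form d S (\<lambda>j. h j - g j) (\<lambda>j. h j - g j) = 0"
proof -
  have m1: "(-1) *\<^sub>C x = - x" for x :: "'z::complex_inner"
    using scaleR_scaleC[of "-1" x] by simp
  have "(\<lambda>j. (-1) *\<^sub>C g j) \<in> formal_sums d" using g by (simp add: formal_sums_def m1)
  then have "cls (\<lambda>j. h j + (-1) *\<^sub>C g j) = cls h + (-1) *\<^sub>C cls g"
    using assms unfolding is_moment_space_def by metis
  then have diff: "cls (\<lambda>j. h j - g j) = cls h - cls g" by (simp add: m1)
  have "(\<lambda>j. h j - g j) \<in> formal_sums d" using h g by (simp add: formal_sums_def)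
  then have "moment_form d S (\<lambda>j. h j - g j) (\<lambda>j. h j - g j) = cinner (cls h - cls g) (cls h - cls g)"
    using assms(1) diff unfolding is_moment_space_def by metis
  then show ?thesis by (simp add: cinner_self)
qed

definition gen :: "((nat \<Rightarrow> 'h::chilbert_space) \<Rightarrow> 'k::chilbert_space) \<Rightarrow> 'h \<Rightarrow> nat \<Rightarrow> 'k"
  where "gen cls h j = cls (\<lambda>i. if i = j then h else 0)"

text \<open>The graph of the closed operator \<open>A\<close>.\<close>

definition shift_graph ::
  "nat \<Rightarrow> ((nat \<Rightarrow> 'h::chilbert_space) \<Rightarrow> 'k::chilbert_space) \<Rightarrow> ('k \<times> 'k) set"
  where "shift_graph d cls =
    closure {(\<Sum>j<d. gen cls (h j) j, \<Sum>j<d. gen cls (h j) (Suc j)) | h. True}"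

definition opA :: "nat \<Rightarrow> ((nat \<Rightarrow> 'h::chilbert_space) \<Rightarrow> 'k::chilbert_space) \<Rightarrow> 'k \<Rightarrow> 'k"
  where "opA d cls x = (THE y. (x, y) \<in> shift_graph d cls)"

definition domA :: "nat \<Rightarrow> ((nat \<Rightarrow> 'h::chilbert_space) \<Rightarrow> 'k::chilbert_space) \<Rightarrow> 'k set"
  where "domA d cls = fst ` shift_graph d cls"

definition ranA :: "nat \<Rightarrow> ((nat \<Rightarrow> 'h::chilbert_space) \<Rightarrow> 'k::chilbert_space) \<Rightarrow> 'k set"
  where "ranA d cls = snd ` shift_graph d cls"

definition opI :: "((nat \<Rightarrow> 'h::chilbert_space) \<Rightarrow> 'k::chilbert_space) \<Rightarrow> 'h \<Rightarrow> 'k"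
  where "opI cls h = gen cls h 0"

section \<open>Coefficients\<close>

text \<open>The prefix \<open>bf\<close> marks the operator functions written in bold face, \<open>cal\<close> the calligraphic
  ones.\<close>

definition preA ::
  "nat \<Rightarrow> ((nat \<Rightarrow> 'h::chilbert_space) \<Rightarrow> 'k::chilbert_space) \<Rightarrow> complex \<Rightarrow> 'k \<Rightarrow> 'k"
  where "preA d cls \<zeta> x = x - \<zeta> *\<^sub>C oproj (domA d cls) (opA d cls x)"

definition bfA ::
  "nat \<Rightarrow> ((nat \<Rightarrow> 'h::chilbert_space) \<Rightarrow> 'k::chilbert_space) \<Rightarrow> complex \<Rightarrow> 'k \<Rightarrow> 'k"
  where "bfA d cls \<zeta> = inv_into (domA d cls) (preA d cls \<zeta>)"

definition bfB ::
  "nat \<Rightarrow> ((nat \<Rightarrow> 'h::chilbert_space) \<Rightarrow> 'k::chilbert_space) \<Rightarrow> complex \<Rightarrow> 'k \<Rightarrow> 'k"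
  where "bfB d cls \<zeta> x = (- \<zeta>) *\<^sub>C bfA d cls \<zeta> (oproj (domA d cls) x)"

definition bfD ::
  "nat \<Rightarrow> ((nat \<Rightarrow> 'h::chilbert_space) \<Rightarrow> 'k::chilbert_space) \<Rightarrow> complex \<Rightarrow> 'k \<Rightarrow> 'k"
  where "bfD d cls \<zeta> x =
    (- \<zeta>) *\<^sub>C oproj (ocompl (domA d cls)) (opA d cls (bfA d cls \<zeta> x))"

definition bfC ::
  "nat \<Rightarrow> ((nat \<Rightarrow> 'h::chilbert_space) \<Rightarrow> 'k::chilbert_space) \<Rightarrow> complex \<Rightarrow> 'k \<Rightarrow> 'k"
  where "bfC d cls \<zeta> x =
    (- \<zeta>) *\<^sub>C oproj (ocompl (domA d cls)) x + \<zeta> *\<^sub>C bfD d cls \<zeta> (oproj (domA d cls) x)"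

definition calA :: "nat \<Rightarrow> (nat \<Rightarrow> 'h \<Rightarrow> 'h::chilbert_space) \<Rightarrow>
    ((nat \<Rightarrow> 'h) \<Rightarrow> 'k::chilbert_space) \<Rightarrow> complex \<Rightarrow> 'h \<Rightarrow> 'h"
  where "calA d S cls \<zeta> h = 2 *\<^sub>C cadjoint (opI cls) (bfA d cls \<zeta> (opI cls h)) - S 0 h"

definition calB ::
  "nat \<Rightarrow> ((nat \<Rightarrow> 'h::chilbert_space) \<Rightarrow> 'k::chilbert_space) \<Rightarrow> complex \<Rightarrow> 'k \<Rightarrow> 'h"
  where "calB d cls \<zeta> =
    restrict (\<lambda>x. 2 *\<^sub>C cadjoint (opI cls) (bfB d cls \<zeta> x)) (ocompl (ranA d cls))"

definition calC ::
  "nat \<Rightarrow> ((nat \<Rightarrow> 'h::chilbert_space) \<Rightarrow> 'k::chilbert_space) \<Rightarrow> complex \<Rightarrow> 'k \<Rightarrow> 'k"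
  where "calC d cls \<zeta> = restrict (bfC d cls \<zeta>) (ocompl (ranA d cls))"

definition calD ::
  "nat \<Rightarrow> ((nat \<Rightarrow> 'h::chilbert_space) \<Rightarrow> 'k::chilbert_space) \<Rightarrow> complex \<Rightarrow> 'h \<Rightarrow> 'k"
  where "calD d cls \<zeta> h = bfD d cls \<zeta> (opI cls h)"

section \<open>Parameters\<close>

text \<open>Operators on a subspace \<open>N\<close> are extensional functions on \<open>N\<close>.\<close>

definition contractions :: "'a::chilbert_space set \<Rightarrow> 'b::chilbert_space set \<Rightarrow> ('a \<Rightarrow> 'b) set"
  where "contractions N N' = {T \<in> N \<rightarrow>\<^sub>E N'.
    (\<forall>x\<in>N. \<forall>y\<in>N. T (x + y) = T x + T y) \<and>
    (\<forall>c. \<forall>x\<in>N. T (c *\<^sub>C x) = c *\<^sub>C T x) \<and>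
    (\<forall>x\<in>N. norm (T x) \<le> norm x)}"

text \<open>Complex differentiability in operator norm at every point of the unit disc.\<close>

definition op_analytic_on_disc ::
  "'a::chilbert_space set \<Rightarrow> (complex \<Rightarrow> 'a \<Rightarrow> 'b::chilbert_space) \<Rightarrow> bool"
  where "op_analytic_on_disc N \<Phi> \<longleftrightarrow>
    (\<forall>\<zeta>\<in>ball 0 1. \<exists>T. \<forall>\<epsilon>>0. \<forall>\<^sub>F z in at \<zeta>. \<forall>x\<in>N.
      norm (inverse (z - \<zeta>) *\<^sub>C (\<Phi> z x - \<Phi> \<zeta> x) - T x) \<le> \<epsilon> * norm x)"

definition schur_class ::
  "'a::chilbert_space set \<Rightarrow> 'b::chilbert_space set \<Rightarrow> (complex \<Rightarrow> 'a \<Rightarrow> 'b) set"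
  where "schur_class N N' = {\<Phi> \<in> ball 0 1 \<rightarrow>\<^sub>E contractions N N'. op_analytic_on_disc N \<Phi>}"

text \<open>The denominator, an operator on the orthogonal complement of the domain of \<open>A\<close>.\<close>

definition denom :: "nat \<Rightarrow> ((nat \<Rightarrow> 'h::chilbert_space) \<Rightarrow> 'k::chilbert_space) \<Rightarrow>
    (complex \<Rightarrow> 'k \<Rightarrow> 'k) \<Rightarrow> complex \<Rightarrow> 'k \<Rightarrow> 'k"
  where "denom d cls \<Phi> \<zeta> x = x + calC d cls \<zeta> (\<Phi> \<zeta> x)"

definition nevanlinna_relation :: "nat \<Rightarrow> (nat \<Rightarrow> 'h \<Rightarrow> 'h::chilbert_space) \<Rightarrow>
    ((nat \<Rightarrow> 'h) \<Rightarrow> 'k::chilbert_space) \<Rightarrow> (complex \<Rightarrow> 'k \<Rightarrow> 'k) \<Rightarrow> (real \<Rightarrow> 'h \<Rightarrow> 'h) \<Rightarrow> bool"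
  where "nevanlinna_relation d S cls \<Phi> F \<longleftrightarrow> (\<forall>\<zeta>\<in>ball 0 1.
    has_rs_integral
      (\<lambda>t. (1 + \<zeta> * exp (\<i> * of_real t)) / (1 - \<zeta> * exp (\<i> * of_real t))) F 0 (2 * pi)
      (\<lambda>h. calA d S cls \<zeta> h
        + calB d cls \<zeta> (\<Phi> \<zeta> (inv_into (ocompl (domA d cls)) (denom d cls \<Phi> \<zeta>) (calD d cls \<zeta> h)))))"

end

(* A parameter Phi extends A to the contractions T_z = A P_D + Phi_z P_N on H (N the orthogonal
   complement of D = D(A)), and the right-hand side of the relation is 2 I^* (1 - z T_z)^(-1) I - S_0:
   this is a Schur complement computation for the decomposition of H into D and N.

   From Phi to F: contractivity gives the right-hand side a non-negative real part, so it is the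
   Herglotz transform of an operator distribution function F. Since T_z x_{h,j} = x_{h,j+1} for j < d,
   its Taylor coefficients up to order d are the prescribed moments. F is unique because the transform
   determines all trigonometric moments, hence the integrals of all continuous functions on the circle,
   hence F.

   From F to Phi: let W_f be the operator in H with form
   (x_{h,j}, x_{g,k}) |-> integral of f(t) e^{i(j-k)t} d(F(t) h, g), a compression of multiplication
   by f. With e = e^{it}, the operators R = W_{1/(1-ze)} and Q = W_{e/(1-ze)} satisfy R = 1 + z Q, and
   |Q x| <= |R x| follows from 2 Re (R x, x) - |x|^2 = (1 - |z|^2) (W_{|e/(1-ze)|^2} x, x). Hence
   T_z = Q R^(-1) is a contraction with R = (1 - z T_z)^(-1); it extends A, and Phi_z is its restriction
   to N. Phi is unique because the relation determines the forms of (1 - z T_z)^(-1) on the vectors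
   x_{h,j} recursively in j. *)
theory Submission
  imports Defs "HOL-Complex_Analysis.Complex_Analysis"
begin

section \<open>Hilbert space preliminaries\<close>

text \<open>No spectral measure and no unitary dilation is constructed; F enters only through the
  non-negative forms of its increments. The estimate that carries the analysis is 2 |B(h,g)| <=
  B(h,h) + B(g,g) for such a form B: its right-hand side is additive in B, so it can be summed over
  the cells of a division and passes to pointwise limits. The price is that W_{fg} is not W_f W_g.
  Hence T_z is Q R^(-1) and not the compression of multiplication by e, and it depends on z.

  The second difficulty is the normalisation. F(0) = 0 with left-continuity up to 2 pi places a
  point mass of the circle at angle 0 in the jump directly after 0 and forbids a jump at 2 pi, while
  a limit of approximating distributions may leave mass at 2 pi and need not be left-continuous. One
  theorem, \<open>left_continuous_representation\<close>, repairs both without altering the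
  integrals of periodic functions. Applied to F itself, it also supplies the integrals of all
  continuous functions.\<close>

lemma scaleC_one [simp]: "1 *\<^sub>C x = (x::'a::complex_inner)"
  using scaleR_scaleC[of 1 x] by simp

lemma scaleC_minus_one: "(-1) *\<^sub>C x = - (x::'a::complex_inner)"
  using scaleR_scaleC[of "-1" x] by simp

lemma cinner_add_right: "cinner x (y + z) = cinner x y + cinner x z"
  by (metis cinner_add_left cinner_commute complex_cnj_add)

lemma cinner_scaleC_right: "cinner x (a *\<^sub>C y) = cnj a * cinner x y"
  by (metis cinner_scaleC_left cinner_commute complex_cnj_mult)

lemma norm_scaleC [simp]: "norm (a *\<^sub>C x) = cmod a * norm (x::'a::complex_inner)"
proof -
  have "complex_of_real ((norm (a *\<^sub>C x))\<^sup>2) = cinner (a *\<^sub>C x) (a *\<^sub>C x)" by (rule cinner_self[symmetric])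
  also have "\<dots> = (a * cnj a) * cinner x x" by (simp add: cinner_scaleC_left cinner_scaleC_right)
  also have "\<dots> = complex_of_real ((cmod a * norm x)\<^sup>2)"
    by (simp add: cinner_self complex_norm_square[symmetric] power_mult_distrib)
  finally have "(norm (a *\<^sub>C x))\<^sup>2 = (cmod a * norm x)\<^sup>2" by (simp only: of_real_eq_iff)
  then show ?thesis by (rule power2_eq_imp_eq) auto
qed

lemma Re_cinner_le: "Re (cinner x y) \<le> norm x * norm y"
  using Cauchy_Schwarz_ineq2[of x y] by (simp add: inner_eq_Re_cinner)

lemma cmod_cinner_le: "cmod (cinner x y) \<le> norm x * norm y"
proof (cases "cinner x y = 0")
  case False
  \<comment> \<open>A unimodular factor makes the product real and non-negative, so the real
    Cauchy-Schwarz inequality applies to c x and y.\<close>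
  define c where "c = cnj (sgn (cinner x y))"
  have c: "cmod c = 1" using False by (simp add: c_def norm_sgn)
  have "c * cinner x y = complex_of_real (cmod (cinner x y))"
  proof -
    have "c * cinner x y = (cinner x y * cnj (cinner x y)) / complex_of_real (cmod (cinner x y))"
      by (simp add: c_def sgn_eq)
    also have "\<dots> = complex_of_real (cmod (cinner x y))"
      using False by (simp add: complex_norm_square[symmetric] power2_eq_square)
    finally show ?thesis .
  qed
  then have "cmod (cinner x y) = Re (cinner (c *\<^sub>C x) y)" by (simp add: cinner_scaleC_left)
  also have "\<dots> \<le> norm x * norm y" using Re_cinner_le[of "c *\<^sub>C x" y] c by simp
  finally show ?thesis .
qed simp

interpretation cinner: bounded_bilinear cinner
proof
  fix a a' b b' :: "'a::complex_inner" and r :: real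
  show "cinner (a + a') b = cinner a b + cinner a' b" by (rule cinner_add_left)
  show "cinner a (b + b') = cinner a b + cinner a b'" by (rule cinner_add_right)
  show "cinner (r *\<^sub>R a) b = r *\<^sub>R cinner a b"
    by (simp add: scaleR_scaleC[of r a] cinner_scaleC_left scaleR_conv_of_real)
  show "cinner a (r *\<^sub>R b) = r *\<^sub>R cinner a b"
    by (simp add: scaleR_scaleC[of r b] cinner_scaleC_right scaleR_conv_of_real)
  show "\<exists>K. \<forall>a b::'a. cmod (cinner a b) \<le> norm a * norm b * K"
    by (intro exI[of _ 1]) (simp add: cmod_cinner_le)
qed

interpretation scaleC: bounded_bilinear "(*\<^sub>C)"
proof
  fix a a' :: complex and b b' :: "'a::complex_inner" and r :: real
  show "(a + a') *\<^sub>C b = a *\<^sub>C b + a' *\<^sub>C b" by (rule scaleC_add_left)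
  show "a *\<^sub>C (b + b') = a *\<^sub>C b + a *\<^sub>C b'" by (rule scaleC_add_right)
  show "(r *\<^sub>R a) *\<^sub>C b = r *\<^sub>R a *\<^sub>C b" 
    by (simp add: scaleR_scaleC[of r "a *\<^sub>C b"] scaleC_scaleC scaleR_conv_of_real)
  show "a *\<^sub>C r *\<^sub>R b = r *\<^sub>R a *\<^sub>C b"
    by (simp add: scaleR_scaleC[of r b] scaleR_scaleC[of r "a *\<^sub>C b"] scaleC_scaleC mult.commute)
  show "\<exists>K. \<forall>a. \<forall>b::'a. norm (a *\<^sub>C b) \<le> norm a * norm b * K"
    by (intro exI[of _ 1]) simp
qed

lemma cinner_ext_left: "(\<And>y. cinner x y = cinner x' y) \<Longrightarrow> x = x'"
  by (metis cinner.diff_left cinner_self diff_self eq_iff_diff_eq_0 norm_eq_zero of_real_eq_0_iff power_eq_0_iff)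

lemma cinner_eq_zero_commute: "cinner x y = 0 \<longleftrightarrow> cinner y x = 0"
  by (metis cinner_commute complex_cnj_zero_iff)

lemma norm_add_cinner: "(norm (x + y))\<^sup>2 = (norm x)\<^sup>2 + 2 * Re (cinner x y) + (norm y)\<^sup>2"
  for x y :: "'a::complex_inner"
  using dot_norm[of x y] by (simp add: inner_eq_Re_cinner)

lemma norm_diff_cinner: "(norm (x - y))\<^sup>2 = (norm x)\<^sup>2 - 2 * Re (cinner x y) + (norm y)\<^sup>2"
  for x y :: "'a::complex_inner"
  using norm_add_cinner[of x "- y"] by (simp add: cinner.minus_right)

text \<open>The bridge from form estimates to strong ones: a bound uniform over g in the unit ball
  bounds the vector, as g = x / |x| shows.\<close>

lemma norm_le_if_cinner_le:
  fixes x :: "'a::complex_inner"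
  assumes "\<And>g. norm g \<le> 1 \<Longrightarrow> cmod (cinner x g) \<le> c"
  shows "norm x \<le> c"
proof (cases "x = 0")
  case False
  have "cmod (cinner x (complex_of_real (inverse (norm x)) *\<^sub>C x)) \<le> c"
    using assms False by (simp add: norm_inverse)
  then show ?thesis
    using False by (simp add: cinner_scaleC_right cinner_self norm_mult norm_power power2_eq_square norm_inverse field_simps)
qed (use assms[of 0] in \<open>simp add: cinner.zero_left\<close>)

section \<open>Subspaces, Riesz representation and orthogonal projections\<close>

definition csubspace :: "'a::complex_inner set \<Rightarrow> bool"
  where "csubspace V \<longleftrightarrow> 0 \<in> V \<and> (\<forall>x\<in>V. \<forall>y\<in>V. x + y \<in> V) \<and> (\<forall>c. \<forall>x\<in>V. c *\<^sub>C x \<in> V)"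

lemma csubspace_0: "csubspace V \<Longrightarrow> 0 \<in> V"
  and csubspace_add: "csubspace V \<Longrightarrow> x \<in> V \<Longrightarrow> y \<in> V \<Longrightarrow> x + y \<in> V"
  and csubspace_scaleC: "csubspace V \<Longrightarrow> x \<in> V \<Longrightarrow> c *\<^sub>C x \<in> V"
  by (auto simp: csubspace_def)

lemma csubspace_uminus: "csubspace V \<Longrightarrow> x \<in> V \<Longrightarrow> - x \<in> V"
  using csubspace_scaleC[of V x "-1"] by (simp add: scaleC_minus_one)

lemma csubspace_diff: "csubspace V \<Longrightarrow> x \<in> V \<Longrightarrow> y \<in> V \<Longrightarrow> x - y \<in> V"
  using csubspace_add[of V x "- y"] csubspace_uminus[of V y] by simp

lemma csubspace_scaleR: "csubspace V \<Longrightarrow> x \<in> V \<Longrightarrow> r *\<^sub>R x \<in> V"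
  by (simp add: scaleR_scaleC csubspace_scaleC)

lemma csubspace_UNIV: "csubspace UNIV"
  by (simp add: csubspace_def)

text \<open>The representing vector minimises \<open>\<Parallel>x\<Parallel>\<^sup>2 - 2 Re (\<phi> x)\<close>; the subspace need not be closed, so
  that this covers both the projection theorem and functionals given on a dense subspace.\<close>

lemma riesz_csubspace:
  fixes \<phi> :: "'a::chilbert_space \<Rightarrow> complex"
  assumes V: "csubspace V"
    and add: "\<And>x y. x \<in> V \<Longrightarrow> y \<in> V \<Longrightarrow> \<phi> (x + y) = \<phi> x + \<phi> y"
    and scale: "\<And>c x. x \<in> V \<Longrightarrow> \<phi> (c *\<^sub>C x) = c * \<phi> x"
    and bound: "\<And>x. x \<in> V \<Longrightarrow> cmod (\<phi> x) \<le> M * norm x"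
  shows "\<exists>w\<in>closure V. \<forall>x\<in>V. \<phi> x = cinner x w"
proof -
  define q where "q x = (norm x)\<^sup>2 - 2 * Re (\<phi> x)" for x
  define m where "m = Inf (q ` V)"
  have q_ge: "- M\<^sup>2 \<le> q x" if "x \<in> V" for x
  proof -
    have "Re (\<phi> x) \<le> M * norm x" using bound[OF that] complex_Re_le_cmod[of "\<phi> x"] by linarith
    moreover have "0 \<le> (norm x - M)\<^sup>2" by simp
    ultimately show ?thesis by (simp add: q_def power2_eq_square algebra_simps)
  qed
  have bdd: "bdd_below (q ` V)" using q_ge by (auto intro!: bdd_belowI2)
  have ne: "q ` V \<noteq> {}" using V by (auto simp: csubspace_def)
  have m_le: "m \<le> q x" if "x \<in> V" for x unfolding m_def using bdd that by (intro cInf_lower) auto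
  have "\<exists>x\<in>V. q x < m + 1 / real (Suc n)" for n
    using cInf_lessD[OF ne, of "m + 1 / real (Suc n)"] by (auto simp: m_def)
  then obtain X where X: "\<And>n. X n \<in> V" "\<And>n. q (X n) < m + 1 / real (Suc n)" by metis
  have half: "(1/2) *\<^sub>R (x + y) \<in> V" if "x \<in> V" "y \<in> V" for x y
    using V that by (auto intro: csubspace_scaleR csubspace_add)
  \<comment> \<open>The midpoint lies in V, so its q-value is at least m; with the parallelogram law
    this makes every minimising sequence Cauchy.\<close>
  have par: "(norm (x - y))\<^sup>2 \<le> 2 * (q x - m) + 2 * (q y - m)" if xy: "x \<in> V" "y \<in> V" for x y
  proof -
    have "2 * Re (\<phi> ((1/2) *\<^sub>R (x + y))) = Re (\<phi> x + \<phi> y)"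
      by (simp add: scaleR_scaleC scale add csubspace_add[OF V] xy)
    then have "q ((1/2) *\<^sub>R (x + y)) = (norm (x + y))\<^sup>2 / 4 - Re (\<phi> x + \<phi> y)"
      unfolding q_def norm_scaleR by (simp add: power_divide power_mult_distrib del: scaleR_right_distrib scaleR_add_right One_nat_def)
    moreover have "m \<le> q ((1/2) *\<^sub>R (x + y))" using m_le[OF half[OF xy]] .
    moreover have "(norm (x + y))\<^sup>2 + (norm (x - y))\<^sup>2 = 2 * (norm x)\<^sup>2 + 2 * (norm y)\<^sup>2"
      by (simp add: norm_add_cinner norm_diff_cinner)
    ultimately show ?thesis by (simp add: q_def)
  qed
  have "Cauchy X"
  proof (rule metric_CauchyI)
    fix e :: real assume e: "0 < e"
    have "0 < e\<^sup>2 / 4" using e by simp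
    then obtain N where N: "1 / real (Suc N) < e\<^sup>2 / 4" by (rule nat_approx_posE)
    show "\<exists>M. \<forall>m\<ge>M. \<forall>n\<ge>M. dist (X m) (X n) < e"
    proof (intro exI allI impI)
      fix k l assume kl: "N \<le> k" "N \<le> l"
      have "1 / real (Suc k) \<le> 1 / real (Suc N)" "1 / real (Suc l) \<le> 1 / real (Suc N)"
        using kl by (auto intro!: divide_left_mono)
      then have "(norm (X k - X l))\<^sup>2 < e\<^sup>2"
        using par[OF X(1)[of k] X(1)[of l]] X(2)[of k] X(2)[of l] N by argo
      then show "dist (X k) (X l) < e" using e by (simp add: dist_norm power2_less_imp_less)
    qed
  qed
  then obtain w where w: "X \<longlonglongrightarrow> w" using Cauchy_convergent convergent_def by blast
  have qX: "(\<lambda>n. q (X n)) \<longlonglongrightarrow> m"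
  proof (rule real_tendsto_sandwich)
    show "\<forall>\<^sub>F n in sequentially. m \<le> q (X n)" using m_le X(1) by simp
    show "\<forall>\<^sub>F n in sequentially. q (X n) \<le> m + 1 / real (Suc n)" using X(2) by (intro always_eventually allI less_imp_le)
    show "(\<lambda>n. m + 1 / real (Suc n)) \<longlonglongrightarrow> m" using LIMSEQ_Suc[OF lim_1_over_n, THEN tendsto_add[OF tendsto_const]]
      by simp
  qed simp
  have "\<phi> v = cinner v w" if v: "v \<in> V" for v
  proof -
    define a where "a = cinner v w - \<phi> v"
    \<comment> \<open>Minimality of m against X n + c v, in the limit over n, gives a quadratic
      inequality in c whose linear part is the defect a.\<close>
    have ineq: "0 \<le> 2 * Re (c * a) + (cmod c * norm v)\<^sup>2" for c
    proof -
      have "m \<le> q (X n) + (2 * Re (c * (cinner v (X n) - \<phi> v)) + (cmod c * norm v)\<^sup>2)" for n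
      proof -
        have "q (X n + c *\<^sub>C v) = q (X n) + (2 * Re (c * (cinner v (X n) - \<phi> v)) + (cmod c * norm v)\<^sup>2)"
          unfolding q_def norm_add_cinner using V v X(1)
          by (simp add: add scale csubspace_scaleC cinner_scaleC_right cinner_commute[of "X n" v] algebra_simps)
        then show ?thesis using m_le[of "X n + c *\<^sub>C v"] V v X(1) by (simp add: csubspace_add csubspace_scaleC)
      qed
      moreover have "(\<lambda>n. q (X n) + (2 * Re (c * (cinner v (X n) - \<phi> v)) + (cmod c * norm v)\<^sup>2))
         \<longlonglongrightarrow> m + (2 * Re (c * (cinner v w - \<phi> v)) + (cmod c * norm v)\<^sup>2)"
        by (intro tendsto_intros qX cinner.tendsto w)
      ultimately have "m \<le> m + (2 * Re (c * (cinner v w - \<phi> v)) + (cmod c * norm v)\<^sup>2)"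
        by (intro LIMSEQ_le_const) auto
      then show ?thesis by (simp add: a_def)
    qed
    \<comment> \<open>At c = - t cnj a the linear part is -2 t |a|^2, and this t keeps the quadratic
      part (t |a| |v|)^2 below t |a|^2 unless a = 0.\<close>
    define t where "t = 1 / (1 + (norm v)\<^sup>2)"
    have t: "0 < t" "t * (norm v)\<^sup>2 < 1" by (auto simp: t_def add_pos_nonneg divide_simps)
    have "Re (cnj a * a) = (cmod a)\<^sup>2" by (metis Re_complex_of_real complex_norm_square mult.commute)
    then have "0 \<le> 2 * (- (t * (cmod a)\<^sup>2)) + (t * cmod a * norm v)\<^sup>2"
      using ineq[of "- (t * cnj a)"] t by (simp add: norm_mult mult.assoc)
    moreover have "2 * (- (t * (cmod a)\<^sup>2)) + (t * cmod a * norm v)\<^sup>2 = t * ((cmod a)\<^sup>2 * (t * (norm v)\<^sup>2 - 2))"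
      by (simp add: power2_eq_square algebra_simps)
    ultimately have "0 \<le> t * ((cmod a)\<^sup>2 * (t * (norm v)\<^sup>2 - 2))" by simp
    then have "0 \<le> (cmod a)\<^sup>2 * (t * (norm v)\<^sup>2 - 2)" using t(1) zero_le_mult_iff[of t] by auto
    moreover have "t * (norm v)\<^sup>2 - 2 < 0" using t(2) by simp
    ultimately have "(cmod a)\<^sup>2 \<le> 0" by (simp only: zero_le_mult_iff) auto
    then have "a = 0" by simp
    then show ?thesis by (simp add: a_def)
  qed
  moreover have "w \<in> closure V" using w X(1) closure_sequential by blast
  ultimately show ?thesis by blast
qed

lemma cinner_closure_eq:
  fixes w w' :: "'a::chilbert_space"
  assumes "w \<in> closure V" "w' \<in> closure V" "csubspace V" and "\<And>x. x \<in> V \<Longrightarrow> cinner x w = cinner x w'"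
  shows "w = w'"
proof -
  have "closed {x. cinner x (w - w') = 0}"
    by (intro closed_Collect_eq continuous_intros cinner.continuous_on)
  then have *: "closure V \<subseteq> {x. cinner x (w - w') = 0}"
    by (rule closure_minimal[rotated]) (use assms(4) in \<open>auto simp: cinner.diff_right\<close>)
  have "cinner (w - w') (w - w') = 0"
    using * assms(1,2) by (simp add: cinner.diff_left subset_iff)
  then show ?thesis by (simp add: cinner_self)
qed

text \<open>The projection of x represents the functional v |-> (v, x) on K, so the Riesz lemma
  applies; closedness puts the representing vector into K.\<close>

lemma oproj_exists:
  fixes x :: "'a::chilbert_space"
  assumes "csubspace K" "closed K"
  shows "\<exists>!y. y \<in> K \<and> x - y \<in> ocompl K"
proof -
  obtain w where w: "w \<in> closure K" "\<forall>v\<in>K. cinner v x = cinner v w"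
    using riesz_csubspace[OF assms(1), of "\<lambda>v. cinner v x" "norm x"]
    by (auto simp: cinner_add_left cinner_scaleC_left cmod_cinner_le mult.commute)
  then have wK: "w \<in> K" using assms(2) by (simp add: closure_closed)
  have orth: "y \<in> K \<and> x - y \<in> ocompl K \<longleftrightarrow> y \<in> K \<and> (\<forall>v\<in>K. cinner v y = cinner v x)" for y
    by (auto simp: ocompl_def cinner_eq_zero_commute[of "x - y"] cinner.diff_right)
  show ?thesis
  proof (rule ex1I[of _ w])
    show "w \<in> K \<and> x - w \<in> ocompl K" unfolding orth using w(2) wK by auto
  next
    fix y assume "y \<in> K \<and> x - y \<in> ocompl K"
    then show "y = w" unfolding orth using w(2) wK
      by (intro cinner_closure_eq[OF _ _ assms(1)]) (auto intro: closure_subset[THEN subsetD])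
  qed
qed

lemma oproj_in: "csubspace K \<Longrightarrow> closed K \<Longrightarrow> oproj K x \<in> K"
  and oproj_diff: "csubspace K \<Longrightarrow> closed K \<Longrightarrow> x - oproj K x \<in> ocompl K"
  using theI'[OF oproj_exists[of K x]] by (auto simp: oproj_def)

lemma oproj_eqI: "csubspace K \<Longrightarrow> closed K \<Longrightarrow> y \<in> K \<Longrightarrow> x - y \<in> ocompl K \<Longrightarrow> oproj K x = y"
  unfolding oproj_def by (rule the1_equality[OF oproj_exists]) auto

lemma csubspace_ocompl: "csubspace (ocompl K)"
  by (auto simp: csubspace_def ocompl_def cinner_add_left cinner_scaleC_left cinner.zero_left)

lemma closed_ocompl: "closed (ocompl K)"
proof -
  have "ocompl K = (\<Inter>y\<in>K. {x. cinner x y = 0})" by (auto simp: ocompl_def)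
  moreover have "closed {x. cinner x y = 0}" for y :: 'a
    by (intro closed_Collect_eq continuous_intros cinner.continuous_on)
  ultimately show ?thesis by auto
qed

lemma oproj_id: "csubspace K \<Longrightarrow> closed K \<Longrightarrow> x \<in> K \<Longrightarrow> oproj K x = x"
  by (rule oproj_eqI) (auto simp: ocompl_def cinner.zero_left)

lemma oproj_ocompl:
  assumes "csubspace K" "closed K"
  shows "oproj (ocompl K) x = x - oproj K x"
proof (rule oproj_eqI[OF csubspace_ocompl closed_ocompl oproj_diff[OF assms]])
  show "x - (x - oproj K x) \<in> ocompl (ocompl K)"
    using oproj_in[OF assms, of x] by (simp add: ocompl_def) (metis cinner_eq_zero_commute)
qed

lemma oproj_add:
  assumes "csubspace K" "closed K"
  shows "oproj K (x + y) = oproj K x + oproj K y"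
proof (rule oproj_eqI[OF assms])
  show "oproj K x + oproj K y \<in> K" using assms by (simp add: csubspace_add oproj_in)
  have "x + y - (oproj K x + oproj K y) = (x - oproj K x) + (y - oproj K y)" by simp
  then show "x + y - (oproj K x + oproj K y) \<in> ocompl K"
    using csubspace_add[OF csubspace_ocompl oproj_diff[OF assms] oproj_diff[OF assms]] by metis
qed

lemma oproj_scaleC:
  assumes "csubspace K" "closed K"
  shows "oproj K (c *\<^sub>C x) = c *\<^sub>C oproj K x"
proof (rule oproj_eqI[OF assms])
  show "c *\<^sub>C oproj K x \<in> K" using assms by (simp add: csubspace_scaleC oproj_in)
  have "c *\<^sub>C x - c *\<^sub>C oproj K x = c *\<^sub>C (x - oproj K x)" by (simp add: scaleC.diff_right)
  then show "c *\<^sub>C x - c *\<^sub>C oproj K x \<in> ocompl K"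
    using csubspace_scaleC[OF csubspace_ocompl oproj_diff[OF assms]] by metis
qed

lemma norm_oproj_pythagoras:
  assumes "csubspace K" "closed K"
  shows "(norm x)\<^sup>2 = (norm (oproj K x))\<^sup>2 + (norm (x - oproj K x))\<^sup>2"
proof -
  have "cinner (x - oproj K x) (oproj K x) = 0"
    using oproj_in[OF assms, of x] oproj_diff[OF assms, of x] by (auto simp: ocompl_def)
  then show ?thesis using norm_add_cinner[of "x - oproj K x" "oproj K x"] by simp
qed

lemma norm_oproj_le: "csubspace K \<Longrightarrow> closed K \<Longrightarrow> norm (oproj K x) \<le> norm x"
  using norm_oproj_pythagoras[of K x] by (metis le_add_same_cancel1 norm_ge_zero power2_le_imp_le zero_le_power2)

section \<open>Bounded operators, operators of forms, adjoints\<close>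

lemma bounded_clinearI:
  assumes "\<And>x y. T (x + y) = T x + T y" "\<And>c x. T (c *\<^sub>C x) = c *\<^sub>C T x"
    and "\<And>x. norm (T x) \<le> norm x * K"
  shows "bounded_clinear T"
proof -
  have "bounded_linear T"
    by (rule bounded_linear_intro[OF assms(1) _ assms(3)]) (metis scaleR_scaleC assms(2))
  then show ?thesis by (simp add: bounded_clinear_def assms(2))
qed

lemma bounded_clinear_add: "bounded_clinear T \<Longrightarrow> T (x + y) = T x + T y"
  and bounded_clinear_diff: "bounded_clinear T \<Longrightarrow> T (x - y) = T x - T y"
  and bounded_clinear_0: "bounded_clinear T \<Longrightarrow> T 0 = 0"
  and bounded_clinear_sum: "bounded_clinear T \<Longrightarrow> T (sum f A) = (\<Sum>a\<in>A. T (f a))"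
  and bounded_clinear_scaleC: "bounded_clinear T \<Longrightarrow> T (c *\<^sub>C x) = c *\<^sub>C T x"
  by (auto simp: bounded_clinear_def linear_simps linear_sum bounded_linear.linear)

lemma bounded_clinear_bound:
  assumes "bounded_clinear T" obtains K where "0 < K" "\<And>x. norm (T x) \<le> norm x * K"
  using assms bounded_linear.pos_bounded unfolding bounded_clinear_def by blast

lemma bounded_clinear_continuous: "bounded_clinear T \<Longrightarrow> continuous_on A T"
  by (simp add: bounded_clinear_def linear_continuous_on)

text \<open>Two applications of the Riesz lemma: first in the left argument for fixed \<open>y\<close>, then in \<open>y\<close>;
  this extends the operator to the whole space without any limiting argument.\<close>

lemma form_operator_dense:
  fixes B :: "'a::chilbert_space \<Rightarrow> 'a \<Rightarrow> complex"
  assumes V: "csubspace V" "closure V = UNIV"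
    and addl: "\<And>x y z. x \<in> V \<Longrightarrow> y \<in> V \<Longrightarrow> z \<in> V \<Longrightarrow> B (x + y) z = B x z + B y z"
    and addr: "\<And>x y z. x \<in> V \<Longrightarrow> y \<in> V \<Longrightarrow> z \<in> V \<Longrightarrow> B x (y + z) = B x y + B x z"
    and scl: "\<And>c x y. x \<in> V \<Longrightarrow> y \<in> V \<Longrightarrow> B (c *\<^sub>C x) y = c * B x y"
    and scr: "\<And>c x y. x \<in> V \<Longrightarrow> y \<in> V \<Longrightarrow> B x (c *\<^sub>C y) = cnj c * B x y"
    and bound: "\<And>x y. x \<in> V \<Longrightarrow> y \<in> V \<Longrightarrow> cmod (B x y) \<le> C * norm x * norm y"
    and C: "0 \<le> C"
  shows "\<exists>T. bounded_clinear T \<and> (\<forall>x\<in>V. \<forall>y\<in>V. cinner (T x) y = B x y) \<and> (\<forall>x. norm (T x) \<le> C * norm x)"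
proof -
  have eqI: "w = w'" if "\<And>x. x \<in> V \<Longrightarrow> cinner x w = cinner x w'" for w w'
    by (rule cinner_closure_eq[OF _ _ V(1)]) (use V(2) that in auto)
  have nrm: "norm w \<le> c" if "\<And>x. x \<in> V \<Longrightarrow> cmod (cinner x w) \<le> c * norm x" "0 \<le> c" for w c
  proof -
    have "closed {x. cmod (cinner x w) \<le> c * norm x}"
      by (intro closed_Collect_le continuous_intros cinner.continuous_on)
    then have "closure V \<subseteq> {x. cmod (cinner x w) \<le> c * norm x}"
      by (rule closure_minimal[rotated]) (use that in auto)
    then have "cmod (cinner w w) \<le> c * norm w" using V(2) by auto
    then have "norm w * norm w \<le> c * norm w" by (simp add: cinner_self norm_power norm_mult power2_eq_square)
    then show ?thesis by (cases "w = 0") (use that in auto)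
  qed
  have "\<exists>w. \<forall>x\<in>V. B x y = cinner x w" if y: "y \<in> V" for y
  proof -
    have "cmod (B x y) \<le> C * norm y * norm x" if "x \<in> V" for x using bound[OF that y] by (simp add: mult_ac)
    then show ?thesis using riesz_csubspace[OF V(1), of "\<lambda>x. B x y" "C * norm y"] y addl scl by auto
  qed
  then obtain w where w: "\<And>x y. x \<in> V \<Longrightarrow> y \<in> V \<Longrightarrow> B x y = cinner x (w y)" by metis
  have wadd: "w (x + y) = w x + w y" if "x \<in> V" "y \<in> V" for x y
    by (rule eqI) (use that V(1) in \<open>auto simp: w[symmetric] csubspace_add addr cinner_add_right\<close>)
  have wsc: "w (c *\<^sub>C x) = c *\<^sub>C w x" if "x \<in> V" for x c
    by (rule eqI) (use that V(1) in \<open>auto simp: w[symmetric] csubspace_scaleC scr cinner_scaleC_right\<close>)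
  have wn: "norm (w y) \<le> C * norm y" if "y \<in> V" for y
    using C that bound[OF _ that] by (intro nrm) (auto simp: w[symmetric] mult_ac)
  have "\<exists>t. \<forall>y\<in>V. cinner (w y) x = cinner y t" for x
  proof -
    have "cmod (cinner (w y) x) \<le> C * norm x * norm y" if "y \<in> V" for y
      using mult_right_mono[OF wn[OF that], of "norm x"] cmod_cinner_le[of "w y" x] by (simp add: mult_ac)
    then show ?thesis using riesz_csubspace[OF V(1), of "\<lambda>y. cinner (w y) x" "C * norm x"]
      by (auto simp: wadd wsc cinner_add_left cinner_scaleC_left)
  qed
  then obtain T where T: "\<And>x y. y \<in> V \<Longrightarrow> cinner (w y) x = cinner y (T x)" by metis
  have Tn: "norm (T x) \<le> C * norm x" for x
  proof (rule nrm)
    show "cmod (cinner y (T x)) \<le> C * norm x * norm y" if "y \<in> V" for y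
      using mult_right_mono[OF wn[OF that], of "norm x"] cmod_cinner_le[of "w y" x] 
      by (simp add: T[symmetric] that mult_ac)
  qed (simp add: C)
  have "bounded_clinear T"
  proof (rule bounded_clinearI)
    show "T (x + y) = T x + T y" for x y
      by (rule eqI) (simp add: T[symmetric] cinner_add_right)
    show "T (c *\<^sub>C x) = c *\<^sub>C T x" for c x
      by (rule eqI) (simp add: T[symmetric] cinner_scaleC_right)
    show "norm (T x) \<le> norm x * C" for x using Tn by (simp add: mult.commute)
  qed
  moreover have "cinner (T x) y = B x y" if "x \<in> V" "y \<in> V" for x y
    using T[OF that(2), of x] w[OF that] by (metis cinner_commute)
  ultimately show ?thesis using Tn by blast
qed

lemma cadjoint_cinner:
  fixes T :: "'a::chilbert_space \<Rightarrow> 'b::chilbert_space"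
  assumes "bounded_clinear T"
  shows "cinner (T x) y = cinner x (cadjoint T y)"
proof -
  obtain K where K: "\<And>x. norm (T x) \<le> norm x * K" using bounded_clinear_bound[OF assms] by metis
  have "\<exists>w. \<forall>x. cinner (T x) y = cinner x w" for y
  proof -
    have "cmod (cinner (T x) y) \<le> K * norm y * norm x" for x
      using mult_right_mono[OF K[of x], of "norm y"] cmod_cinner_le[of "T x" y] by (simp add: mult_ac)
    then show ?thesis using riesz_csubspace[OF csubspace_UNIV, of "\<lambda>x. cinner (T x) y" "K * norm y"]
      by (auto simp: assms bounded_clinear_add bounded_clinear_scaleC cinner_add_left cinner_scaleC_left)
  qed
  then obtain T' where T': "\<forall>x y. cinner (T x) y = cinner x (T' y)" by metis
  have "cadjoint T = T'"
    unfolding cadjoint_def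
  proof (rule the_equality)
    fix S assume S: "\<forall>x y. cinner (T x) y = cinner x (S y)"
    show "S = T'"
    proof
      fix y show "S y = T' y"
        by (rule cinner_ext_left) (metis S T' cinner_commute)
    qed
  qed (rule T')
  then show ?thesis using T' by simp
qed

section \<open>Sesquilinear forms\<close>

definition sesq :: "('h::complex_inner \<Rightarrow> 'h \<Rightarrow> complex) \<Rightarrow> bool"
  where "sesq B \<longleftrightarrow> (\<forall>x y z. B (x + y) z = B x z + B y z) \<and> (\<forall>x y z. B x (y + z) = B x y + B x z) \<and>
    (\<forall>c x y. B (c *\<^sub>C x) y = c * B x y) \<and> (\<forall>c x y. B x (c *\<^sub>C y) = cnj c * B x y)"

definition psd :: "('h::complex_inner \<Rightarrow> 'h \<Rightarrow> complex) \<Rightarrow> bool"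
  where "psd B \<longleftrightarrow> sesq B \<and> (\<forall>x. B x x \<in> \<real>\<^sub>\<ge>\<^sub>0)"

lemma sesqD:
  assumes "sesq B"
  shows "B (x + y) z = B x z + B y z" "B x (y + z) = B x y + B x z"
    "B (c *\<^sub>C x) y = c * B x y" "B x (c *\<^sub>C y) = cnj c * B x y"
    "B 0 y = 0" "B x 0 = 0" "B (x - y) z = B x z - B y z" "B x (y - z) = B x y - B x z"
proof -
  have l: "\<And>x y z. B (x + y) z = B x z + B y z" and r: "\<And>x y z. B x (y + z) = B x y + B x z"
    and lc: "\<And>c x y. B (c *\<^sub>C x) y = c * B x y" and rc: "\<And>c x y. B x (c *\<^sub>C y) = cnj c * B x y"
    using assms unfolding sesq_def by blast+
  have z1: "B 0 y = 0" for y using l[of 0 0 y] by simp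
  have z2: "B x 0 = 0" for x using r[of x 0 0] by simp
  show "B (x + y) z = B x z + B y z" "B x (y + z) = B x y + B x z"
    "B (c *\<^sub>C x) y = c * B x y" "B x (c *\<^sub>C y) = cnj c * B x y" "B 0 y = 0" "B x 0 = 0"
    by (fact l r lc rc z1 z2)+
  show "B (x - y) z = B x z - B y z" using l[of "x - y" y z] by simp
  show "B x (y - z) = B x y - B x z" using r[of x "y - z" z] by simp
qed

lemma sesq_zero: "sesq (\<lambda>x y. 0)"
  by (simp add: sesq_def)

lemma sesq_mult: "sesq B \<Longrightarrow> sesq (\<lambda>x y. c * B x y)"
  by (auto simp: sesq_def distrib_left)

lemma sesq_plus: "sesq B \<Longrightarrow> sesq B' \<Longrightarrow> sesq (\<lambda>x y. B x y + B' x y)"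
  by (auto simp: sesq_def distrib_left)

lemma sesq_minus: "sesq B \<Longrightarrow> sesq B' \<Longrightarrow> sesq (\<lambda>x y. B x y - B' x y)"
  by (auto simp: sesq_def right_diff_distrib)

lemma sesq_sum: "(\<And>i. i \<in> A \<Longrightarrow> sesq (B i)) \<Longrightarrow> sesq (\<lambda>x y. \<Sum>i\<in>A. B i x y)"
  by (induction A rule: infinite_finite_induct) (auto intro: sesq_zero sesq_plus)

lemma psd_sesq: "psd B \<Longrightarrow> sesq B"
  by (simp add: psd_def)

lemma psd_nonneg: "psd B \<Longrightarrow> 0 \<le> Re (B x x)"
  and psd_Im: "psd B \<Longrightarrow> Im (B x x) = 0"
  by (auto simp: psd_def complex_nonneg_Reals_iff)

lemma psdI: "sesq B \<Longrightarrow> (\<And>x. 0 \<le> Re (B x x)) \<Longrightarrow> (\<And>x. Im (B x x) = 0) \<Longrightarrow> psd B"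
  by (auto simp: psd_def complex_nonneg_Reals_iff)

text \<open>Polarisation: the diagonal at x + y gives opposite imaginary parts, the diagonal at x +
  i y gives equal real parts.\<close>

lemma psd_hermitian:
  assumes "psd B" shows "B y x = cnj (B x y)"
proof -
  note s = sesqD[OF psd_sesq[OF assms]]
  have "Im (B (x + y) (x + y)) = 0" "Im (B (x + \<i> *\<^sub>C y) (x + \<i> *\<^sub>C y)) = 0"
    using assms by (auto intro: psd_Im)
  then show ?thesis using psd_Im[OF assms]
    by (auto simp: s complex_eq_iff)
qed

text \<open>Positivity at c x - y for the unimodular c with c B(x,y) = |B(x,y)|. This variant of
  Cauchy-Schwarz has a right-hand side additive in B, so it sums over the cells of a
  division.\<close>

lemma psd_amgm:
  assumes "psd B" shows "cmod (B x y) \<le> (Re (B x x) + Re (B y y)) / 2"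
proof (cases "B x y = 0")
  case True then show ?thesis using psd_nonneg[OF assms, of x] psd_nonneg[OF assms, of y] by simp
next
  case False
  note s = sesqD[OF psd_sesq[OF assms]]
  define c where "c = cnj (sgn (B x y))"
  have "c * B x y = (B x y * cnj (B x y)) / complex_of_real (cmod (B x y))"
    by (simp add: c_def sgn_eq)
  also have "\<dots> = complex_of_real (cmod (B x y))"
    using False by (simp add: complex_norm_square[symmetric] power2_eq_square)
  finally have c: "c * B x y = complex_of_real (cmod (B x y))" .
  have c1: "c * cnj c = 1"
    using False by (simp add: c_def complex_norm_square[symmetric] norm_sgn mult.commute[of _ "sgn _"])
  have "B (c *\<^sub>C x - y) (c *\<^sub>C x - y) = (c * cnj c) * B x x - c * B x y - cnj (c * B x y) + B y y"
    by (simp add: s psd_hermitian[OF assms, of x y] algebra_simps)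
  then have "Re (B (c *\<^sub>C x - y) (c *\<^sub>C x - y)) = Re (B x x) + Re (B y y) - 2 * cmod (B x y)"
    by (simp add: c c1)
  then show ?thesis using psd_nonneg[OF assms, of "c *\<^sub>C x - y"] by simp
qed

text \<open>The weight comes from replacing x by t x; a suitable t later recovers a product of two
  factors from the sum.\<close>

lemma psd_amgm_scaled:
  assumes "psd B" "0 < t"
  shows "cmod (B x y) \<le> (t * Re (B x x) + Re (B y y) / t) / 2"
proof -
  note s = sesqD[OF psd_sesq[OF assms(1)]]
  have "cmod (B (of_real t *\<^sub>C x) y) \<le> (Re (B (of_real t *\<^sub>C x) (of_real t *\<^sub>C x)) + Re (B y y)) / 2"
    by (rule psd_amgm[OF assms(1)])
  then have "t * cmod (B x y) \<le> (t * (t * Re (B x x)) + Re (B y y)) / 2"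
    using assms(2) by (simp add: s norm_mult)
  also have "\<dots> = t * ((t * Re (B x x) + Re (B y y) / t) / 2)"
    using assms(2) by (simp add: field_simps)
  finally show ?thesis using assms(2) by (simp only: mult_le_cancel_left_pos)
qed

text \<open>Normalising both arguments to length one turns the additive bound into the product bound
  that defines an operator.\<close>

lemma sesq_bound_scale:
  fixes B :: "'h::complex_inner \<Rightarrow> 'h \<Rightarrow> complex"
  assumes B: "sesq B" and bd: "\<And>h g. cmod (B h g) \<le> C / 2 * ((norm h)\<^sup>2 + (norm g)\<^sup>2)"
  shows "cmod (B h g) \<le> C * norm h * norm g"
proof (cases "h = 0 \<or> g = 0")
  case False
  let ?h = "of_real (1 / norm h) *\<^sub>C h" and ?g = "of_real (1 / norm g) *\<^sub>C g"
  have "cmod (B ?h ?g) \<le> C / 2 * ((norm ?h)\<^sup>2 + (norm ?g)\<^sup>2)" by (rule bd)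
  moreover have "norm ?h = 1" "norm ?g = 1" using False by (auto simp: norm_divide)
  moreover have "B ?h ?g = of_real (1 / norm h) * of_real (1 / norm g) * B h g" 
    by (simp only: sesqD[OF B] complex_cnj_complex_of_real mult_ac)
  moreover have "cmod (B ?h ?g) = cmod (B h g) / (norm h * norm g)" unfolding calculation(4)
    by (simp add: norm_mult norm_divide)
  ultimately show ?thesis using False by (simp add: divide_le_eq mult.assoc zero_less_mult_iff)
qed (auto simp: sesqD[OF B])

lemma sesq_operator:
  fixes B :: "'h::chilbert_space \<Rightarrow> 'h \<Rightarrow> complex"
  assumes B: "sesq B" and bd: "\<And>h g. cmod (B h g) \<le> C * norm h * norm g"
  shows "\<exists>T. bounded_clinear T \<and> (\<forall>x y. cinner (T x) y = B x y)"
proof -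
  have bd': "cmod (B x y) \<le> max C 0 * norm x * norm y" for x y
    using bd[of x y] mult_right_mono[of C "max C 0" "norm x * norm y"] by (simp add: mult.assoc)
  show ?thesis
    using form_operator_dense[OF csubspace_UNIV closure_UNIV, of B "max C 0"] sesqD[OF B] bd' by auto
qed

section \<open>Limits along filters\<close>

text \<open>The Hilbert space need not be separable, so Helly's selection is replaced by compactness of a
  product of discs: some finer filter makes all coordinates converge.\<close>

lemma compact_product_cball: "compact (PiE UNIV (\<lambda>n::'n. cball (0::complex) (c n)))"
proof -
  have "compactin (product_topology (\<lambda>n::'n. euclidean) UNIV) (PiE UNIV (\<lambda>n. cball (0::complex) (c n)))"
    by (simp add: compactin_PiE)
  then show ?thesis by (simp add: euclidean_product_topology)
qed

lemma finer_convergent_filter: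
  fixes X :: "'i \<Rightarrow> 'n \<Rightarrow> complex"
  assumes "Fl \<noteq> bot" and bd: "\<And>n. \<forall>\<^sub>F i in Fl. cmod (X i n) \<le> c n"
  shows "\<exists>U Y. U \<le> Fl \<and> U \<noteq> bot \<and> (\<forall>n. ((\<lambda>i. X i n) \<longlongrightarrow> Y n) U)"
proof -
  define X' where "X' i n = (if cmod (X i n) \<le> c n then X i n else 0)" for i n
  define K where "K = PiE UNIV (\<lambda>n::'n. cball (0::complex) (max (c n) 0))"
  have "X' i \<in> K" for i by (auto simp: K_def X'_def)
  then have "\<forall>\<^sub>F x in filtermap X' Fl. x \<in> K" by (simp add: eventually_filtermap)
  moreover have "filtermap X' Fl \<noteq> bot" using assms(1) by (simp add: filtermap_bot_iff)
  ultimately obtain Y where Y: "inf (nhds Y) (filtermap X' Fl) \<noteq> bot"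
    using compact_product_cball[of "\<lambda>n. max (c n) 0"] unfolding compact_filter K_def[symmetric] by blast
  \<comment> \<open>The coarsest filter finer than Fl along which X' tends to Y; it is proper
    because Y is a cluster point.\<close>
  define U where "U = inf Fl (filtercomap X' (nhds Y))"
  have "U \<noteq> bot"
  proof
    assume "U = bot"
    then have "eventually (\<lambda>_. False) (inf Fl (filtercomap X' (nhds Y)))" by (simp add: U_def)
    then obtain P Q where PQ: "eventually P Fl" "eventually Q (nhds Y)" "\<And>i. P i \<Longrightarrow> Q (X' i) \<Longrightarrow> False"
      unfolding eventually_inf eventually_filtercomap by metis
    have "eventually (\<lambda>y. \<not> Q y) (filtermap X' Fl)"
      unfolding eventually_filtermap by (rule eventually_mono[OF PQ(1)]) (use PQ(3) in blast)
    with PQ(2) have "eventually (\<lambda>_. False) (inf (nhds Y) (filtermap X' Fl))"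
      unfolding eventually_inf by blast
    with Y show False by (simp add: trivial_limit_def)
  qed
  moreover have "((\<lambda>i. X i n) \<longlongrightarrow> Y n) U" for n
  proof -
    have "filterlim X' (nhds Y) U"
      unfolding U_def filterlim_def by (simp add: filtermap_filtercomap filtermap_inf le_infI2 order.trans[OF filtermap_mono[OF inf_le2]])
    moreover have "((\<lambda>x::'n \<Rightarrow> complex. x n) \<longlongrightarrow> Y n) (nhds Y)"
    proof -
      have "((\<lambda>x::'n \<Rightarrow> complex. x n) \<longlongrightarrow> Y n) (at Y)"
        using continuous_on_product_coordinates[of n, where 'b=complex] by (simp add: continuous_on_def)
      then show ?thesis using tendsto_at_iff_tendsto_nhds[of "\<lambda>x::'n \<Rightarrow> complex. x n" Y] by simp
    qed
    ultimately have "((\<lambda>i. X' i n) \<longlongrightarrow> Y n) U" by (rule filterlim_compose[rotated])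
    moreover have "\<forall>\<^sub>F i in U. X' i n = X i n"
      using filter_leD[OF _ bd[of n], of U] by (auto simp: U_def X'_def elim: eventually_mono)
    ultimately show ?thesis by (rule Lim_transform_eventually)
  qed
  ultimately show ?thesis by (intro exI[of _ U] exI[of _ Y]) (auto simp: U_def)
qed

text \<open>Divisions with mesh tending to zero, as a filter: integrals become limits along it, and
  linearity, scalar products and uniqueness come from the laws of limits.\<close>

definition rs_filter :: "real \<Rightarrow> real \<Rightarrow> (real \<times> real set) set filter"
  where "rs_filter a b = (INF \<delta>\<in>{0<..}. principal
    {p. p tagged_division_of {a..b} \<and> (\<forall>(t, K)\<in>p. Sup K - Inf K < \<delta>)})"

lemma eventually_rs_filter:
  "eventually P (rs_filter a b) \<longleftrightarrow>
    (\<exists>\<delta>>0. \<forall>p. p tagged_division_of {a..b} \<and> (\<forall>(t, K)\<in>p. Sup K - Inf K < \<delta>) \<longrightarrow> P p)"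
  unfolding rs_filter_def
proof (subst eventually_INF_base)
  fix \<delta> \<delta>' :: real assume "\<delta> \<in> {0<..}" "\<delta>' \<in> {0<..}"
  then show "\<exists>x\<in>{0<..}. principal {p. p tagged_division_of {a..b} \<and> (\<forall>(t, K)\<in>p. Sup K - Inf K < x)}
    \<le> inf (principal {p. p tagged_division_of {a..b} \<and> (\<forall>(t, K)\<in>p. Sup K - Inf K < \<delta>)})
          (principal {p. p tagged_division_of {a..b} \<and> (\<forall>(t, K)\<in>p. Sup K - Inf K < \<delta>')})"
    by (intro bexI[of _ "min \<delta> \<delta>'"]) (auto split: prod.splits)
qed (auto simp: eventually_principal)

lemma rs_filter_nonbot:
  assumes "a \<le> b" shows "rs_filter a b \<noteq> bot"
proof -
  have "\<exists>p. p tagged_division_of {a..b} \<and> (\<forall>(t, K)\<in>p. Sup K - Inf K < \<delta>)" if d: "0 < \<delta>" for \<delta>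
  proof -
    \<comment> \<open>An interval inside a ball of radius \<delta>/4 has length at most \<delta>/2,
      which leaves room for the strict mesh bound.\<close>
    obtain p where p: "p tagged_division_of {a..b}" "(\<lambda>x. ball x (\<delta> / 4)) fine p"
      using fine_division_exists_real[of "\<lambda>x. ball x (\<delta> / 4)" a b] d by (auto simp: gauge_ball)
    have "Sup K - Inf K < \<delta>" if tK: "(t, K) \<in> p" for t K
    proof -
      have "K \<noteq> {}" "K \<subseteq> ball t (\<delta> / 4)" using tagged_division_ofD[OF p(1)] p(2) tK by (auto simp: fine_def)
      moreover have "t - \<delta> / 4 \<le> x \<and> x \<le> t + \<delta> / 4" if "x \<in> K" for x
      proof -
        have "dist t x < \<delta> / 4" using that calculation by auto
        then show ?thesis unfolding dist_real_def by linarith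
      qed
      ultimately have "Sup K \<le> t + \<delta> / 4" "t - \<delta> / 4 \<le> Inf K"
        by (auto intro: cSup_least cInf_greatest)
      then show ?thesis using d by linarith
    qed
    with p(1) show ?thesis by blast
  qed
  then show ?thesis unfolding trivial_limit_def eventually_rs_filter by blast
qed

section \<open>Riemann-Stieltjes integrals as limits, linearity\<close>

definition rs_sum :: "(real \<Rightarrow> complex) \<Rightarrow> (real \<Rightarrow> 'h \<Rightarrow> 'h::chilbert_space) \<Rightarrow> 'h \<Rightarrow> (real \<times> real set) set \<Rightarrow> 'h"
  where "rs_sum f F h p = (\<Sum>(t, K)\<in>p. f t *\<^sub>C (F (Sup K) h - F (Inf K) h))"

lemma has_rs_integral_iff:
  "has_rs_integral f F a b T \<longleftrightarrow> (\<forall>h. (rs_sum f F h \<longlongrightarrow> T h) (rs_filter a b))"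
  unfolding has_rs_integral_def tendsto_iff eventually_rs_filter rs_sum_def dist_norm
  by (rule arg_cong[where f=All]) (auto intro!: ext)

lemma has_rs_integral_unique:
  assumes "a \<le> b" "has_rs_integral f F a b T" "has_rs_integral f F a b T'"
  shows "T = T'"
proof
  fix h
  show "T h = T' h"
    using assms(2,3) tendsto_unique[OF rs_filter_nonbot[OF assms(1)], of "rs_sum f F h"]
    by (auto simp: has_rs_integral_iff)
qed

lemma eventually_rs_filter_division: "\<forall>\<^sub>F p in rs_filter a b. p tagged_division_of {a..b}"
  unfolding eventually_rs_filter by (intro exI[of _ 1]) auto

lemma rs_sum_add: "rs_sum (\<lambda>t. f t + g t) F h = (\<lambda>p. rs_sum f F h p + rs_sum g F h p)"
  by (rule ext) (simp add: rs_sum_def scaleC_add_left sum.distrib case_prod_unfold)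

lemma has_rs_integral_add:
  "has_rs_integral f F a b T \<Longrightarrow> has_rs_integral g F a b T' \<Longrightarrow>
    has_rs_integral (\<lambda>t. f t + g t) F a b (\<lambda>h. T h + T' h)"
  unfolding has_rs_integral_iff
  by (rule allI, subst rs_sum_add, rule tendsto_add) auto

lemma has_rs_integral_mult:
  assumes "has_rs_integral f F a b T"
  shows "has_rs_integral (\<lambda>t. c * f t) F a b (\<lambda>h. c *\<^sub>C T h)"
  unfolding has_rs_integral_iff
proof
  fix h
  have "((\<lambda>p. c *\<^sub>C rs_sum f F h p) \<longlongrightarrow> c *\<^sub>C T h) (rs_filter a b)"
    using assms by (intro scaleC.tendsto tendsto_const) (auto simp: has_rs_integral_iff)
  then show "(rs_sum (\<lambda>t. c * f t) F h \<longlongrightarrow> c *\<^sub>C T h) (rs_filter a b)"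
    by (simp add: rs_sum_def[abs_def] scaleC.sum_right scaleC_scaleC case_prod_unfold)
qed

lemma has_rs_integral_diff:
  assumes "has_rs_integral f F a b T" "has_rs_integral g F a b T'"
  shows "has_rs_integral (\<lambda>t. f t - g t) F a b (\<lambda>h. T h - T' h)"
  using has_rs_integral_add[OF assms(1) has_rs_integral_mult[OF assms(2), of "-1"]]
  by (simp add: scaleC_minus_one)

lemma has_rs_integral_const:
  assumes "a \<le> b"
  shows "has_rs_integral (\<lambda>t. c) F a b (\<lambda>h. c *\<^sub>C (F b h - F a h))"
  unfolding has_rs_integral_iff
proof
  fix h
  have "\<forall>\<^sub>F p in rs_filter a b. c *\<^sub>C (F b h - F a h) = rs_sum (\<lambda>t. c) F h p"
    using eventually_rs_filter_division
  proof eventually_elim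
    case (elim p)
    show ?case using additive_tagged_division_1[OF assms elim, of "\<lambda>t. F t h"]
      by (simp add: rs_sum_def scaleC.sum_right[symmetric] case_prod_unfold)
  qed
  then show "(rs_sum (\<lambda>t. c) F h \<longlongrightarrow> c *\<^sub>C (F b h - F a h)) (rs_filter a b)"
    by (rule Lim_transform_eventually[OF tendsto_const])
qed

lemma has_rs_integral_form:
  "has_rs_integral f F a b T \<Longrightarrow>
    ((\<lambda>p. \<Sum>(t, K)\<in>p. f t * cinner (F (Sup K) h - F (Inf K) h) g) \<longlongrightarrow> cinner (T h) g) (rs_filter a b)"
  using cinner.tendsto[OF _ tendsto_const, of "rs_sum f F h" "T h" "rs_filter a b" g]
  by (simp add: has_rs_integral_iff rs_sum_def[abs_def] cinner.sum_left cinner_scaleC_left case_prod_unfold)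

section \<open>Stieltjes integrals of monotone families of forms\<close>

text \<open>\<open>\<Psi>\<close> is an indefinite integral of \<open>f\<close> against the increments of \<open>L\<close>; the inequality expresses
  that the difference of the two set functions is dominated, by Cauchy-Schwarz, as soon as \<open>f\<close> is
  nearly constant. Unlike the integral itself it is stable under pointwise limits of \<open>(L, \<Psi>)\<close>.\<close>

definition integrates ::
  "(real \<Rightarrow> 'h::complex_inner \<Rightarrow> 'h \<Rightarrow> complex) \<Rightarrow> (real \<Rightarrow> complex) \<Rightarrow> (real \<Rightarrow> 'h \<Rightarrow> 'h \<Rightarrow> complex) \<Rightarrow> real \<Rightarrow> real \<Rightarrow> bool"
  where "integrates L f \<Psi> a b \<longleftrightarrow> (\<forall>u v c \<eta> h g. a \<le> u \<longrightarrow> u \<le> v \<longrightarrow> v \<le> b \<longrightarrow> 0 \<le> \<eta> \<longrightarrow>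
    (\<forall>t\<in>{u..v}. cmod (f t - c) \<le> \<eta>) \<longrightarrow>
    cmod (c * (L v h g - L u h g) - (\<Psi> v h g - \<Psi> u h g))
      \<le> \<eta> / 2 * (Re (L v h h - L u h h) + Re (L v g g - L u g g)))"

definition mono_forms :: "(real \<Rightarrow> 'h::complex_inner \<Rightarrow> 'h \<Rightarrow> complex) \<Rightarrow> real \<Rightarrow> real \<Rightarrow> bool"
  where "mono_forms L a b \<longleftrightarrow> (\<forall>s t. a \<le> s \<longrightarrow> s \<le> t \<longrightarrow> t \<le> b \<longrightarrow> psd (\<lambda>h g. L t h g - L s h g))"

lemma integratesD:
  assumes "integrates L f \<Psi> a b" "a \<le> u" "u \<le> v" "v \<le> b" "0 \<le> \<eta>" "\<And>t. u \<le> t \<Longrightarrow> t \<le> v \<Longrightarrow> cmod (f t - c) \<le> \<eta>"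
  shows "cmod (c * (L v h g - L u h g) - (\<Psi> v h g - \<Psi> u h g))
      \<le> \<eta> / 2 * (Re (L v h h - L u h h) + Re (L v g g - L u g g))"
  using assms unfolding integrates_def by auto

lemma mono_formsD: "mono_forms L a b \<Longrightarrow> a \<le> s \<Longrightarrow> s \<le> t \<Longrightarrow> t \<le> b \<Longrightarrow> psd (\<lambda>h g. L t h g - L s h g)"
  by (simp add: mono_forms_def)

lemma mono_forms_Re:
  "mono_forms L a b \<Longrightarrow> a \<le> s \<Longrightarrow> s \<le> t \<Longrightarrow> t \<le> b \<Longrightarrow> Re (L s h h) \<le> Re (L t h h)"
  using psd_nonneg[OF mono_formsD, of L a b s t h] by simp

lemma continuous_uniform_modulus:
  fixes f :: "real \<Rightarrow> complex"
  assumes "continuous_on {a..b} f" "0 < \<eta>"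
  obtains \<delta> where "0 < \<delta>" "\<And>s t. s \<in> {a..b} \<Longrightarrow> t \<in> {a..b} \<Longrightarrow> \<bar>s - t\<bar> < \<delta> \<Longrightarrow> cmod (f s - f t) \<le> \<eta>"
proof -
  have "uniformly_continuous_on {a..b} f" using assms(1) by (intro compact_uniformly_continuous) auto
  then obtain \<delta> where "0 < \<delta>" "\<And>s t. s \<in> {a..b} \<Longrightarrow> t \<in> {a..b} \<Longrightarrow> dist t s < \<delta> \<Longrightarrow> dist (f t) (f s) < \<eta>"
    using assms(2) unfolding uniformly_continuous_on_def by metis
  then show ?thesis by (intro that[of \<delta>]) (force simp: dist_norm)+
qed

text \<open>Tested against g, the error of a Riemann sum is the sum of the defects on its cells, and
  these add up to at most \<eta>/2 times the total increments at h and at g. The latter is bounded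
  for all g in the unit ball at once, which gives convergence in norm and not only weakly.\<close>

lemma integrates_has_rs_integral:
  fixes F :: "real \<Rightarrow> 'h \<Rightarrow> 'h::chilbert_space"
  assumes ab: "a \<le> b" and I: "integrates (\<lambda>t h g. cinner (F t h) g) f \<Psi> a b"
    and f: "continuous_on {a..b} f"
    and F: "bounded_clinear (F a)" "bounded_clinear (F b)"
    and T: "\<And>h g. cinner (T h) g = \<Psi> b h g - \<Psi> a h g"
  shows "has_rs_integral f F a b T"
  unfolding has_rs_integral_def
proof (intro allI impI)
  fix h and \<epsilon> :: real assume \<epsilon>: "0 < \<epsilon>"
  define L where "L = (\<lambda>t h g. cinner (F t h) g)"
  obtain Ka Kb where K: "\<And>g. norm (F a g) \<le> norm g * Ka" "\<And>g. norm (F b g) \<le> norm g * Kb" "0 < Ka" "0 < Kb"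
    using bounded_clinear_bound[OF F(1)] bounded_clinear_bound[OF F(2)] by metis
  define q where "q g = Re (L b g g - L a g g)" for g
  have q1: "q g \<le> Ka + Kb" if "norm g \<le> 1" for g
  proof -
    have "q g \<le> norm (F b g - F a g) * norm g"
      using Re_cinner_le[of "F b g - F a g" g] by (simp add: q_def L_def cinner.diff_left)
    also have "\<dots> \<le> (Ka + Kb) * 1"
    proof (rule mult_mono)
      have "norm g * Ka \<le> 1 * Ka" "norm g * Kb \<le> 1 * Kb"
        using that K(3,4) by (intro mult_right_mono; simp)+
      then show "norm (F b g - F a g) \<le> Ka + Kb"
        using K(1)[of g] K(2)[of g] norm_triangle_ineq4[of "F b g" "F a g"] by linarith
    qed (use that K in auto)
    finally show ?thesis by simp
  qed
  \<comment> \<open>C bounds q h + q g for every g in the unit ball; the summand 1 keeps it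
    positive, and the final error is \<eta>/2 * C = \<epsilon>/2.\<close>
  define C where "C = \<bar>q h\<bar> + Ka + Kb + 1"
  have C: "0 < C" using K by (simp add: C_def)
  define \<eta> where "\<eta> = \<epsilon> / C"
  have \<eta>: "0 < \<eta>" using \<epsilon> C by (simp add: \<eta>_def)
  obtain \<delta> where \<delta>: "0 < \<delta>" "\<And>s t. s \<in> {a..b} \<Longrightarrow> t \<in> {a..b} \<Longrightarrow> \<bar>s - t\<bar> < \<delta> \<Longrightarrow> cmod (f s - f t) \<le> \<eta>"
    using continuous_uniform_modulus[OF f \<eta>] by metis
  show "\<exists>\<delta>>0. \<forall>p. p tagged_division_of {a..b} \<and> (\<forall>(t, K)\<in>p. Sup K - Inf K < \<delta>) \<longrightarrow>
      norm ((\<Sum>(t, K)\<in>p. f t *\<^sub>C (F (Sup K) h - F (Inf K) h)) - T h) < \<epsilon>"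
  proof (intro exI[of _ \<delta>] conjI allI impI \<delta>(1))
    fix p assume p: "p tagged_division_of {a..b} \<and> (\<forall>(t, K)\<in>p. Sup K - Inf K < \<delta>)"
    let ?X = "(\<Sum>(t, K)\<in>p. f t *\<^sub>C (F (Sup K) h - F (Inf K) h)) - T h"
    have "norm ?X \<le> \<eta> / 2 * C"
    proof (rule norm_le_if_cinner_le)
      fix g :: 'h assume g: "norm g \<le> 1"
      have tele: "(\<Sum>(t, K)\<in>p. G (Sup K) - G (Inf K)) = G b - G a" for G :: "real \<Rightarrow> 'z::real_normed_vector"
        using additive_tagged_division_1[OF ab conjunct1[OF p]] by simp
      have "cinner ?X g = (\<Sum>(t, K)\<in>p. f t * (L (Sup K) h g - L (Inf K) h g)) - (\<Psi> b h g - \<Psi> a h g)"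
        by (simp add: cinner.diff_left cinner.sum_left cinner_scaleC_left case_prod_unfold T L_def)
      also have "\<dots> = (\<Sum>(t, K)\<in>p. f t * (L (Sup K) h g - L (Inf K) h g) - (\<Psi> (Sup K) h g - \<Psi> (Inf K) h g))"
        unfolding tele[of "\<lambda>t. \<Psi> t h g", symmetric] by (simp add: sum_subtractf case_prod_unfold)
      also have "cmod \<dots> \<le> (\<Sum>(t, K)\<in>p. \<eta> / 2 * (Re (L (Sup K) h h - L (Inf K) h h) + Re (L (Sup K) g g - L (Inf K) g g)))"
        unfolding case_prod_unfold
      proof (rule sum_norm_le)
        fix x assume x: "x \<in> p"
        obtain t K where tK: "x = (t, K)" by (cases x)
        note d = tagged_division_ofD[OF conjunct1[OF p]]
        obtain u v where uv: "K = {u..v}" using d(4)[of t K] x tK by auto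
        have sub: "t \<in> K" "K \<subseteq> {a..b}" using d(2,3)[of t K] x tK by auto
        then have "u \<le> v" "a \<le> u" "v \<le> b" using uv by auto
        moreover have "v - u < \<delta>" using p x tK uv \<open>u \<le> v\<close> by auto
        moreover have "cmod (f s - f t) \<le> \<eta>" if "u \<le> s" "s \<le> v" for s
          using that sub uv \<open>v - u < \<delta>\<close> by (intro \<delta>(2)) auto
        ultimately have "cmod (f t * (L v h g - L u h g) - (\<Psi> v h g - \<Psi> u h g))
            \<le> \<eta> / 2 * (Re (L v h h - L u h h) + Re (L v g g - L u g g))"
          using I \<eta> unfolding L_def by (intro integratesD[where f=f and a=a and b=b]) auto
        then show "cmod (f (fst x) * (L (Sup (snd x)) h g - L (Inf (snd x)) h g) - (\<Psi> (Sup (snd x)) h g - \<Psi> (Inf (snd x)) h g))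
           \<le> \<eta> / 2 * (Re (L (Sup (snd x)) h h - L (Inf (snd x)) h h) + Re (L (Sup (snd x)) g g - L (Inf (snd x)) g g))"
          using tK uv \<open>u \<le> v\<close> by simp
      qed
      also have "\<dots> = \<eta> / 2 * (q h + q g)"
        unfolding case_prod_unfold sum_distrib_left[symmetric] sum.distrib
        using tele[of "\<lambda>t. Re (L t h h)"] tele[of "\<lambda>t. Re (L t g g)"]
        by (simp add: case_prod_unfold q_def)
      also have "\<dots> \<le> \<eta> / 2 * C"
        using q1[OF g] \<eta> by (intro mult_left_mono) (auto simp: C_def)
      finally show "cmod (cinner ?X g) \<le> \<eta> / 2 * C" .
    qed
    also have "\<dots> < \<epsilon>" using \<epsilon> C by (simp add: \<eta>_def)
    finally show "norm ?X < \<epsilon>" .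
  qed
qed

text \<open>For fixed u, v, c, \<eta> and fixed vectors the inequality involves finitely many values
  of the two families, so pointwise convergence preserves it.\<close>

lemma integrates_limit:
  assumes "U \<noteq> bot" and I: "\<forall>\<^sub>F i in U. integrates (L i) f (\<Psi> i) a b"
    and L: "\<And>x h g. a \<le> x \<Longrightarrow> x \<le> b \<Longrightarrow> ((\<lambda>i. L i x h g) \<longlongrightarrow> L' x h g) U"
    and \<Psi>: "\<And>x h g. a \<le> x \<Longrightarrow> x \<le> b \<Longrightarrow> ((\<lambda>i. \<Psi> i x h g) \<longlongrightarrow> \<Psi>' x h g) U"
  shows "integrates L' f \<Psi>' a b"
  unfolding integrates_def
proof (intro allI impI)
  fix u v c \<eta> h g
  assume uv: "a \<le> u" "u \<le> v" "v \<le> b" "0 \<le> \<eta>" "\<forall>t\<in>{u..v}. cmod (f t - c) \<le> \<eta>"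
  have "\<forall>\<^sub>F i in U. cmod (c * (L i v h g - L i u h g) - (\<Psi> i v h g - \<Psi> i u h g))
      \<le> \<eta> / 2 * (Re (L i v h h - L i u h h) + Re (L i v g g - L i u g g))"
    using I
  proof eventually_elim
    case (elim i)
    show ?case by (rule integratesD[OF elim]) (use uv in auto)
  qed
  then show "cmod (c * (L' v h g - L' u h g) - (\<Psi>' v h g - \<Psi>' u h g))
      \<le> \<eta> / 2 * (Re (L' v h h - L' u h h) + Re (L' v g g - L' u g g))"
    by (rule tendsto_le[OF assms(1), rotated 2])
      (use uv in \<open>auto intro!: tendsto_intros L \<Psi>\<close>)
qed

lemma sesq_limit:
  assumes "U \<noteq> bot" "\<forall>\<^sub>F i in U. sesq (B i)" "\<And>h g. ((\<lambda>i. B i h g) \<longlongrightarrow> B' h g) U"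
  shows "sesq B'"
proof -
  note u = tendsto_unique[OF assms(1)]
  have "B' (x + y) z = B' x z + B' y z" for x y z
    by (rule u[OF assms(3)], rule Lim_transform_eventually[OF tendsto_add[OF assms(3)[of x z] assms(3)[of y z]]])
      (use assms(2) in \<open>auto simp: sesqD elim: eventually_mono\<close>)
  moreover have "B' x (y + z) = B' x y + B' x z" for x y z
    by (rule u[OF assms(3)], rule Lim_transform_eventually[OF tendsto_add[OF assms(3)[of x y] assms(3)[of x z]]])
      (use assms(2) in \<open>auto simp: sesqD elim: eventually_mono\<close>)
  moreover have "B' (c *\<^sub>C x) y = c * B' x y" for c x y
    by (rule u[OF assms(3)], rule Lim_transform_eventually[OF tendsto_mult[OF tendsto_const assms(3)[of x y]]])
      (use assms(2) in \<open>auto simp: sesqD elim: eventually_mono\<close>)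
  moreover have "B' x (c *\<^sub>C y) = cnj c * B' x y" for c x y
    by (rule u[OF assms(3)], rule Lim_transform_eventually[OF tendsto_mult[OF tendsto_const assms(3)[of x y]]])
      (use assms(2) in \<open>auto simp: sesqD elim: eventually_mono\<close>)
  ultimately show ?thesis by (simp add: sesq_def)
qed

lemma psd_limit:
  assumes "U \<noteq> bot" "\<forall>\<^sub>F i in U. psd (B i)" "\<And>h g. ((\<lambda>i. B i h g) \<longlongrightarrow> B' h g) U"
  shows "psd B'"
proof (rule psdI)
  show "sesq B'" by (rule sesq_limit[OF assms(1) _ assms(3)]) (use assms(2) in \<open>auto intro: psd_sesq elim: eventually_mono\<close>)
  fix x
  show "0 \<le> Re (B' x x)"
    by (rule tendsto_lowerbound[OF tendsto_Re[OF assms(3)] _ assms(1)])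
      (use assms(2) in \<open>auto intro: psd_nonneg elim: eventually_mono\<close>)
  have "((\<lambda>i. Im (B i x x)) \<longlongrightarrow> 0) U"
    by (rule Lim_transform_eventually[OF tendsto_const]) (use assms(2) in \<open>auto simp: psd_Im elim: eventually_mono\<close>)
  then show "Im (B' x x) = 0" using tendsto_unique[OF assms(1) tendsto_Im[OF assms(3)]] by blast
qed

lemma sum_mult_Re_add: "(\<Sum>k\<in>A. c * (Re (f k) + Re (g k))) = c * (Re (sum f A) + Re (sum g A))"
  by (simp add: sum_distrib_left[symmetric] sum.distrib)

subsection \<open>Discretisation\<close>

text \<open>The increment of \<open>L\<close> over the \<open>k\<close>-th cell of the uniform grid is placed at the right end of the
  cell, and the last one at \<open>a\<close>, which is identified with \<open>b\<close>. In the limit the distribution function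
  of these masses is left-continuous, whatever \<open>L\<close> is.\<close>

definition grid :: "real \<Rightarrow> real \<Rightarrow> nat \<Rightarrow> nat \<Rightarrow> real"
  where "grid a b N k = a + (b - a) * (real k / real N)"

definition node :: "real \<Rightarrow> real \<Rightarrow> nat \<Rightarrow> nat \<Rightarrow> real"
  where "node a b N k = (if Suc k < N then grid a b N (Suc k) else a)"

definition cell :: "real \<Rightarrow> real \<Rightarrow> (real \<Rightarrow> 'h \<Rightarrow> 'h \<Rightarrow> complex) \<Rightarrow> nat \<Rightarrow> nat \<Rightarrow> 'h \<Rightarrow> 'h \<Rightarrow> complex"
  where "cell a b L N k h g = L (grid a b N (Suc k)) h g - L (grid a b N k) h g"

text \<open>For f = 1 this is the distribution function of the masses, otherwise the indefinite
  integral of f. The strict inequality makes it left-continuous in x and zero at \<open>a\<close>,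
  while a mass moved to \<open>a\<close> counts at every larger x.\<close>

definition dsum :: "real \<Rightarrow> real \<Rightarrow> (real \<Rightarrow> 'h \<Rightarrow> 'h \<Rightarrow> complex) \<Rightarrow> nat \<Rightarrow> (real \<Rightarrow> complex) \<Rightarrow> real \<Rightarrow> 'h \<Rightarrow> 'h \<Rightarrow> complex"
  where "dsum a b L N f x h g = (\<Sum>k<N. if node a b N k < x then f (node a b N k) * cell a b L N k h g else 0)"

context
  fixes a b :: real and L :: "real \<Rightarrow> 'h::chilbert_space \<Rightarrow> 'h \<Rightarrow> complex"
  assumes ab: "a < b" and L: "mono_forms L a b"
begin

lemma grid_0: "grid a b N 0 = a"
  and grid_N: "0 < N \<Longrightarrow> grid a b N N = b"
  by (auto simp: grid_def)

lemma grid_mono: "k \<le> l \<Longrightarrow> grid a b N k \<le> grid a b N l"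
  using ab by (auto simp: grid_def divide_right_mono intro!: mult_left_mono)

lemma grid_strict: "0 < N \<Longrightarrow> k < l \<Longrightarrow> grid a b N k < grid a b N l"
  using ab by (auto simp: grid_def divide_strict_right_mono intro!: mult_strict_left_mono)

lemma grid_ge: "a \<le> grid a b N k"
  using grid_mono[of 0 k N] by (simp add: grid_0)

lemma grid_le: "0 < N \<Longrightarrow> k \<le> N \<Longrightarrow> grid a b N k \<le> b"
  using grid_mono[of k N N] by (simp add: grid_N)

lemma grid_Suc: "grid a b N (Suc k) = grid a b N k + (b - a) / real N"
  by (simp add: grid_def add_divide_distrib distrib_left)

lemma node_ge: "a \<le> node a b N k"
  by (simp add: node_def grid_ge)

lemma node_less: "node a b N k < b"
proof (cases "Suc k < N")
  case True
  then show ?thesis using grid_strict[of N "Suc k" N] grid_N[of N] by (simp add: node_def)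
qed (use ab in \<open>simp add: node_def\<close>)

lemma psd_cell:
  assumes "k < N" shows "psd (cell a b L N k)"
proof -
  have "psd (\<lambda>h g. L (grid a b N (Suc k)) h g - L (grid a b N k) h g)"
    by (rule mono_formsD[OF L]) (use assms in \<open>auto intro: grid_ge grid_le grid_mono\<close>)
  then show ?thesis by (simp add: cell_def[abs_def])
qed

lemma sum_cell: "j \<le> N \<Longrightarrow> (\<Sum>k<j. cell a b L N k h g) = L (grid a b N j) h g - L a h g"
  using sum_lessThan_telescope[of "\<lambda>k. L (grid a b N k) h g" j] by (simp add: cell_def grid_0)

lemma sesq_dsum: "sesq (dsum a b L N f x)"
proof -
  have "sesq (\<lambda>h g. if node a b N k < x then f (node a b N k) * cell a b L N k h g else 0)" if "k < N" for k
    using sesq_mult[OF psd_sesq[OF psd_cell[OF that]], of "f (node a b N k)"]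
    by (cases "node a b N k < x") (simp_all add: sesq_zero)
  then have "sesq (\<lambda>h g. \<Sum>k<N. if node a b N k < x then f (node a b N k) * cell a b L N k h g else 0)"
    by (intro sesq_sum) auto
  then show ?thesis by (simp add: dsum_def[abs_def])
qed

lemma dsum_bound:
  assumes "0 < N" "\<And>t. t \<in> {a..b} \<Longrightarrow> cmod (f t) \<le> c"
  shows "cmod (dsum a b L N f x h g) \<le> c / 2 * (Re (L b h h - L a h h) + Re (L b g g - L a g g))"
proof -
  have c: "0 \<le> c" using assms(2)[of a] ab norm_ge_zero[of "f a"] by (simp del: norm_ge_zero)
  have "cmod (dsum a b L N f x h g) \<le> (\<Sum>k<N. c / 2 * (Re (cell a b L N k h h) + Re (cell a b L N k g g)))"
    unfolding dsum_def
  proof (rule sum_norm_le)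
    fix k assume "k \<in> {..<N}"
    then have p: "psd (cell a b L N k)" by (simp add: psd_cell)
    have "cmod (f (node a b N k)) \<le> c" using node_ge[of N k] node_less[of N k] by (intro assms(2)) auto
    then have "cmod (f (node a b N k)) * cmod (cell a b L N k h g) \<le> c * ((Re (cell a b L N k h h) + Re (cell a b L N k g g)) / 2)"
      using psd_amgm[OF p, of h g] c by (intro mult_mono) auto
    then show "cmod (if node a b N k < x then f (node a b N k) * cell a b L N k h g else 0)
      \<le> c / 2 * (Re (cell a b L N k h h) + Re (cell a b L N k g g))"
      using psd_nonneg[OF p, of h] psd_nonneg[OF p, of g] c by (simp add: norm_mult)
  qed
  also have "\<dots> = c / 2 * (Re (\<Sum>k<N. cell a b L N k h h) + Re (\<Sum>k<N. cell a b L N k g g))"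
    by (rule sum_mult_Re_add)
  finally show ?thesis using assms(1) by (simp add: sum_cell grid_N)
qed

lemma dsum_integrates: "integrates (dsum a b L N (\<lambda>_. 1)) f (dsum a b L N f) a b"
  unfolding integrates_def
proof (intro allI impI)
  fix u v c \<eta> h g
  assume uv: "a \<le> u" "u \<le> v" "v \<le> b" "0 \<le> \<eta>" "\<forall>t\<in>{u..v}. cmod (f t - c) \<le> \<eta>"
  let ?n = "node a b N" and ?P = "cell a b L N"
  have inc: "dsum a b L N f v h g - dsum a b L N f u h g = (\<Sum>k<N. if u \<le> ?n k \<and> ?n k < v then f (?n k) * ?P k h g else 0)"
    for f h g using uv(2) unfolding dsum_def sum_subtractf[symmetric] by (intro sum.cong) auto
  let ?X = "c * (dsum a b L N (\<lambda>_. 1) v h g - dsum a b L N (\<lambda>_. 1) u h g) - (dsum a b L N f v h g - dsum a b L N f u h g)"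
  have X: "?X = (\<Sum>k<N. if u \<le> ?n k \<and> ?n k < v then (c - f (?n k)) * ?P k h g else 0)"
    unfolding inc sum_distrib_left sum_subtractf[symmetric] by (intro sum.cong) (auto simp: algebra_simps)
  have "cmod ?X \<le> (\<Sum>k<N. \<eta> / 2 * (Re (if u \<le> ?n k \<and> ?n k < v then 1 * ?P k h h else 0) +
      Re (if u \<le> ?n k \<and> ?n k < v then 1 * ?P k g g else 0)))"
    unfolding X
  proof (rule sum_norm_le)
    fix k assume "k \<in> {..<N}"
    then have p: "psd (?P k)" by (simp add: psd_cell)
    show "cmod (if u \<le> ?n k \<and> ?n k < v then (c - f (?n k)) * ?P k h g else 0) \<le> \<eta> / 2 *
      (Re (if u \<le> ?n k \<and> ?n k < v then 1 * ?P k h h else 0) + Re (if u \<le> ?n k \<and> ?n k < v then 1 * ?P k g g else 0))"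
    proof (cases "u \<le> ?n k \<and> ?n k < v")
      case True
      then have "cmod (c - f (?n k)) \<le> \<eta>" using uv(5) by (simp add: norm_minus_commute)
      then have "cmod (c - f (?n k)) * cmod (?P k h g) \<le> \<eta> * ((Re (?P k h h) + Re (?P k g g)) / 2)"
        using psd_amgm[OF p, of h g] uv(4) by (intro mult_mono) auto
      then show ?thesis using True by (simp add: norm_mult)
    qed auto
  qed
  also have "\<dots> = \<eta> / 2 * (Re (dsum a b L N (\<lambda>_. 1) v h h - dsum a b L N (\<lambda>_. 1) u h h)
      + Re (dsum a b L N (\<lambda>_. 1) v g g - dsum a b L N (\<lambda>_. 1) u g g))"
  proof -
    let ?A = "\<lambda>h k. if u \<le> ?n k \<and> ?n k < v then 1 * ?P k h h else 0"
    have "Re (dsum a b L N (\<lambda>_. 1) v h h - dsum a b L N (\<lambda>_. 1) u h h) = Re (sum (?A h) {..<N})" for h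
      by (rule arg_cong[where f=Re], rule inc)
    then show ?thesis by (simp only: sum_mult_Re_add)
  qed
  finally show "cmod (c * (dsum a b L N (\<lambda>_. 1) v h g - dsum a b L N (\<lambda>_. 1) u h g) - (dsum a b L N f v h g - dsum a b L N f u h g))
     \<le> \<eta> / 2 * (Re (dsum a b L N (\<lambda>_. 1) v h h - dsum a b L N (\<lambda>_. 1) u h h)
      + Re (dsum a b L N (\<lambda>_. 1) v g g - dsum a b L N (\<lambda>_. 1) u g g))" .
qed

lemma dsum_one_mono:
  assumes "u \<le> v" shows "psd (\<lambda>h g. dsum a b L N (\<lambda>_. 1) v h g - dsum a b L N (\<lambda>_. 1) u h g)"
proof (rule psdI)
  show "sesq (\<lambda>h g. dsum a b L N (\<lambda>_. 1) v h g - dsum a b L N (\<lambda>_. 1) u h g)"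
    by (intro sesq_minus sesq_dsum)
  fix x
  have inc: "dsum a b L N (\<lambda>_. 1) v x x - dsum a b L N (\<lambda>_. 1) u x x =
      (\<Sum>k<N. if u \<le> node a b N k \<and> node a b N k < v then cell a b L N k x x else 0)"
    using assms unfolding dsum_def sum_subtractf[symmetric] by (intro sum.cong) auto
  show "0 \<le> Re (dsum a b L N (\<lambda>_. 1) v x x - dsum a b L N (\<lambda>_. 1) u x x)"
    unfolding inc Re_sum by (intro sum_nonneg) (auto intro: psd_nonneg psd_cell)
  show "Im (dsum a b L N (\<lambda>_. 1) v x x - dsum a b L N (\<lambda>_. 1) u x x) = 0"
    unfolding inc Im_sum by (intro sum.neutral) (auto intro: psd_Im psd_cell)
qed

lemma dsum_at_a: "dsum a b L N f a h g = 0"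
  unfolding dsum_def using node_ge[of N] by (intro sum.neutral) (simp add: leD)

lemma grid_bracket:
  assumes "0 < N" "a < x" "x \<le> b"
  obtains j where "j < N" "grid a b N j < x" "x \<le> grid a b N (Suc j)"
proof -
  define j where "j = (LEAST j. x \<le> grid a b N (Suc j))"
  have ex: "x \<le> grid a b N (Suc (N - 1))" using assms by (simp add: grid_N)
  have 1: "x \<le> grid a b N (Suc j)" unfolding j_def by (rule LeastI[of _ "N - 1"], rule ex)
  have "j \<le> N - 1" unfolding j_def by (rule Least_le, rule ex)
  moreover have "grid a b N j < x"
  proof (cases j)
    case (Suc i)
    then have "\<not> x \<le> grid a b N (Suc i)" using not_less_Least[of i "\<lambda>j. x \<le> grid a b N (Suc j)"] by (simp add: j_def)
    then show ?thesis using Suc by simp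
  qed (use assms(2) in \<open>simp add: grid_0\<close>)
  ultimately show ?thesis using 1 assms(1) by (intro that) auto
qed

text \<open>The nodes below x are those of the first j cells, whose increments telescope, and that
  of the last cell, which sits at \<open>a\<close>.\<close>

lemma dsum_one_eq:
  assumes N: "0 < N" and j: "j < N" "grid a b N j < x" "x \<le> grid a b N (Suc j)" and x: "a < x"
  shows "dsum a b L N (\<lambda>_. 1) x h g =
    L (grid a b N j) h g - L a h g + (L b h g - L (grid a b N (N - 1)) h g)"
proof -
  have lt: "node a b N k < x \<longleftrightarrow> k < j \<or> k = N - 1" if "k < N" for k
  proof (cases "Suc k < N")
    case True
    have "grid a b N (Suc k) < x \<longleftrightarrow> k < j"
    proof
      assume "k < j" then have "grid a b N (Suc k) \<le> grid a b N j" by (intro grid_mono) auto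
      then show "grid a b N (Suc k) < x" using j by simp
    next
      assume "grid a b N (Suc k) < x"
      then show "k < j" using j(3) grid_mono[of "Suc j" "Suc k" N] by (cases "k < j") auto
    qed
    then show ?thesis using True by (auto simp: node_def)
  qed (use that x in \<open>auto simp: node_def\<close>)
  obtain M where M: "N = Suc M" using N by (cases N) auto
  have "dsum a b L N (\<lambda>_. 1) x h g = (\<Sum>k<N. if k < j \<or> k = N - 1 then cell a b L N k h g else 0)"
    unfolding dsum_def by (intro sum.cong) (auto simp: lt)
  also have "\<dots> = (\<Sum>k<M. if k < j then cell a b L N k h g else 0) + cell a b L N M h g"
  proof -
    have "(\<Sum>k<M. if k < j \<or> k = N - 1 then cell a b L N k h g else 0) = (\<Sum>k<M. if k < j then cell a b L N k h g else 0)"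
      by (intro sum.cong) (auto simp: M)
    then show ?thesis by (simp add: M)
  qed
  also have "(\<Sum>k<M. if k < j then cell a b L N k h g else 0) = (\<Sum>k<j. cell a b L N k h g)"
    using j(1) M by (intro sum.mono_neutral_cong_right) auto
  also have "(\<Sum>k<j. cell a b L N k h g) = L (grid a b N j) h g - L a h g"
    using j(1) by (intro sum_cell) simp
  also have "cell a b L N M h g = L b h g - L (grid a b N (N - 1)) h g"
    using grid_N[OF N] by (simp add: cell_def M)
  finally show ?thesis .
qed

end

section \<open>Limits of discretisations\<close>

lemma continuous_bounded_Icc:
  fixes f :: "real \<Rightarrow> complex"
  assumes "continuous_on {a..b} f" shows "\<exists>c. \<forall>t\<in>{a..b}. cmod (f t) \<le> c"
  using compact_imp_bounded[OF compact_continuous_image[OF assms compact_Icc]] by (auto simp: bounded_iff)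

text \<open>One filter has to serve all integrands, points and vectors simultaneously, so the whole
  quadruple is the index of the compact product.\<close>

lemma discretisation_limit:
  fixes L :: "real \<Rightarrow> 'h::chilbert_space \<Rightarrow> 'h \<Rightarrow> complex"
  assumes ab: "a < b" and L: "mono_forms L a b"
  obtains U Y where "U \<le> sequentially" "U \<noteq> bot"
    "\<And>f x h g. continuous_on {a..b} f \<Longrightarrow> ((\<lambda>N. dsum a b L N f x h g) \<longlongrightarrow> Y f x h g) U"
proof -
  \<comment> \<open>A discontinuous integrand may be unbounded; zero is put in its place so that
    every coordinate stays bounded.\<close>
  define X where "X N = (\<lambda>(f, x, h, g). if continuous_on {a..b} f then dsum a b L N f x h g else 0)" for N
  define c where "c = (\<lambda>(f::real\<Rightarrow>complex, x::real, h, g). (SOME c. \<forall>t\<in>{a..b}. cmod (f t) \<le> c) / 2 * (Re (L b h h - L a h h) + Re (L b g g - L a g g)))"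
  define c' where "c' n = max (c n) 0" for n
  have "\<forall>\<^sub>F N in sequentially. cmod (X N n) \<le> c' n" for n
    using eventually_gt_at_top[of 0]
  proof eventually_elim
    case (elim N)
    obtain f x h g where n: "n = (f, x, h, g)" by (cases n)
    show ?case
    proof (cases "continuous_on {a..b} f")
      case True
      then have "\<exists>c. \<forall>t\<in>{a..b}. cmod (f t) \<le> c" by (rule continuous_bounded_Icc)
      then have "\<forall>t\<in>{a..b}. cmod (f t) \<le> (SOME c. \<forall>t\<in>{a..b}. cmod (f t) \<le> c)" by (rule someI_ex)
      then have "cmod (dsum a b L N f x h g) \<le> c n"
        unfolding c_def n prod.case by (intro dsum_bound[OF ab L elim]) auto
      then show ?thesis using True by (simp add: X_def n c'_def)
    qed (simp add: X_def n c'_def)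
  qed
  then obtain U Y where U: "U \<le> sequentially" "U \<noteq> bot" "\<And>n. ((\<lambda>N. X N n) \<longlongrightarrow> Y n) U"
    using finer_convergent_filter[of sequentially X c'] sequentially_bot by auto
  show ?thesis
  proof (rule that[OF U(1,2)])
    fix f :: "real \<Rightarrow> complex" and x h g assume "continuous_on {a..b} f"
    then show "((\<lambda>N. dsum a b L N f x h g) \<longlongrightarrow> (\<lambda>f x h g. Y (f, x, h, g)) f x h g) U"
      using U(3)[of "(f, x, h, g)"] by (simp add: X_def)
  qed
qed

text \<open>All that the moment problem asks of a solution apart from the moments, on a general
  interval.\<close>

definition distribution_fun :: "real \<Rightarrow> real \<Rightarrow> (real \<Rightarrow> 'h \<Rightarrow> 'h::chilbert_space) \<Rightarrow> bool"
  where "distribution_fun a b F \<longleftrightarrow> F \<in> extensional {a..b} \<and> (\<forall>t\<in>{a..b}. bounded_clinear (F t)) \<and>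
    (\<forall>s\<in>{a..b}. \<forall>t\<in>{a..b}. s \<le> t \<longrightarrow> positive_op (\<lambda>h. F t h - F s h)) \<and> (\<forall>h. F a h = 0) \<and>
    (\<forall>t\<in>{a<..b}. \<forall>h. ((\<lambda>s. F s h) \<longlongrightarrow> F t h) (at_left t))"

text \<open>The moved mass of the last cell occurs in both values and cancels. What remains is an
  increment of L from a grid point not below y, once the mesh is less than s - y, to a grid point
  below x. The bound does not involve N and survives the limit; it is the source of
  left-continuity.\<close>

lemma dsum_grid_difference:
  fixes L :: "real \<Rightarrow> 'h::chilbert_space \<Rightarrow> 'h \<Rightarrow> complex"
  assumes ab: "a < b" and L: "mono_forms L a b" and s: "a < s" "s \<le> x" "x \<le> b" and y: "a \<le> y" "y < s"
  shows "\<forall>\<^sub>F N in sequentially. Re (dsum a b L N (\<lambda>_. 1) x h h - dsum a b L N (\<lambda>_. 1) s h h)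
    \<le> (SUP t\<in>{a..<x}. Re (L t h h)) - Re (L y h h)"
proof -
  have "\<forall>\<^sub>F N in sequentially. (b - a) / real N < s - y"
    using order_tendstoD(2)[OF lim_const_over_n[of "b - a"], of "s - y"] y by simp
  then show ?thesis using eventually_gt_at_top[of 0]
  proof eventually_elim
    case (elim N)
    obtain j where j: "j < N" "grid a b N j < x" "x \<le> grid a b N (Suc j)"
      using grid_bracket[OF ab L elim(2), of x] s by auto
    obtain i where i: "i < N" "grid a b N i < s" "s \<le> grid a b N (Suc i)"
      using grid_bracket[OF ab L elim(2), of s] s by auto
    have "y \<le> grid a b N i" using i elim(1) grid_Suc[OF ab L, of N i] by linarith
    then have "Re (L y h h) \<le> Re (L (grid a b N i) h h)"
      using i s y by (intro mono_forms_Re[OF L]) auto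
    moreover have "Re (L (grid a b N j) h h) \<le> (SUP t\<in>{a..<x}. Re (L t h h))"
    proof (rule cSUP_upper)
      show "grid a b N j \<in> {a..<x}" using j grid_ge[OF ab L] by auto
      show "bdd_above ((\<lambda>t. Re (L t h h)) ` {a..<x})"
        using s by (intro bdd_aboveI2[of _ _ "Re (L b h h)"] mono_forms_Re[OF L]) auto
    qed
    moreover have "dsum a b L N (\<lambda>_. 1) x h h - dsum a b L N (\<lambda>_. 1) s h h = L (grid a b N j) h h - L (grid a b N i) h h"
      using dsum_one_eq[OF ab L elim(2) j, of h h] dsum_one_eq[OF ab L elim(2) i, of h h] s by simp
    ultimately show ?case by simp
  qed
qed

text \<open>Converts smallness of the quadratic form at h into smallness of the vector D h: a large
  t makes M / t small, and the form then has to be small compared with 1 / t.\<close>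

lemma positive_op_strong_bound:
  assumes D: "psd (\<lambda>h g. cinner (D h) g)" and t: "0 < t" and M: "\<And>g. norm g \<le> 1 \<Longrightarrow> Re (cinner (D g) g) \<le> M"
  shows "norm (D h) \<le> (t * Re (cinner (D h) h) + M / t) / 2"
proof (rule norm_le_if_cinner_le)
  fix g :: 'a assume g: "norm g \<le> 1"
  have "cmod (cinner (D h) g) \<le> (t * Re (cinner (D h) h) + Re (cinner (D g) g) / t) / 2"
    by (rule psd_amgm_scaled[OF D t])
  also have "\<dots> \<le> (t * Re (cinner (D h) h) + M / t) / 2"
    using M[OF g] t by (simp add: divide_right_mono)
  finally show "cmod (cinner (D h) g) \<le> (t * Re (cinner (D h) h) + M / t) / 2" .
qed

lemma positive_op_iff_psd:
  "(\<And>x y. D (x + y) = D x + D y) \<Longrightarrow> (\<And>c x. D (c *\<^sub>C x) = c *\<^sub>C D x) \<Longrightarrow>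
    positive_op D \<longleftrightarrow> psd (\<lambda>h g. cinner (D h) g)"
  by (auto simp: positive_op_def psd_def sesq_def cinner_add_left cinner_add_right cinner_scaleC_left cinner_scaleC_right)

text \<open>F is a limit of the discrete masses of L. The last two clauses compare it with L: if f a
  = f b, moving mass from b to a leaves the integral unchanged, and if L is already left-continuous,
  nothing is lost except its value at a.\<close>

theorem left_continuous_representation:
  fixes L :: "real \<Rightarrow> 'h::chilbert_space \<Rightarrow> 'h \<Rightarrow> complex"
  assumes ab: "a < b" and L: "mono_forms L a b"
    and M: "\<And>h. Re (L b h h - L a h h) \<le> M * (norm h)\<^sup>2"
  obtains F J where "distribution_fun a b F"
    "\<And>f. continuous_on {a..b} f \<Longrightarrow> bounded_clinear (J f)"
    "\<And>f. continuous_on {a..b} f \<Longrightarrow> has_rs_integral f F a b (J f)"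
    "\<And>f. continuous_on {a..b} f \<Longrightarrow> \<exists>\<Psi>. integrates (\<lambda>t h g. cinner (F t h) g) f \<Psi> a b \<and>
       (\<forall>h g. cinner (J f h) g = \<Psi> b h g - \<Psi> a h g)"
    "\<And>f \<Lambda> h g. continuous_on {a..b} f \<Longrightarrow> f a = f b \<Longrightarrow> integrates L f \<Lambda> a b \<Longrightarrow>
       cinner (J f h) g = \<Lambda> b h g - \<Lambda> a h g"
    "(\<And>x h g. a < x \<Longrightarrow> x \<le> b \<Longrightarrow> ((\<lambda>s. L s h g) \<longlongrightarrow> L x h g) (at_left x)) \<Longrightarrow>
       (\<And>x h g. x \<in> {a..b} \<Longrightarrow> cinner (F x h) g = L x h g - L a h g)"
proof -
  obtain U Y where U: "U \<le> sequentially" "U \<noteq> bot"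
    and Y: "\<And>f x h g. continuous_on {a..b} f \<Longrightarrow> ((\<lambda>N. dsum a b L N f x h g) \<longlongrightarrow> Y f x h g) U"
    using discretisation_limit[OF ab L] by metis
  have pos: "\<forall>\<^sub>F N in U. 0 < N" by (rule filter_leD[OF U(1) eventually_gt_at_top])
  let ?one = "\<lambda>_::real. 1::complex"
  note Y1 = Y[OF continuous_on_const, of 1]
  have sesqY: "sesq (Y f x)" if "continuous_on {a..b} f" for f x
    by (rule sesq_limit[OF U(2) _ Y[OF that]]) (simp add: sesq_dsum[OF ab L])
  have "\<exists>c. \<forall>x h g. cmod (Y f x h g) \<le> c * norm h * norm g" if f: "continuous_on {a..b} f" for f
  proof -
    obtain c where c: "\<forall>t\<in>{a..b}. cmod (f t) \<le> c" using continuous_bounded_Icc[OF f] by blast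
    have c0: "0 \<le> c" using c ab by (intro order_trans[OF norm_ge_zero[of "f a"]]) auto
    have bd: "cmod (Y f x h g) \<le> c * M / 2 * ((norm h)\<^sup>2 + (norm g)\<^sup>2)" for x h g
    proof (rule tendsto_upperbound[OF tendsto_norm[OF Y[OF f]] _ U(2)])
      show "\<forall>\<^sub>F N in U. cmod (dsum a b L N f x h g) \<le> c * M / 2 * ((norm h)\<^sup>2 + (norm g)\<^sup>2)"
        using pos
      proof eventually_elim
        case (elim N)
        have "cmod (dsum a b L N f x h g) \<le> c / 2 * (Re (L b h h - L a h h) + Re (L b g g - L a g g))"
          using c by (intro dsum_bound[OF ab L elim]) auto
        also have "\<dots> \<le> c / 2 * (M * (norm h)\<^sup>2 + M * (norm g)\<^sup>2)"
          using c0 by (intro mult_left_mono add_mono M) auto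
        finally show ?case by (simp add: algebra_simps)
      qed
    qed
    have "cmod (Y f x h g) \<le> c * M * norm h * norm g" for x h g
      by (rule sesq_bound_scale[OF sesqY[OF f] bd])
    then show ?thesis by blast
  qed
  then have "\<exists>T. bounded_clinear T \<and> (\<forall>h g. cinner (T h) g = Y f x h g)" if "continuous_on {a..b} f" for f x
    using sesq_operator[OF sesqY[OF that]] that by metis
  then obtain W where W: "\<And>f x. continuous_on {a..b} f \<Longrightarrow> bounded_clinear (W f x)"
    "\<And>f x h g. continuous_on {a..b} f \<Longrightarrow> cinner (W f x h) g = Y f x h g" by metis
  note W1 = W[OF continuous_on_const, of 1]
  define F where "F = restrict (W ?one) {a..b}"
  have F: "F x = W ?one x" if "x \<in> {a..b}" for x using that by (simp add: F_def)
  have Ya: "Y f a h g = 0" if "continuous_on {a..b} f" for f h g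
    by (rule tendsto_unique[OF U(2) Y[OF that]]) (simp add: dsum_at_a[OF ab L])
  have Ymono: "psd (\<lambda>h g. Y ?one v h g - Y ?one u h g)" if "u \<le> v" for u v
    by (rule psd_limit[OF U(2) _ tendsto_diff[OF Y1 Y1]]) (simp add: dsum_one_mono[OF ab L that])
  have left: "((\<lambda>s. F s h) \<longlongrightarrow> F x h) (at_left x)" if x: "x \<in> {a<..b}" for x h
  proof (rule tendstoI)
    fix e :: real assume e: "0 < e"
    define M' where "M' = max M 0 + 1"
    have M': "0 < M'" by (simp add: M'_def)
    have Db: "Re (Y ?one x g g - Y ?one s g g) \<le> M'" if "s \<le> x" "norm g \<le> 1" "a \<le> s" for s g
    proof -
      have "Re (Y ?one x g g - Y ?one s g g) \<le> Re (Y ?one b g g - Y ?one a g g)"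
        using psd_nonneg[OF Ymono[of x b], of g] psd_nonneg[OF Ymono[of a s], of g] x that by simp
      also have "Y ?one b g g = L b g g - L a g g"
      proof (rule tendsto_unique[OF U(2) Y1], rule Lim_transform_eventually[OF tendsto_const])
        show "\<forall>\<^sub>F N in U. L b g g - L a g g = dsum a b L N ?one b g g"
          using pos
        proof eventually_elim
          case (elim N)
          obtain j where j: "j < N" "grid a b N j < b" "b \<le> grid a b N (Suc j)"
            using grid_bracket[OF ab L elim, of b] ab by auto
          have "Suc j = N"
            using grid_strict[OF ab L elim, of "Suc j" N] grid_N[OF ab L elim] j by (cases "Suc j < N") auto
          then show ?case using dsum_one_eq[OF ab L elim j ab, of g g] by auto
        qed
      qed
      also have "Re (L b g g - L a g g - Y ?one a g g) \<le> M * (norm g)\<^sup>2" using M[of g] by (simp add: Ya)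
      also have "\<dots> \<le> M'"
      proof -
        have "(norm g)\<^sup>2 \<le> 1" using that(2) by (simp add: power_le_one)
        then have "M * (norm g)\<^sup>2 \<le> max M 0 * 1" by (intro mult_mono) auto
        then show ?thesis by (simp add: M'_def)
      qed
      finally show ?thesis .
    qed
    \<comment> \<open>Balance in \<open>positive_op_strong_bound\<close>: M' / t equals e, and a
      quadratic form below e / (2 t) contributes e / 2, so the bound is 3 e / 4.\<close>
    define t where "t = M' / e"
    have t: "0 < t" using M' e by (simp add: t_def)
    \<comment> \<open>In the limit, the increments up to x see L only on the half-open interval from
      a to x, so this supremum takes the place of L at x.\<close>
    define \<sigma> where "\<sigma> = (SUP y\<in>{a..<x}. Re (L y h h))"
    obtain y where y: "a \<le> y" "y < x" "\<sigma> - e / (2 * t) < Re (L y h h)"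
      using less_cSUP_iff[of "{a..<x}" "\<lambda>y. Re (L y h h)" "\<sigma> - e / (2 * t)"] x e t
        bdd_aboveI2[of "{a..<x}" "\<lambda>y. Re (L y h h)" "Re (L b h h)"] mono_forms_Re[OF L, of _ b h]
      by (auto simp: \<sigma>_def)
    have "\<forall>\<^sub>F s in at_left x. y < s \<and> s < x"
      using y(2) by (auto simp: eventually_at_left[OF y(2)])
    then show "\<forall>\<^sub>F s in at_left x. dist (F s h) (F x h) < e"
    proof eventually_elim
      case (elim s)
      have s: "a < s" "s \<le> x" using elim y by auto
      have "Re (Y ?one x h h - Y ?one s h h) \<le> \<sigma> - Re (L y h h)"
      proof (rule tendsto_upperbound[OF tendsto_Re[OF tendsto_diff[OF Y1 Y1]] _ U(2)])
        show "\<forall>\<^sub>F N in U. Re (dsum a b L N ?one x h h - dsum a b L N ?one s h h) \<le> \<sigma> - Re (L y h h)"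
          unfolding \<sigma>_def
          by (rule filter_leD[OF U(1) dsum_grid_difference[OF ab L]]) (use s x elim y in auto)
      qed
      then have small: "Re (Y ?one x h h - Y ?one s h h) < e / (2 * t)" using y(3) by simp
      let ?D = "\<lambda>h. F x h - F s h"
      have D: "cinner (?D h) g = Y ?one x h g - Y ?one s h g" for h g
        using F[of x] F[of s] x s by (simp add: cinner.diff_left W1)
      have "norm (?D h) \<le> (t * Re (cinner (?D h) h) + M' / t) / 2"
        by (rule positive_op_strong_bound[OF _ t]) (use Ymono[OF s(2)] Db s in \<open>auto simp: D\<close>)
      also have "\<dots> < (t * (e / (2 * t)) + M' / t) / 2" using small t by (simp add: D del: times_divide_eq_right)
      also have "\<dots> \<le> e" using t M' e by (simp add: t_def)
      finally show ?case by (simp add: dist_norm norm_minus_commute)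
    qed
  qed
  have dist: "distribution_fun a b F"
    unfolding distribution_fun_def
  proof (intro conjI ballI allI impI left)
    show "F \<in> extensional {a..b}" by (simp add: F_def)
    show bF: "bounded_clinear (F t)" if "t \<in> {a..b}" for t using that by (simp add: F W1)
    show "positive_op (\<lambda>h. F t h - F s h)" if st: "s \<in> {a..b}" "t \<in> {a..b}" "s \<le> t" for s t
    proof (subst positive_op_iff_psd)
      show "psd (\<lambda>h g. cinner (F t h - F s h) g)"
        using Ymono[OF st(3)] st(1,2) by (simp add: F W1 cinner.diff_left)
    qed (use bF[OF st(1)] bF[OF st(2)] in \<open>simp_all add: bounded_clinear_add bounded_clinear_scaleC scaleC.diff_right\<close>)
    show "F a h = 0" for h
      by (rule cinner_ext_left) (use ab in \<open>simp add: F W1 Ya cinner.zero_left\<close>)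
  qed
  define J where "J f = W f b" for f
  have int: "integrates (\<lambda>t h g. cinner (F t h) g) f (Y f) a b" if f: "continuous_on {a..b} f" for f
  proof (rule integrates_limit[OF U(2), of "\<lambda>N. dsum a b L N ?one" _ "\<lambda>N. dsum a b L N f"])
    show "((\<lambda>N. dsum a b L N ?one x h g) \<longlongrightarrow> cinner (F x h) g) U" if "a \<le> x" "x \<le> b" for x h g
      using Y1 that by (simp add: F W1)
  qed (use Y[OF f] dsum_integrates[OF ab L] in auto)
  have bF: "bounded_clinear (F a)" "bounded_clinear (F b)" using dist ab by (auto simp: distribution_fun_def)
  show ?thesis
  proof (rule that[of F J])
    show "distribution_fun a b F" by (rule dist)
    fix f :: "real \<Rightarrow> complex" assume f: "continuous_on {a..b} f"
    show "bounded_clinear (J f)" using W(1)[OF f] by (simp add: J_def)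
    show "has_rs_integral f F a b (J f)"
      by (rule integrates_has_rs_integral[OF less_imp_le[OF ab] int[OF f] f bF]) (simp add: J_def W(2)[OF f] Ya[OF f])
    show "\<exists>\<Psi>. integrates (\<lambda>t h g. cinner (F t h) g) f \<Psi> a b \<and> (\<forall>h g. cinner (J f h) g = \<Psi> b h g - \<Psi> a h g)"
      using int[OF f] W(2)[OF f] Ya[OF f] by (auto simp: J_def)
    fix \<Lambda> h g assume per: "f a = f b" and \<Lambda>: "integrates L f \<Lambda> a b"
    define C where "C = Re (L b h h - L a h h) + Re (L b g g - L a g g)"
    have C: "0 \<le> C" using psd_nonneg[OF mono_formsD[OF L, of a b], of h] psd_nonneg[OF mono_formsD[OF L, of a b], of g] ab
      by (simp add: C_def)
    \<comment> \<open>For periodic f the node of the last cell may be read as b. Then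
      \<open>dsum\<close> at b is a Riemann sum tagged at the right ends, and the inequality for
      \<Lambda> on each cell compares it with the increment of \<Lambda>.\<close>
    have "(\<lambda>N. dsum a b L N f b h g) \<longlonglongrightarrow> \<Lambda> b h g - \<Lambda> a h g"
    proof (rule LIMSEQ_I)
      fix e :: real assume e: "0 < e"
      define \<eta> where "\<eta> = e / (C + 1)"
      have \<eta>: "0 < \<eta>" using e C by (simp add: \<eta>_def)
      obtain \<delta> where \<delta>: "0 < \<delta>" "\<And>s t. s \<in> {a..b} \<Longrightarrow> t \<in> {a..b} \<Longrightarrow> \<bar>s - t\<bar> < \<delta> \<Longrightarrow> cmod (f s - f t) \<le> \<eta>"
        using continuous_uniform_modulus[OF f \<eta>] by metis
      have "\<forall>\<^sub>F N in sequentially. (b - a) / real N < \<delta>"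
        using order_tendstoD(2)[OF lim_const_over_n[of "b - a"] \<delta>(1)] .
      then have "\<forall>\<^sub>F N in sequentially. norm (dsum a b L N f b h g - (\<Lambda> b h g - \<Lambda> a h g)) < e"
        using eventually_gt_at_top[of 0]
      proof eventually_elim
        case (elim N)
        let ?x = "grid a b N" and ?P = "cell a b L N"
        have fn: "f (node a b N k) = f (?x (Suc k))" if "k < N" for k
        proof (cases "Suc k < N")
          case False
          then have "Suc k = N" using that by simp
          then show ?thesis using per grid_N[OF ab L elim(2)] by (simp add: node_def)
        qed (simp add: node_def)
        have "(\<Sum>k<N. \<Lambda> (?x (Suc k)) h g - \<Lambda> (?x k) h g) = \<Lambda> b h g - \<Lambda> a h g"
          using sum_lessThan_telescope[of "\<lambda>k. \<Lambda> (?x k) h g" N] grid_0[OF ab L] grid_N[OF ab L elim(2)] by simp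
        then have eq: "dsum a b L N f b h g - (\<Lambda> b h g - \<Lambda> a h g) =
            (\<Sum>k<N. f (?x (Suc k)) * ?P k h g - (\<Lambda> (?x (Suc k)) h g - \<Lambda> (?x k) h g))"
          using node_less[OF ab L, of N] fn by (simp add: dsum_def sum_subtractf)
        have "norm (dsum a b L N f b h g - (\<Lambda> b h g - \<Lambda> a h g)) \<le> (\<Sum>k<N. \<eta> / 2 * (Re (?P k h h) + Re (?P k g g)))"
          unfolding eq
        proof (rule sum_norm_le)
          fix k assume "k \<in> {..<N}"
          then have k: "a \<le> ?x k" "?x k \<le> ?x (Suc k)" "?x (Suc k) \<le> b"
            using grid_ge[OF ab L] grid_mono[OF ab L] grid_le[OF ab L elim(2)] by auto
          have "cmod (f t - f (?x (Suc k))) \<le> \<eta>" if "?x k \<le> t" "t \<le> ?x (Suc k)" for t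
            using that k elim(1) grid_Suc[OF ab L, of N k] by (intro \<delta>(2)) auto
          then show "cmod (f (?x (Suc k)) * ?P k h g - (\<Lambda> (?x (Suc k)) h g - \<Lambda> (?x k) h g)) \<le> \<eta> / 2 * (Re (?P k h h) + Re (?P k g g))"
            unfolding cell_def using k \<eta> by (intro integratesD[OF \<Lambda>]) auto
        qed
        also have "\<dots> = \<eta> / 2 * (Re (\<Sum>k<N. ?P k h h) + Re (\<Sum>k<N. ?P k g g))" by (rule sum_mult_Re_add)
        also have "\<dots> = \<eta> / 2 * C" using sum_cell[OF ab L, of N N] grid_N[OF ab L elim(2)] by (simp add: C_def)
        also have "\<dots> < e"
        proof -
          have "\<eta> * C < \<eta> * (2 * (C + 1))" using \<eta> C by (intro mult_strict_left_mono) auto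
          also have "\<dots> = 2 * e" using C add_pos_nonneg[of 1 C] by (simp add: \<eta>_def field_simps)
          finally show ?thesis by simp
        qed
        finally show ?case .
      qed
      then show "\<exists>no. \<forall>n\<ge>no. norm (dsum a b L n f b h g - (\<Lambda> b h g - \<Lambda> a h g)) < e"
        by (simp add: eventually_sequentially)
    qed
    then have "((\<lambda>N. dsum a b L N f b h g) \<longlongrightarrow> \<Lambda> b h g - \<Lambda> a h g) U" by (rule tendsto_mono[OF U(1)])
    then show "cinner (J f h) g = \<Lambda> b h g - \<Lambda> a h g"
      using tendsto_unique[OF U(2) Y[OF f]] W(2)[OF f] by (metis J_def)
  next
    fix x h g
    assume lc: "\<And>x h g. a < x \<Longrightarrow> x \<le> b \<Longrightarrow> ((\<lambda>s. L s h g) \<longlongrightarrow> L x h g) (at_left x)" and x: "x \<in> {a..b}"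
    show "cinner (F x h) g = L x h g - L a h g"
    proof (cases "x = a")
      case True then show ?thesis using ab by (simp add: F W1 Ya)
    next
      case False
      \<comment> \<open>Grid points approach y strictly from the left. This is used at y = x and at
        y = b; the latter shows that the mass of the moved last cell vanishes in the limit.\<close>
      have lim: "\<exists>j. (\<forall>N>0. j N < N \<and> grid a b N (j N) < y \<and> y \<le> grid a b N (Suc (j N))) \<and>
          (\<lambda>N. L (grid a b N (j N)) h g) \<longlonglongrightarrow> L y h g" if y: "a < y" "y \<le> b" for y
      proof -
        have "\<exists>j. j < N \<and> grid a b N j < y \<and> y \<le> grid a b N (Suc j)" if "0 < N" for N
          using grid_bracket[OF ab L that y] by metis
        then obtain j where j: "\<And>N. 0 < N \<Longrightarrow> j N < N \<and> grid a b N (j N) < y \<and> y \<le> grid a b N (Suc (j N))" by metis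
        have lo: "y - (b - a) / real N \<le> grid a b N (j N)" "grid a b N (j N) \<le> y" if "0 < N" for N
          using j[OF that] grid_Suc[OF ab L, of N "j N"] by auto
        have "(\<lambda>N. grid a b N (j N)) \<longlonglongrightarrow> y"
        proof (rule real_tendsto_sandwich[of "\<lambda>N. y - (b - a) / real N" _ _ "\<lambda>_. y"])
          show "(\<lambda>N. y - (b - a) / real N) \<longlonglongrightarrow> y"
            using tendsto_diff[OF tendsto_const[of y] lim_const_over_n[of "b - a"]] by simp
        qed (auto intro!: eventually_mono[OF eventually_gt_at_top[of "0::nat"]] lo)
        then have "filterlim (\<lambda>N. grid a b N (j N)) (at_left y) sequentially"
          unfolding filterlim_at using j by (auto intro!: eventually_mono[OF eventually_gt_at_top[of "0::nat"]])
        then show ?thesis using j filterlim_compose[OF lc[OF y]] by blast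
      qed
      obtain j where j: "\<And>N. 0 < N \<Longrightarrow> j N < N \<and> grid a b N (j N) < x \<and> x \<le> grid a b N (Suc (j N))"
        "(\<lambda>N. L (grid a b N (j N)) h g) \<longlonglongrightarrow> L x h g" using lim[of x] x False by auto
      obtain i where i: "\<And>N. 0 < N \<Longrightarrow> i N < N \<and> grid a b N (i N) < b \<and> b \<le> grid a b N (Suc (i N))"
        "(\<lambda>N. L (grid a b N (i N)) h g) \<longlonglongrightarrow> L b h g" using lim[of b] ab by auto
      have "(\<lambda>N. L (grid a b N (j N)) h g - L a h g + (L b h g - L (grid a b N (i N)) h g)) \<longlonglongrightarrow>
          L x h g - L a h g + (L b h g - L b h g)" by (intro tendsto_intros j i)
      moreover have "\<forall>\<^sub>F N in sequentially. L (grid a b N (j N)) h g - L a h g + (L b h g - L (grid a b N (i N)) h g)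
          = dsum a b L N ?one x h g"
        using eventually_gt_at_top[of 0]
      proof eventually_elim
        case (elim N)
        have "Suc (i N) = N"
          using grid_strict[OF ab L elim, of "Suc (i N)" N] grid_N[OF ab L elim] i(1)[OF elim] by (cases "Suc (i N) < N") auto
        then have "i N = N - 1" by simp
        then show ?case using dsum_one_eq[OF ab L elim, of "j N" x h g] j(1)[OF elim] x False by simp
      qed
      ultimately have "(\<lambda>N. dsum a b L N ?one x h g) \<longlonglongrightarrow> L x h g - L a h g + (L b h g - L b h g)"
        by (rule Lim_transform_eventually)
      then have "((\<lambda>N. dsum a b L N ?one x h g) \<longlongrightarrow> L x h g - L a h g) U" by (auto intro: tendsto_mono[OF U(1)])
      then show ?thesis using tendsto_unique[OF U(2) Y1] x by (simp add: F W1)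
    qed
  qed
qed

section \<open>The operator Herglotz theorem\<close>

definition circ_exp :: "real \<Rightarrow> complex"
  where "circ_exp t = exp (\<i> * of_real t)"

definition herglotz_kernel :: "complex \<Rightarrow> real \<Rightarrow> complex"
  where "herglotz_kernel \<zeta> t = (1 + \<zeta> * circ_exp t) / (1 - \<zeta> * circ_exp t)"

lemma circ_exp_cis: "circ_exp t = cis t"
  by (simp add: circ_exp_def cis_conv_exp)

lemma norm_circ_exp [simp]: "cmod (circ_exp t) = 1"
  by (simp add: circ_exp_cis)

lemma circ_exp_nonzero [simp]: "circ_exp t \<noteq> 0"
  by (simp add: circ_exp_def)

lemma continuous_circ_exp: "continuous_on A circ_exp"
  unfolding circ_exp_def[abs_def] by (intro continuous_intros)

lemma one_minus_circ_exp_bound: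
  assumes "cmod \<zeta> < 1" shows "1 - cmod \<zeta> \<le> cmod (1 - \<zeta> * circ_exp t)" "1 - \<zeta> * circ_exp t \<noteq> 0"
proof -
  show *: "1 - cmod \<zeta> \<le> cmod (1 - \<zeta> * circ_exp t)"
    using norm_triangle_ineq2[of 1 "\<zeta> * circ_exp t"] by (simp add: norm_mult)
  show "1 - \<zeta> * circ_exp t \<noteq> 0" using * assms by auto
qed

lemma continuous_herglotz_kernel: "cmod \<zeta> < 1 \<Longrightarrow> continuous_on A (herglotz_kernel \<zeta>)"
  unfolding herglotz_kernel_def[abs_def]
  using one_minus_circ_exp_bound(2)[of \<zeta>] by (intro continuous_intros continuous_circ_exp) auto

text \<open>For w = r e^(it) one has dw = i w dt, which accounts for the factor w and the division
  by i.\<close>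

lemma circle_integral:
  assumes "(f has_contour_integral I) (circlepath 0 r)"
  shows "((\<lambda>t. f (of_real r * circ_exp t) * (of_real r * circ_exp t)) has_integral I / \<i>) {0..2 * pi}"
proof -
  have "((\<lambda>t. f (0 + of_real r * cis t) * of_real r * \<i> * cis t) has_integral I) {0..2 * pi}"
    using assms by (simp add: circlepath_def has_contour_integral_part_circlepath_iff)
  from has_integral_mult_left[OF this, of "1 / \<i>"] show ?thesis
    by (simp add: circ_exp_cis mult_ac)
qed

text \<open>The boundary function is evaluated at r e^(-it) while the kernel contains e^(it);
  reflection exchanges the two exponents.\<close>

lemma has_integral_reflect_period:
  assumes "((\<lambda>t. f (2 * pi - t)) has_integral I) {0..2 * pi}"
  shows "((f :: real \<Rightarrow> complex) has_integral I) {0..2 * pi}"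
proof -
  have "((\<lambda>t. f (2 * pi - (- 1 * t + 2 * pi))) has_integral I) ((\<lambda>x. - x + 2 * pi) ` {0..2 * pi})"
    using has_integral_affinity[of "\<lambda>t. f (2 * pi - t)" I 0 "2 * pi" "-1" "2 * pi"] assms by simp
  moreover have "(\<lambda>x. - x + 2 * pi) ` {0..2 * pi} = {0..2 * pi}"
  proof (rule set_eqI)
    fix y show "y \<in> (\<lambda>x. - x + 2 * pi) ` {0..2 * pi} \<longleftrightarrow> y \<in> {0..2 * pi}"
      by (auto simp: image_iff intro!: bexI[of _ "2 * pi - y"])
  qed
  ultimately show ?thesis by simp
qed

lemma circ_exp_reflect: "circ_exp (2 * pi - t) = inverse (circ_exp t)" "circ_exp (- t) = inverse (circ_exp t)"
  "cnj (circ_exp t) = inverse (circ_exp t)"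
  by (simp_all add: circ_exp_cis cis_cnj cis_inverse complex_eq_iff)

text \<open>Substituting \<open>w = r e\<^sup>i\<^sup>t\<close> turns the kernel into \<open>(w + \<zeta> r) / (w - \<zeta> r)\<close>, so that the two integrals
  are Cauchy integrals of functions holomorphic near the closed disc of radius \<open>r\<close>.\<close>

lemma herglotz_mean_holomorphic:
  fixes g :: "complex \<Rightarrow> complex"
  assumes g: "g holomorphic_on ball 0 1" and r: "0 < r" "r < 1" and \<zeta>: "cmod \<zeta> < 1"
  shows "((\<lambda>t. herglotz_kernel \<zeta> t * g (of_real r * circ_exp (- t))) has_integral
    2 * pi * (2 * g (\<zeta> * of_real r) - g 0)) {0..2 * pi}"
proof (rule has_integral_reflect_period)
  have gr: "g holomorphic_on cball 0 r" using r by (intro holomorphic_on_subset[OF g]) auto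
  define a where "a = \<zeta> * of_real r"
  have a: "cmod a < r" using \<zeta> r by (simp add: a_def norm_mult)
  have "((\<lambda>u. 2 * (g u / (u - a)) - g u / (u - 0)) has_contour_integral
      2 * (2 * of_real pi * \<i> * g a) - 2 * of_real pi * \<i> * g 0) (circlepath 0 r)"
    using gr a r by (intro has_contour_integral_diff has_contour_integral_lmul Cauchy_integral_circlepath_simple) auto
  from circle_integral[OF this]
  have I: "((\<lambda>t. (2 * (g (r * circ_exp t) / (r * circ_exp t - a)) - g (r * circ_exp t) / (r * circ_exp t - 0)) * (r * circ_exp t))
    has_integral 2 * pi * (2 * g a - g 0)) {0..2 * pi}"
    by (simp add: algebra_simps)
  have "(2 * (g (r * circ_exp t) / (r * circ_exp t - a)) - g (r * circ_exp t) / (r * circ_exp t - 0)) * (r * circ_exp t)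
     = herglotz_kernel \<zeta> (2 * pi - t) * g (of_real r * circ_exp (- (2 * pi - t)))" for t
  proof -
    let ?w = "of_real r * circ_exp t"
    have w: "?w \<noteq> 0" using r by simp
    have wa: "?w - a \<noteq> 0" using a r by (auto simp: norm_mult dest!: arg_cong[where f=cmod])
    have e: "circ_exp (- (2 * pi - t)) = circ_exp t"
      by (simp add: circ_exp_cis complex_eq_iff cos_diff sin_diff)
    have "herglotz_kernel \<zeta> (2 * pi - t) = (1 + a / ?w) / (1 - a / ?w)"
      using r by (simp add: herglotz_kernel_def circ_exp_reflect a_def divide_simps)
    also have "\<dots> = (?w + a) / (?w - a)"
      using w wa by (simp add: divide_simps)
    finally have K: "herglotz_kernel \<zeta> (2 * pi - t) = (?w + a) / (?w - a)" .
    have "(2 * (G / (w - a)) - G / (w - 0)) * w = (w + a) / (w - a) * G" if "w \<noteq> 0" "w - a \<noteq> 0" for w G :: complex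
      using that by (simp add: field_simps)
    from this[OF w wa] show ?thesis unfolding e K .
  qed
  then show "((\<lambda>t. herglotz_kernel \<zeta> (2 * pi - t) * g (of_real r * circ_exp (- (2 * pi - t)))) has_integral
    2 * pi * (2 * g (\<zeta> * of_real r) - g 0)) {0..2 * pi}"
    using I by (simp add: a_def)
qed

lemma herglotz_mean_antiholomorphic:
  fixes g :: "complex \<Rightarrow> complex"
  assumes g: "g holomorphic_on ball 0 1" and r: "0 < r" "r < 1" and \<zeta>: "cmod \<zeta> < 1"
  shows "((\<lambda>t. herglotz_kernel \<zeta> t * cnj (g (of_real r * circ_exp (- t)))) has_integral
    2 * pi * cnj (g 0)) {0..2 * pi}"
proof -
  \<comment> \<open>Conjugation turns e^(-it) into w / r, so the kernel becomes holomorphic on the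
    closed disc of radius r and the mean is the value at 0.\<close>
  define q where "q w = (1 + cnj \<zeta> * w / of_real r) / (1 - cnj \<zeta> * w / of_real r) * g w" for w
  have nz: "1 - cnj \<zeta> * w / of_real r \<noteq> 0" if "cmod w \<le> r" for w
  proof
    assume "1 - cnj \<zeta> * w / of_real r = 0"
    then have "cmod (cnj \<zeta> * w / of_real r) = 1" by simp
    then have "cmod \<zeta> * cmod w = r" using r by (simp add: norm_mult norm_divide)
    moreover have "cmod \<zeta> * cmod w \<le> cmod \<zeta> * r" using that by (intro mult_left_mono) auto
    moreover have "cmod \<zeta> * r < r" using \<zeta> r by simp
    ultimately show False by linarith
  qed
  have gr: "g holomorphic_on cball 0 r" using r by (intro holomorphic_on_subset[OF g]) auto
  have "q holomorphic_on cball 0 r" unfolding q_def[abs_def]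
    using nz r by (intro holomorphic_intros gr) auto
  then have "((\<lambda>u. q u / (u - 0)) has_contour_integral (2 * of_real pi * \<i> * q 0)) (circlepath 0 r)"
    using r by (intro Cauchy_integral_circlepath_simple) auto
  from circle_integral[OF this]
  moreover have "q (r * circ_exp t) / (r * circ_exp t - 0) * (r * circ_exp t) = q (r * circ_exp t)" for t
    using r by simp
  moreover have "2 * of_real pi * \<i> * q 0 / \<i> = 2 * pi * g 0" by (simp add: q_def)
  ultimately have "((\<lambda>t. q (r * circ_exp t)) has_integral 2 * pi * g 0) {0..2 * pi}" by (simp only:)
  moreover have "q (r * circ_exp t) = cnj (herglotz_kernel \<zeta> (2 * pi - t)) * g (of_real r * circ_exp (- (2 * pi - t)))" for t
  proof -
    have e: "circ_exp (- (2 * pi - t)) = circ_exp t"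
      by (simp add: circ_exp_cis complex_eq_iff cos_diff sin_diff)
    show ?thesis unfolding e using r by (simp add: q_def herglotz_kernel_def circ_exp_reflect)
  qed
  ultimately have "((\<lambda>t. cnj (herglotz_kernel \<zeta> (2 * pi - t)) * g (of_real r * circ_exp (- (2 * pi - t))))
     has_integral 2 * pi * g 0) {0..2 * pi}" by simp
  then have "((\<lambda>t. cnj (herglotz_kernel \<zeta> t) * g (of_real r * circ_exp (- t))) has_integral 2 * pi * g 0) {0..2 * pi}"
    by (rule has_integral_reflect_period)
  then have "((cnj \<circ> (\<lambda>t. cnj (herglotz_kernel \<zeta> t) * g (of_real r * circ_exp (- t)))) has_integral cnj (2 * pi * g 0)) {0..2 * pi}"
    by (simp only: has_integral_cnj)
  then show ?thesis by (simp add: comp_def)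
qed

lemma hk_integral_Re: "f integrable_on A \<Longrightarrow> integral A (\<lambda>x. Re (f x)) = Re (integral A f)"
  and hk_integral_Im: "f integrable_on A \<Longrightarrow> integral A (\<lambda>x. Im (f x)) = Im (integral A f)"
  using integral_linear[of f A Re] integral_linear[of f A Im] by (simp_all add: o_def bounded_linear_Re bounded_linear_Im)

lemma density_integrates:
  fixes \<rho> :: "real \<Rightarrow> 'h::chilbert_space \<Rightarrow> 'h \<Rightarrow> complex"
  assumes psd: "\<And>s. psd (\<rho> s)" and cont: "\<And>h g. continuous_on {a..b} (\<lambda>s. \<rho> s h g)" and f: "continuous_on {a..b} f"
  shows "integrates (\<lambda>x h g. integral {a..x} (\<lambda>s. \<rho> s h g)) f (\<lambda>x h g. integral {a..x} (\<lambda>s. f s * \<rho> s h g)) a b"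
  unfolding integrates_def
proof (intro allI impI)
  fix u v c \<eta> h g
  assume uv: "a \<le> u" "u \<le> v" "v \<le> b" "0 \<le> \<eta>" "\<forall>t\<in>{u..v}. cmod (f t - c) \<le> \<eta>"
  have inc: "integral {a..v} \<phi> - integral {a..u} \<phi> = integral {u..v} \<phi>" if "continuous_on {a..b} \<phi>" for \<phi> :: "real \<Rightarrow> complex"
  proof -
    have "\<phi> integrable_on {a..v}" using that uv by (intro integrable_continuous_real) (auto elim: continuous_on_subset)
    then show ?thesis using Henstock_Kurzweil_Integration.integral_combine[of a u v \<phi>] uv by (simp add: algebra_simps)
  qed
  have int: "\<phi> integrable_on {u..v}" if "continuous_on {a..b} \<phi>" for \<phi> :: "real \<Rightarrow> complex"
    using that uv by (intro integrable_continuous_real) (auto elim: continuous_on_subset)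
  have cf: "continuous_on {a..b} (\<lambda>s. f s * \<rho> s h g)" by (intro continuous_on_mult f cont)
  have X: "c * integral {u..v} (\<lambda>s. \<rho> s h g) - integral {u..v} (\<lambda>s. f s * \<rho> s h g) = integral {u..v} (\<lambda>s. (c - f s) * \<rho> s h g)"
    by (simp add: left_diff_distrib Henstock_Kurzweil_Integration.integral_diff[OF integrable_on_mult_right[OF int[OF cont]] int[OF cf]] Henstock_Kurzweil_Integration.integral_mult_right)
  have "cmod (integral {u..v} (\<lambda>s. (c - f s) * \<rho> s h g)) \<le> integral {u..v} (\<lambda>s. \<eta> / 2 * (Re (\<rho> s h h) + Re (\<rho> s g g)))"
  proof (rule integral_norm_bound_integral)
    show "(\<lambda>s. (c - f s) * \<rho> s h g) integrable_on {u..v}"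
      by (intro int continuous_intros f cont)
    show "(\<lambda>s. \<eta> / 2 * (Re (\<rho> s h h) + Re (\<rho> s g g))) integrable_on {u..v}"
      using uv by (intro integrable_continuous_real continuous_intros continuous_on_subset[OF cont]) auto
    fix s assume s: "s \<in> {u..v}"
    have "cmod (c - f s) \<le> \<eta>" using uv(5) s by (simp add: norm_minus_commute)
    then have "cmod (c - f s) * cmod (\<rho> s h g) \<le> \<eta> * ((Re (\<rho> s h h) + Re (\<rho> s g g)) / 2)"
      using uv(4) by (intro mult_mono psd_amgm psd) auto
    then show "cmod ((c - f s) * \<rho> s h g) \<le> \<eta> / 2 * (Re (\<rho> s h h) + Re (\<rho> s g g))" by (simp add: norm_mult)
  qed
  also have "\<dots> = \<eta> / 2 * (Re (integral {u..v} (\<lambda>s. \<rho> s h h)) + Re (integral {u..v} (\<lambda>s. \<rho> s g g)))"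
  proof -
    have 1: "(\<lambda>s. Re (\<rho> s h h)) integrable_on {u..v}" for h
      using uv by (intro integrable_continuous_real continuous_intros continuous_on_subset[OF cont]) auto
    show ?thesis
      by (simp only: Henstock_Kurzweil_Integration.integral_mult_right Henstock_Kurzweil_Integration.integral_add[OF 1 1] hk_integral_Re[OF int[OF cont]])
  qed
  finally show "cmod (c * (integral {a..v} (\<lambda>s. \<rho> s h g) - integral {a..u} (\<lambda>s. \<rho> s h g)) -
      (integral {a..v} (\<lambda>s. f s * \<rho> s h g) - integral {a..u} (\<lambda>s. f s * \<rho> s h g)))
    \<le> \<eta> / 2 * (Re (integral {a..v} (\<lambda>s. \<rho> s h h) - integral {a..u} (\<lambda>s. \<rho> s h h)) +
       Re (integral {a..v} (\<lambda>s. \<rho> s g g) - integral {a..u} (\<lambda>s. \<rho> s g g)))"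
    unfolding inc[OF cont] inc[OF cf] X .
qed

lemma density_mono_forms:
  fixes \<rho> :: "real \<Rightarrow> 'h::chilbert_space \<Rightarrow> 'h \<Rightarrow> complex"
  assumes psd: "\<And>s. psd (\<rho> s)" and cont: "\<And>h g. continuous_on {a..b} (\<lambda>s. \<rho> s h g)"
  shows "mono_forms (\<lambda>x h g. integral {a..x} (\<lambda>s. \<rho> s h g)) a b"
  unfolding mono_forms_def
proof (intro allI impI)
  fix u v :: real
  assume uv: "a \<le> u" "u \<le> v" "v \<le> b"
  have int: "(\<lambda>s. \<rho> s h g) integrable_on {u..v}" for h g
    using uv by (intro integrable_continuous_real continuous_on_subset[OF cont]) auto
  have int': "(\<lambda>s. \<rho> s h g) integrable_on {a..v}" for h g
    using uv by (intro integrable_continuous_real continuous_on_subset[OF cont]) auto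
  have inc: "integral {a..v} (\<lambda>s. \<rho> s h g) - integral {a..u} (\<lambda>s. \<rho> s h g) = integral {u..v} (\<lambda>s. \<rho> s h g)" for h g
    using Henstock_Kurzweil_Integration.integral_combine[OF uv(1,2) int'] by (simp add: algebra_simps)
  note s = sesqD[OF psd_sesq[OF psd]]
  show "psd (\<lambda>h g. integral {a..v} (\<lambda>s. \<rho> s h g) - integral {a..u} (\<lambda>s. \<rho> s h g))"
    unfolding inc
  proof (rule psdI)
    show "sesq (\<lambda>h g. integral {u..v} (\<lambda>s. \<rho> s h g))"
      by (simp add: sesq_def s Henstock_Kurzweil_Integration.integral_add[OF int int])
    fix x
    have "Re (integral {u..v} (\<lambda>s. \<rho> s x x)) = integral {u..v} (\<lambda>s. Re (\<rho> s x x))" by (simp add: hk_integral_Re[OF int])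
    also have "0 \<le> \<dots>" using int[of x x] by (intro integral_nonneg psd_nonneg psd) (auto dest: integrable_linear[OF _ bounded_linear_Re] simp: o_def)
    finally show "0 \<le> Re (integral {u..v} (\<lambda>s. \<rho> s x x))" .
    show "Im (integral {u..v} (\<lambda>s. \<rho> s x x)) = 0"
      by (simp add: hk_integral_Im[OF int, symmetric] psd_Im[OF psd])
  qed
qed

text \<open>The Hermitian part of B on the circle of radius r < 1 is a non-negative continuous
  density whose Herglotz transform at \<zeta> is B at \<zeta> r. The indefinite integrals of these
  densities converge along a filter finer than r -> 1, and the inequality \<open>integrates\<close>
  carries the transform to the limit.\<close>

theorem operator_herglotz:
  fixes B :: "complex \<Rightarrow> 'h::chilbert_space \<Rightarrow> 'h \<Rightarrow> complex"
  assumes sq: "\<And>z. cmod z < 1 \<Longrightarrow> sesq (B z)"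
    and hol: "\<And>h g. (\<lambda>z. B z h g) holomorphic_on ball 0 1"
    and pos: "\<And>z h. cmod z < 1 \<Longrightarrow> 0 \<le> Re (B z h h)"
    and herm: "\<And>h g. cnj (B 0 g h) = B 0 h g"
    and M: "\<And>h. Re (B 0 h h) \<le> M * (norm h)\<^sup>2"
  obtains F where "distribution_fun 0 (2 * pi) F"
    "\<And>\<zeta>. cmod \<zeta> < 1 \<Longrightarrow> \<exists>T. has_rs_integral (herglotz_kernel \<zeta>) F 0 (2 * pi) T \<and> (\<forall>h g. cinner (T h) g = B \<zeta> h g)"
proof -
  \<comment> \<open>The Hermitian part, half the sum of B and its adjoint form, divided by the
    length 2 pi. The point r e^(-is) appears because the kernel is a power series in \<zeta>
    e^(is).\<close>
  define \<rho> where "\<rho> r s h g = (B (of_real r * circ_exp (- s)) h g + cnj (B (of_real r * circ_exp (- s)) g h)) / (4 * pi)" for r s h g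
  have w: "cmod (of_real r * circ_exp (- s)) < 1" if "0 < r" "r < 1" for r s using that by (simp add: norm_mult)
  have psd\<rho>: "psd (\<rho> r s)" if r: "0 < r" "r < 1" for r s
  proof (rule psdI)
    note S = sesqD[OF sq[OF w[OF r]]]
    show "sesq (\<rho> r s)" by (simp add: sesq_def \<rho>_def S add_divide_distrib distrib_left)
    show "0 \<le> Re (\<rho> r s x x)" for x using pos[OF w[OF r]] by (simp add: \<rho>_def)
    show "Im (\<rho> r s x x) = 0" for x by (simp add: \<rho>_def)
  qed
  have cont\<rho>: "continuous_on A (\<lambda>s. \<rho> r s h g)" if r: "0 < r" "r < 1" for r A h g
  proof -
    have ce: "continuous_on A (\<lambda>s. of_real r * circ_exp (- s))"
      unfolding circ_exp_def by (intro continuous_intros)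
    have "continuous_on A (\<lambda>s. B (of_real r * circ_exp (- s)) h g)" for h g
      by (rule continuous_on_compose2[OF holomorphic_on_imp_continuous_on[OF hol] ce]) (use w[OF r] in auto)
    then show ?thesis unfolding \<rho>_def by (intro continuous_intros) auto
  qed
  have mean: "integral {0..2 * pi} (\<lambda>s. herglotz_kernel \<zeta> s * \<rho> r s h g) = B (\<zeta> * of_real r) h g"
    if r: "0 < r" "r < 1" and \<zeta>: "cmod \<zeta> < 1" for r \<zeta> h g
  proof -
    have "((\<lambda>s. (herglotz_kernel \<zeta> s * B (of_real r * circ_exp (- s)) h g + herglotz_kernel \<zeta> s * cnj (B (of_real r * circ_exp (- s)) g h)) * (1 / (4 * pi)))
       has_integral (2 * pi * (2 * B (\<zeta> * of_real r) h g - B 0 h g) + 2 * pi * cnj (B 0 g h)) * (1 / (4 * pi))) {0..2 * pi}"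
      by (intro has_integral_mult_left has_integral_add herglotz_mean_holomorphic[OF hol r \<zeta>] herglotz_mean_antiholomorphic[OF hol r \<zeta>])
    \<comment> \<open>The two contributions of the origin cancel by the Hermitian symmetry of B at
      0.\<close>
    moreover have "(2 * pi * (2 * B (\<zeta> * of_real r) h g - B 0 h g) + 2 * pi * cnj (B 0 g h)) * (1 / (4 * pi)) = B (\<zeta> * of_real r) h g"
      by (simp add: herm field_simps)
    ultimately show ?thesis by (intro integral_unique) (simp add: \<rho>_def field_simps)
  qed
  have total: "integral {0..2 * pi} (\<lambda>s. \<rho> r s h g) = B 0 h g" if "0 < r" "r < 1" for r h g
    using mean[OF that, of 0 h g] by (simp add: herglotz_kernel_def)
  define \<Lambda> where "\<Lambda> r f x h g = integral {0..x} (\<lambda>s. f s * \<rho> r s h g)" for r f x h g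
  let ?one = "\<lambda>_::real. 1::complex"
  have int: "integrates (\<Lambda> r ?one) f (\<Lambda> r f) 0 (2 * pi)" if r: "0 < r" "r < 1" and f: "continuous_on {0..2 * pi} f" for r f
    using density_integrates[of "\<rho> r" 0 "2 * pi" f, OF psd\<rho>[OF r] cont\<rho>[OF r] f] unfolding \<Lambda>_def[abs_def] mult_1 .
  have mono: "mono_forms (\<Lambda> r ?one) 0 (2 * pi)" if r: "0 < r" "r < 1" for r
    using density_mono_forms[of "\<rho> r" 0 "2 * pi", OF psd\<rho>[OF r] cont\<rho>[OF r]] unfolding \<Lambda>_def[abs_def] mult_1 .
  define X where "X r = (\<lambda>(f, x, h, g). if continuous_on {0..2 * pi} f \<and> 0 \<le> x \<and> x \<le> 2 * pi then \<Lambda> r f x h g else 0)" for r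
  define c where "c = (\<lambda>(f::real\<Rightarrow>complex, x::real, h, g). (SOME c. \<forall>t\<in>{0..2 * pi}. cmod (f t) \<le> c) / 2 * (Re (B 0 h h) + Re (B 0 g g)))"
  define c' where "c' n = max (c n) 0" for n
  have r01: "\<forall>\<^sub>F r in at_left (1::real). 0 < r \<and> r < 1"
    by (auto simp: eventually_at_left[of 0] intro!: exI[of _ 0])
  have bd: "\<forall>\<^sub>F r in at_left 1. cmod (X r n) \<le> c' n" for n
    using r01
  proof eventually_elim
    case (elim r)
    then have r: "0 < r" "r < 1" by auto
    obtain f x h g where n: "n = (f, x, h, g)" by (cases n)
    show ?case
    proof (cases "continuous_on {0..2 * pi} f \<and> 0 \<le> x \<and> x \<le> 2 * pi")
      case True
      then have "\<exists>c. \<forall>t\<in>{0..2 * pi}. cmod (f t) \<le> c" using continuous_bounded_Icc by blast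
      then have C: "\<forall>t\<in>{0..2 * pi}. cmod (f t) \<le> (SOME c. \<forall>t\<in>{0..2 * pi}. cmod (f t) \<le> c)" by (rule someI_ex)
      define C where "C = (SOME c. \<forall>t\<in>{0..2 * pi}. cmod (f t) \<le> c)"
      have C0: "0 \<le> C" using C order_trans[OF norm_ge_zero[of "f 0"], of C] by (simp add: C_def)
      have le: "Re (\<Lambda> r ?one x k k - \<Lambda> r ?one 0 k k) \<le> Re (B 0 k k)" for k
      proof -
        have "Re (\<Lambda> r ?one x k k) \<le> Re (\<Lambda> r ?one (2 * pi) k k)"
          using True by (intro mono_forms_Re[OF mono[OF r]]) auto
        then show ?thesis using total[OF r, of k k] by (simp add: \<Lambda>_def)
      qed
      \<comment> \<open>With comparison constant 0 and \<eta> = C the inequality becomes an a priori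
        bound for the integral of f.\<close>
      have "cmod (0 * (\<Lambda> r ?one x h g - \<Lambda> r ?one 0 h g) - (\<Lambda> r f x h g - \<Lambda> r f 0 h g)) \<le>
          C / 2 * (Re (\<Lambda> r ?one x h h - \<Lambda> r ?one 0 h h) + Re (\<Lambda> r ?one x g g - \<Lambda> r ?one 0 g g))"
        by (rule integratesD[OF int[OF r, of f]]) (use True C C0 in \<open>auto simp: C_def\<close>)
      also have "\<dots> \<le> C / 2 * (Re (B 0 h h) + Re (B 0 g g))"
        using C0 by (intro mult_left_mono add_mono le) auto
      finally show ?thesis using True by (simp add: X_def n c'_def c_def C_def \<Lambda>_def)
    next
      case False
      then have "X r n = 0" unfolding X_def n prod.case by (rule if_not_P)
      then show ?thesis by (simp add: c'_def)
    qed
  qed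
  obtain U Y where U: "U \<le> at_left (1::real)" "U \<noteq> bot" and Y': "\<And>n. ((\<lambda>r. X r n) \<longlongrightarrow> Y n) U"
    using finer_convergent_filter[of "at_left (1::real)" X c'] bd by auto
  define \<Psi> where "\<Psi> f x h g = Y (f, x, h, g)" for f x h g
  have Y: "((\<lambda>r. \<Lambda> r f x h g) \<longlongrightarrow> \<Psi> f x h g) U" if "continuous_on {0..2 * pi} f" "0 \<le> x" "x \<le> 2 * pi" for f x h g
    using Y'[of "(f, x, h, g)"] that by (simp add: X_def \<Psi>_def)
  note U01 = filter_leD[OF U(1) r01]
  have int\<Psi>: "integrates (\<Psi> ?one) f (\<Psi> f) 0 (2 * pi)" if f: "continuous_on {0..2 * pi} f" for f
    by (rule integrates_limit[OF U(2), of "\<lambda>r. \<Lambda> r ?one" _ "\<lambda>r. \<Lambda> r f"])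
      (use U01 int[OF _ _ f] Y[OF f] Y[OF continuous_on_const, of _ 1] in \<open>auto elim: eventually_mono\<close>)
  have mono\<Psi>: "mono_forms (\<Psi> ?one) 0 (2 * pi)"
    unfolding mono_forms_def
  proof (intro allI impI)
    fix s t :: real assume st: "0 \<le> s" "s \<le> t" "t \<le> 2 * pi"
    show "psd (\<lambda>h g. \<Psi> ?one t h g - \<Psi> ?one s h g)"
    proof (rule psd_limit[OF U(2)])
      show "\<forall>\<^sub>F r in U. psd (\<lambda>h g. \<Lambda> r ?one t h g - \<Lambda> r ?one s h g)"
        using U01 by eventually_elim (use st in \<open>auto intro: mono_formsD[OF mono]\<close>)
      show "((\<lambda>r. \<Lambda> r ?one t h g - \<Lambda> r ?one s h g) \<longlongrightarrow> \<Psi> ?one t h g - \<Psi> ?one s h g) U" for h g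
        using st by (intro tendsto_diff Y) auto
    qed
  qed
  have \<Psi>0: "\<Psi> f 0 h g = 0" if f: "continuous_on {0..2 * pi} f" for f h g
    by (rule tendsto_unique[OF U(2) Y[OF f]]) (auto simp: \<Lambda>_def)
  have \<Psi>end: "\<Psi> (herglotz_kernel \<zeta>) (2 * pi) h g = B \<zeta> h g" if \<zeta>: "cmod \<zeta> < 1" for \<zeta> h g
  proof (rule tendsto_unique[OF U(2) Y])
    have "((\<lambda>r. B (\<zeta> * of_real r) h g) \<longlongrightarrow> B (\<zeta> * of_real 1) h g) (at_left 1)"
    proof (rule isCont_tendsto_compose[where g="\<lambda>z. B z h g"])
      show "isCont (\<lambda>z. B z h g) (\<zeta> * of_real 1)"
        using holomorphic_on_imp_continuous_on[OF hol] \<zeta> by (simp add: continuous_on_eq_continuous_at)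
    qed (intro tendsto_intros)
    then have "((\<lambda>r. B (\<zeta> * of_real r) h g) \<longlongrightarrow> B \<zeta> h g) U" using tendsto_mono[OF U(1)] by simp
    then show "((\<lambda>r. \<Lambda> r (herglotz_kernel \<zeta>) (2 * pi) h g) \<longlongrightarrow> B \<zeta> h g) U"
      by (rule Lim_transform_eventually) (use U01 mean[OF _ _ \<zeta>] in \<open>auto simp: \<Lambda>_def elim: eventually_mono\<close>)
  qed (auto simp: continuous_herglotz_kernel \<zeta>)
  have \<Psi>one: "\<Psi> ?one (2 * pi) h g = B 0 h g" for h g
  proof -
    have "herglotz_kernel 0 = ?one" by (auto simp: herglotz_kernel_def)
    then show ?thesis using \<Psi>end[of 0 h g] by simp
  qed
  have "Re (\<Psi> ?one (2 * pi) h h - \<Psi> ?one 0 h h) \<le> M * (norm h)\<^sup>2" for h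
    using M[of h] by (simp add: \<Psi>one \<Psi>0)
  note bound = this
  have pos: "0 < 2 * pi" by simp
  \<comment> \<open>The limit \<Psi> may fail to be left-continuous and may charge 2 pi. The kernel
    is periodic, so passing from \<Psi> to F keeps the transform.\<close>
  obtain F J where F: "distribution_fun 0 (2 * pi) F"
    "\<And>f. continuous_on {0..2 * pi} f \<Longrightarrow> has_rs_integral f F 0 (2 * pi) (J f)"
    "\<And>f \<Lambda> h g. continuous_on {0..2 * pi} f \<Longrightarrow> f 0 = f (2 * pi) \<Longrightarrow> integrates (\<Psi> ?one) f \<Lambda> 0 (2 * pi) \<Longrightarrow>
       cinner (J f h) g = \<Lambda> (2 * pi) h g - \<Lambda> 0 h g"
    by (rule left_continuous_representation[OF pos mono\<Psi> bound]) blast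
  show ?thesis
  proof (rule that[OF F(1)])
    fix \<zeta> :: complex assume \<zeta>: "cmod \<zeta> < 1"
    have K: "continuous_on {0..2 * pi} (herglotz_kernel \<zeta>)" by (rule continuous_herglotz_kernel[OF \<zeta>])
    have "cinner (J (herglotz_kernel \<zeta>) h) g = B \<zeta> h g" for h g
      using F(3)[OF K _ int\<Psi>[OF K], of h g] \<Psi>end[OF \<zeta>] \<Psi>0[OF K]
      by (simp add: herglotz_kernel_def circ_exp_cis)
    then show "\<exists>T. has_rs_integral (herglotz_kernel \<zeta>) F 0 (2 * pi) T \<and> (\<forall>h g. cinner (T h) g = B \<zeta> h g)"
      using F(2)[OF K] by blast
  qed
qed

section \<open>Integration against a distribution function on the circle\<close>

definition rs_int :: "(real \<Rightarrow> 'h \<Rightarrow> 'h::chilbert_space) \<Rightarrow> (real \<Rightarrow> complex) \<Rightarrow> 'h \<Rightarrow> 'h"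
  where "rs_int F f = (THE T. has_rs_integral f F 0 (2 * pi) T)"

lemma rs_int_eqI: "has_rs_integral f F 0 (2 * pi) T \<Longrightarrow> rs_int F f = T"
  unfolding rs_int_def by (rule the_equality) (auto intro: has_rs_integral_unique[of 0 "2 * pi"])

context
  fixes F :: "real \<Rightarrow> 'h \<Rightarrow> 'h::chilbert_space"
  assumes F: "distribution_fun 0 (2 * pi) F"
begin

lemma distribution_clinear: "t \<in> {0..2 * pi} \<Longrightarrow> bounded_clinear (F t)"
  and distribution_zero: "F 0 h = 0"
  and distribution_left: "0 < t \<Longrightarrow> t \<le> 2 * pi \<Longrightarrow> ((\<lambda>s. F s h) \<longlongrightarrow> F t h) (at_left t)"
  using F by (auto simp: distribution_fun_def)

lemma distribution_mono_forms: "mono_forms (\<lambda>t h g. cinner (F t h) g) 0 (2 * pi)"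
  unfolding mono_forms_def
proof (intro allI impI)
  fix s t assume st: "0 \<le> s" "s \<le> t" "t \<le> 2 * pi"
  then have "positive_op (\<lambda>h. F t h - F s h)" using F by (auto simp: distribution_fun_def)
  moreover have "bounded_clinear (F s)" "bounded_clinear (F t)" using st by (auto intro: distribution_clinear)
  ultimately have "psd (\<lambda>h g. cinner (F t h - F s h) g)"
    by (subst (asm) positive_op_iff_psd) (simp_all add: bounded_clinear_add bounded_clinear_scaleC scaleC.diff_right)
  then show "psd (\<lambda>h g. cinner (F t h) g - cinner (F s h) g)" by (simp add: cinner.diff_left)
qed

text \<open>F is left-continuous, so the representation theorem applied to the forms of F returns F
  itself; its other clauses then give existence, boundedness and an indefinite integral for every
  continuous integrand.\<close>

lemma rs_int_props:
  assumes f: "continuous_on {0..2 * pi} f"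
  shows "has_rs_integral f F 0 (2 * pi) (rs_int F f)" "bounded_clinear (rs_int F f)"
    "\<exists>\<Psi>. integrates (\<lambda>t h g. cinner (F t h) g) f \<Psi> 0 (2 * pi) \<and>
      (\<forall>h g. cinner (rs_int F f h) g = \<Psi> (2 * pi) h g - \<Psi> 0 h g)"
proof -
  have bc: "bounded_clinear (F (2 * pi))" by (rule distribution_clinear) auto
  obtain K where K: "\<And>h. norm (F (2 * pi) h) \<le> norm h * K" using bounded_clinear_bound[OF bc] by metis
  have M: "Re (cinner (F (2 * pi) h) h - cinner (F 0 h) h) \<le> K * (norm h)\<^sup>2" for h
    using Re_cinner_le[of "F (2 * pi) h" h] mult_right_mono[OF K[of h], of "norm h"]
    by (simp add: distribution_zero cinner.zero_left power2_eq_square mult_ac)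
  have pos: "0 < 2 * pi" by simp
  have lc: "((\<lambda>s. cinner (F s h) g) \<longlongrightarrow> cinner (F x h) g) (at_left x)" if "0 < x" "x \<le> 2 * pi" for x h g
    by (intro cinner.tendsto distribution_left that tendsto_const)
  obtain G J where G: "distribution_fun 0 (2 * pi) G"
    "\<And>f. continuous_on {0..2 * pi} f \<Longrightarrow> bounded_clinear (J f)"
    "\<And>f. continuous_on {0..2 * pi} f \<Longrightarrow> has_rs_integral f G 0 (2 * pi) (J f)"
    "\<And>f. continuous_on {0..2 * pi} f \<Longrightarrow> \<exists>\<Psi>. integrates (\<lambda>t h g. cinner (G t h) g) f \<Psi> 0 (2 * pi) \<and>
       (\<forall>h g. cinner (J f h) g = \<Psi> (2 * pi) h g - \<Psi> 0 h g)"
    "\<And>x h g. x \<in> {0..2 * pi} \<Longrightarrow> cinner (G x h) g = cinner (F x h) g - cinner (F 0 h) g"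
    by (rule left_continuous_representation[OF pos distribution_mono_forms M]) (use lc in blast)
  have "G = F"
  proof (rule extensionalityI)
    show "G \<in> extensional {0..2 * pi}" "F \<in> extensional {0..2 * pi}" using F G(1) by (auto simp: distribution_fun_def)
    show "G x = F x" if "x \<in> {0..2 * pi}" for x
    proof
      fix h show "G x h = F x h"
        by (rule cinner_ext_left) (simp add: G(5)[OF that] distribution_zero cinner.zero_left)
    qed
  qed
  then have "rs_int F f = J f" using G(3)[OF f] by (intro rs_int_eqI) simp
  then show "has_rs_integral f F 0 (2 * pi) (rs_int F f)" "bounded_clinear (rs_int F f)"
    "\<exists>\<Psi>. integrates (\<lambda>t h g. cinner (F t h) g) f \<Psi> 0 (2 * pi) \<and>
      (\<forall>h g. cinner (rs_int F f h) g = \<Psi> (2 * pi) h g - \<Psi> 0 h g)"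
    using G(2,3,4)[OF f] \<open>G = F\<close> by simp_all
qed

lemma rs_int_form_nonneg: "0 \<le> Re (cinner (F (2 * pi) h) h)"
  using psd_nonneg[OF mono_formsD[OF distribution_mono_forms, of 0 "2 * pi"], of h]
  by (simp add: distribution_zero cinner.zero_left)

lemma rs_int_bound:
  assumes f: "continuous_on {0..2 * pi} f" and c: "\<And>t. t \<in> {0..2 * pi} \<Longrightarrow> cmod (f t) \<le> c"
  shows "cmod (cinner (rs_int F f h) g) \<le> c / 2 * (Re (cinner (F (2 * pi) h) h) + Re (cinner (F (2 * pi) g) g))"
proof -
  obtain \<Psi> where \<Psi>: "integrates (\<lambda>t h g. cinner (F t h) g) f \<Psi> 0 (2 * pi)"
    "\<And>h g. cinner (rs_int F f h) g = \<Psi> (2 * pi) h g - \<Psi> 0 h g"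
    using rs_int_props(3)[OF f] by blast
  have "0 \<le> c" using order_trans[OF norm_ge_zero c[of 0]] by simp
  then have "cmod (0 * (cinner (F (2 * pi) h) g - cinner (F 0 h) g) - (\<Psi> (2 * pi) h g - \<Psi> 0 h g))
    \<le> c / 2 * (Re (cinner (F (2 * pi) h) h - cinner (F 0 h) h) + Re (cinner (F (2 * pi) g) g - cinner (F 0 g) g))"
    by (intro integratesD[OF \<Psi>(1)]) (use c in auto)
  then show ?thesis by (simp add: \<Psi>(2) distribution_zero cinner.zero_left norm_minus_commute)
qed

lemma rs_int_add:
  assumes "continuous_on {0..2 * pi} f" "continuous_on {0..2 * pi} g"
  shows "rs_int F (\<lambda>t. f t + g t) h = rs_int F f h + rs_int F g h"
  using rs_int_eqI[OF has_rs_integral_add[OF rs_int_props(1)[OF assms(1)] rs_int_props(1)[OF assms(2)]]] by simp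

lemma rs_int_diff:
  assumes "continuous_on {0..2 * pi} f" "continuous_on {0..2 * pi} g"
  shows "rs_int F (\<lambda>t. f t - g t) h = rs_int F f h - rs_int F g h"
  using rs_int_eqI[OF has_rs_integral_diff[OF rs_int_props(1)[OF assms(1)] rs_int_props(1)[OF assms(2)]]] by simp

lemma rs_int_mult:
  assumes "continuous_on {0..2 * pi} f"
  shows "rs_int F (\<lambda>t. c * f t) h = c *\<^sub>C rs_int F f h"
  using rs_int_eqI[OF has_rs_integral_mult[OF rs_int_props(1)[OF assms]]] by simp

lemma rs_int_const: "rs_int F (\<lambda>t. c) h = c *\<^sub>C F (2 * pi) h"
  using rs_int_eqI[OF has_rs_integral_const[of 0 "2 * pi" c F]] by (simp add: distribution_zero)

lemma rs_int_zero: "rs_int F (\<lambda>t. 0) h = 0"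
  using rs_int_const[of 0] by (simp add: scaleC.zero_left)

lemma rs_int_sum:
  "(\<And>k. k \<in> A \<Longrightarrow> continuous_on {0..2 * pi} (f k)) \<Longrightarrow> rs_int F (\<lambda>t. \<Sum>k\<in>A. f k t) h = (\<Sum>k\<in>A. rs_int F (f k) h)"
  by (induction A rule: infinite_finite_induct) (auto simp: rs_int_zero rs_int_add continuous_on_sum)

lemma cinner_increment_cnj:
  assumes "0 \<le> s" "s \<le> t" "t \<le> 2 * pi"
  shows "cinner (F t h - F s h) g = cnj (cinner (F t g - F s g) h)"
  using psd_hermitian[OF mono_formsD[OF distribution_mono_forms assms], of h g] by (simp add: cinner.diff_left)

lemma rs_int_cnj:
  assumes f: "continuous_on {0..2 * pi} f"
  shows "cinner (rs_int F (\<lambda>t. cnj (f t)) h) g = cnj (cinner (rs_int F f g) h)"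
proof (rule tendsto_unique[OF rs_filter_nonbot[of 0 "2 * pi"]])
  have cf: "continuous_on {0..2 * pi} (\<lambda>t. cnj (f t))" by (intro continuous_intros f)
  show "((\<lambda>p. \<Sum>(t, K)\<in>p. cnj (f t) * cinner (F (Sup K) h - F (Inf K) h) g) \<longlongrightarrow> cinner (rs_int F (\<lambda>t. cnj (f t)) h) g)
      (rs_filter 0 (2 * pi))"
    by (rule has_rs_integral_form[OF rs_int_props(1)[OF cf]])
  show "((\<lambda>p. \<Sum>(t, K)\<in>p. cnj (f t) * cinner (F (Sup K) h - F (Inf K) h) g) \<longlongrightarrow> cnj (cinner (rs_int F f g) h))
      (rs_filter 0 (2 * pi))"
  proof (rule Lim_transform_eventually[OF tendsto_cnj[OF has_rs_integral_form[OF rs_int_props(1)[OF f]]]])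
    show "\<forall>\<^sub>F p in rs_filter 0 (2 * pi). cnj (\<Sum>(t, K)\<in>p. f t * cinner (F (Sup K) g - F (Inf K) g) h) =
        (\<Sum>(t, K)\<in>p. cnj (f t) * cinner (F (Sup K) h - F (Inf K) h) g)"
      using eventually_rs_filter_division
    proof eventually_elim
      case (elim p)
      show ?case unfolding cnj_sum
      proof (rule sum.cong, safe)
        fix t K assume tK: "(t, K) \<in> p"
        note d = tagged_division_ofD[OF elim]
        obtain u v where "K = {u..v}" using d(4)[OF tK] by auto
        moreover have "t \<in> K" "K \<subseteq> {0..2 * pi}" using d(2,3)[OF tK] by auto
        ultimately show "cnj (f t * cinner (F (Sup K) g - F (Inf K) g) h) = cnj (f t) * cinner (F (Sup K) h - F (Inf K) h) g"
          using cinner_increment_cnj[of u v h g] by auto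
      qed
    qed
  qed
qed simp

text \<open>f imitates the indicator function of the half-open interval from 0 to x. In the
  application f comes from a function on the circle and has to return near 2 pi to its value at 0;
  hence the second interval {z..2 * pi} on which only the modulus is controlled.\<close>

lemma rs_int_step_approx:
  assumes f: "continuous_on {0..2 * pi} f" and b: "\<And>t. cmod (f t) \<le> 1"
    and yxz: "0 \<le> y" "y \<le> x" "x \<le> z" "z \<le> 2 * pi"
    and one: "\<And>t. 0 \<le> t \<Longrightarrow> t \<le> y \<Longrightarrow> f t = 1" and zero: "\<And>t. x \<le> t \<Longrightarrow> t \<le> z \<Longrightarrow> f t = 0"
  shows "cmod (cinner (rs_int F f h) g - cinner (F x h) g)
    \<le> (Re (cinner (F x h) h - cinner (F y h) h) + Re (cinner (F x g) g - cinner (F y g) g))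
      + (Re (cinner (F (2 * pi) h) h - cinner (F z h) h) + Re (cinner (F (2 * pi) g) g - cinner (F z g) g))"
proof -
  obtain \<Psi> where \<Psi>: "integrates (\<lambda>t h g. cinner (F t h) g) f \<Psi> 0 (2 * pi)"
    "\<And>h g. cinner (rs_int F f h) g = \<Psi> (2 * pi) h g - \<Psi> 0 h g"
    using rs_int_props(3)[OF f] by blast
  let ?D = "\<lambda>u v. Re (cinner (F v h) h - cinner (F u h) h) + Re (cinner (F v g) g - cinner (F u g) g)"
  have D: "0 \<le> ?D u v" "cmod (cinner (F v h) g - cinner (F u h) g) \<le> ?D u v / 2" if "0 \<le> u" "u \<le> v" "v \<le> 2 * pi" for u v
    using psd_nonneg[OF mono_formsD[OF distribution_mono_forms that]] psd_amgm[OF mono_formsD[OF distribution_mono_forms that]]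
    by (auto simp: add_nonneg_nonneg)
  \<comment> \<open>Where the integrand is constant, on {0..y} and {x..z}, the inequality holds with
    \<eta> = 0 and determines the increment; the other two intervals are only estimated.\<close>
  have 1: "\<Psi> y h g - \<Psi> 0 h g = cinner (F y h) g"
    using integratesD[OF \<Psi>(1), of 0 y 0 1 h g] one yxz by (auto simp: distribution_zero cinner.zero_left)
  have 2: "cmod (\<Psi> x h g - \<Psi> y h g) \<le> ?D y x / 2"
    using integratesD[OF \<Psi>(1), of y x 1 0 h g] b yxz by (auto simp: norm_minus_commute)
  have 3: "\<Psi> z h g - \<Psi> x h g = 0"
    using integratesD[OF \<Psi>(1), of x z 0 0 h g] zero yxz by auto
  have 4: "cmod (\<Psi> (2 * pi) h g - \<Psi> z h g) \<le> ?D z (2 * pi) / 2"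
    using integratesD[OF \<Psi>(1), of z "2 * pi" 1 0 h g] b yxz by (auto simp: norm_minus_commute)
  have "cinner (rs_int F f h) g - cinner (F x h) g = (\<Psi> x h g - \<Psi> y h g) + (\<Psi> (2 * pi) h g - \<Psi> z h g)
      - (cinner (F x h) g - cinner (F y h) g)"
    using 1 3 by (simp add: \<Psi>(2) algebra_simps)
  then have "cmod (cinner (rs_int F f h) g - cinner (F x h) g) =
      cmod ((\<Psi> x h g - \<Psi> y h g) + (\<Psi> (2 * pi) h g - \<Psi> z h g) - (cinner (F x h) g - cinner (F y h) g))"
    by (rule arg_cong)
  then have "cmod (cinner (rs_int F f h) g - cinner (F x h) g) \<le> cmod (\<Psi> x h g - \<Psi> y h g) + cmod (\<Psi> (2 * pi) h g - \<Psi> z h g)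
      + cmod (cinner (F x h) g - cinner (F y h) g)"
    using norm_triangle_ineq4[of "(\<Psi> x h g - \<Psi> y h g) + (\<Psi> (2 * pi) h g - \<Psi> z h g)" "cinner (F x h) g - cinner (F y h) g"]
      norm_triangle_ineq[of "\<Psi> x h g - \<Psi> y h g" "\<Psi> (2 * pi) h g - \<Psi> z h g"] by linarith
  then show ?thesis using 2 4 D(2)[of y x] D(1)[of z "2 * pi"] yxz by argo
qed

end

section \<open>Taylor coefficients of the Herglotz transform\<close>

lemma herglotz_kernel_expansion:
  assumes "cmod \<zeta> < 1"
  shows "herglotz_kernel \<zeta> t = (\<Sum>k\<le>n. (if k = 0 then 1 else 2) * \<zeta> ^ k * circ_exp t ^ k)
    + 2 * \<zeta> ^ Suc n * (circ_exp t ^ Suc n / (1 - \<zeta> * circ_exp t))"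
proof (induction n)
  case 0
  have "(1 + w) / (1 - w) = 1 + 2 * (w / (1 - w))" if "1 - w \<noteq> 0" for w :: complex
    using that by (simp add: field_simps)
  from this[OF one_minus_circ_exp_bound(2)[OF assms, of t]] show ?case by (simp add: herglotz_kernel_def)
next
  case (Suc n)
  have "2 * \<zeta> ^ Suc n * (circ_exp t ^ Suc n / (1 - \<zeta> * circ_exp t)) = 2 * \<zeta> ^ Suc n * circ_exp t ^ Suc n
      + 2 * \<zeta> ^ Suc (Suc n) * (circ_exp t ^ Suc (Suc n) / (1 - \<zeta> * circ_exp t))"
  proof -
    have "2 * z * (e / y) = 2 * z * e + 2 * (\<zeta> * z) * ((c * e) / y)" if "y = 1 - \<zeta> * c" "y \<noteq> 0" for z e y c :: complex
      using that by (simp add: divide_simps) (simp add: algebra_simps)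
    from this[OF refl one_minus_circ_exp_bound(2)[OF assms, of t], of "\<zeta> ^ Suc n" "circ_exp t ^ Suc n"]
    show ?thesis by simp
  qed
  then show ?case unfolding Suc.IH by simp
qed

text \<open>Letting \<zeta> tend to 0 kills the constant coefficient, and division by \<zeta> lowers
  the degree. Only a remainder estimate enters, in place of uniqueness of power series.\<close>

lemma poly_coeffs_zero_if_small:
  fixes a :: "nat \<Rightarrow> complex"
  assumes "\<And>\<zeta>. 0 < cmod \<zeta> \<Longrightarrow> cmod \<zeta> < 1/2 \<Longrightarrow> cmod (\<Sum>k\<le>n. a k * \<zeta> ^ k) \<le> C * cmod \<zeta> ^ Suc n" and "k \<le> n"
  shows "a k = 0"
  using assms
proof (induction n arbitrary: a k)
  case (0 a k)
  have "((\<lambda>\<zeta>. C * cmod \<zeta>) \<longlongrightarrow> C * cmod 0) (at 0)" by (intro tendsto_intros)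
  then have "((\<lambda>\<zeta>::complex. C * cmod \<zeta>) \<longlongrightarrow> 0) (at 0)" by simp
  moreover have "\<forall>\<^sub>F \<zeta> in at (0::complex). cmod (a 0) \<le> C * cmod \<zeta>"
    unfolding eventually_at using 0(1) by (intro exI[of _ "1/2"]) (auto simp: dist_norm)
  ultimately have "cmod (a 0) \<le> 0" by (intro tendsto_lowerbound[of _ _ "at (0::complex)"]) auto
  then show ?case using 0(2) by simp
next
  case (Suc n a k)
  have shift: "(\<Sum>k\<le>Suc n. a k * \<zeta> ^ k) = a 0 + \<zeta> * (\<Sum>k\<le>n. a (Suc k) * \<zeta> ^ k)" for \<zeta>
    by (simp add: sum.atMost_Suc_shift sum_distrib_left mult_ac del: sum.atMost_Suc)
  have a0: "a 0 = 0"
  proof -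
    have "((\<lambda>\<zeta>. C * cmod \<zeta> ^ Suc (Suc n) + cmod (\<zeta> * (\<Sum>k\<le>n. a (Suc k) * \<zeta> ^ k))) \<longlongrightarrow>
        C * cmod 0 ^ Suc (Suc n) + cmod (0 * (\<Sum>k\<le>n. a (Suc k) * 0 ^ k))) (at 0)" by (intro tendsto_intros)
    then have "((\<lambda>\<zeta>. C * cmod \<zeta> ^ Suc (Suc n) + cmod (\<zeta> * (\<Sum>k\<le>n. a (Suc k) * \<zeta> ^ k))) \<longlongrightarrow> 0) (at 0)" by simp
    moreover have "cmod (a 0) \<le> C * cmod \<zeta> ^ Suc (Suc n) + cmod (\<zeta> * (\<Sum>k\<le>n. a (Suc k) * \<zeta> ^ k))"
      if "0 < cmod \<zeta>" "cmod \<zeta> < 1/2" for \<zeta>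
      using Suc.prems(1)[OF that] norm_triangle_ineq4[of "a 0 + \<zeta> * (\<Sum>k\<le>n. a (Suc k) * \<zeta> ^ k)" "\<zeta> * (\<Sum>k\<le>n. a (Suc k) * \<zeta> ^ k)"]
      unfolding shift by simp
    then have "\<forall>\<^sub>F \<zeta> in at 0. cmod (a 0) \<le> C * cmod \<zeta> ^ Suc (Suc n) + cmod (\<zeta> * (\<Sum>k\<le>n. a (Suc k) * \<zeta> ^ k))"
      unfolding eventually_at by (intro exI[of _ "1/2"]) (auto simp: dist_norm)
    ultimately have "cmod (a 0) \<le> 0" by (intro tendsto_lowerbound[of _ _ "at (0::complex)"]) auto
    then show ?thesis by simp
  qed
  have "cmod (\<Sum>k\<le>n. a (Suc k) * \<zeta> ^ k) \<le> C * cmod \<zeta> ^ Suc n" if \<zeta>: "0 < cmod \<zeta>" "cmod \<zeta> < 1/2" for \<zeta>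
  proof -
    have "cmod \<zeta> * cmod (\<Sum>k\<le>n. a (Suc k) * \<zeta> ^ k) \<le> cmod \<zeta> * (C * cmod \<zeta> ^ Suc n)"
      using Suc.prems(1)[OF \<zeta>] unfolding shift a0 by (simp add: norm_mult mult_ac)
    then show ?thesis using \<zeta>(1) by (simp only: mult_le_cancel_left_pos)
  qed
  then have "a (Suc j) = 0" if "j \<le> n" for j using Suc.IH[of "\<lambda>k. a (Suc k)" j] that by blast
  then show ?case using a0 Suc.prems(2) by (cases k) auto
qed

text \<open>The radius 1/2 keeps |1 - \<zeta> e^(it)| at least 1/2, so the remainder kernel is
  bounded by 2 uniformly in t and \<zeta>.\<close>

lemma transform_expansion:
  fixes F :: "real \<Rightarrow> 'h \<Rightarrow> 'h::chilbert_space"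
  assumes F: "distribution_fun 0 (2 * pi) F"
  shows "\<exists>C. \<forall>\<zeta>. cmod \<zeta> < 1/2 \<longrightarrow> cmod (cinner (rs_int F (herglotz_kernel \<zeta>) h) g
    - (\<Sum>k\<le>n. (if k = 0 then 1 else 2) * \<zeta> ^ k * cinner (rs_int F (\<lambda>t. circ_exp t ^ k) h) g)) \<le> C * cmod \<zeta> ^ Suc n"
proof (intro exI allI impI)
  fix \<zeta> :: complex assume \<zeta>: "cmod \<zeta> < 1/2"
  define D where "D = Re (cinner (F (2 * pi) h) h) + Re (cinner (F (2 * pi) g) g)"
  let ?w = "\<lambda>k. if k = 0 then 1 else 2 :: complex"
  have ce: "continuous_on A (\<lambda>t. circ_exp t ^ k)" "continuous_on A (\<lambda>t. c * circ_exp t ^ k)" for A k c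
    by (intro continuous_intros continuous_circ_exp)+
  have \<zeta>1: "cmod \<zeta> < 1" using \<zeta> by simp
  define R where "R t = circ_exp t ^ Suc n / (1 - \<zeta> * circ_exp t)" for t
  have cR: "continuous_on A R" "continuous_on A (\<lambda>t. c * R t)" for A c
    unfolding R_def[abs_def] using one_minus_circ_exp_bound(2)[OF \<zeta>1]
    by (intro continuous_intros continuous_circ_exp; auto)+
  have "rs_int F (herglotz_kernel \<zeta>) h = rs_int F (\<lambda>t. (\<Sum>k\<le>n. ?w k * \<zeta> ^ k * circ_exp t ^ k) + 2 * \<zeta> ^ Suc n * R t) h"
    using herglotz_kernel_expansion[OF \<zeta>1, of _ n] by (intro arg_cong[where f="\<lambda>f. rs_int F f h"] ext) (simp add: R_def)
  also have "\<dots> = rs_int F (\<lambda>t. \<Sum>k\<le>n. ?w k * \<zeta> ^ k * circ_exp t ^ k) h + rs_int F (\<lambda>t. 2 * \<zeta> ^ Suc n * R t) h"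
    by (intro rs_int_add[OF F] continuous_on_sum ce cR)
  also have "\<dots> = (\<Sum>k\<le>n. (?w k * \<zeta> ^ k) *\<^sub>C rs_int F (\<lambda>t. circ_exp t ^ k) h) + (2 * \<zeta> ^ Suc n) *\<^sub>C rs_int F R h"
    by (simp only: rs_int_sum[OF F ce(2)] rs_int_mult[OF F ce(1)] rs_int_mult[OF F cR(1)])
  finally have JK: "cinner (rs_int F (herglotz_kernel \<zeta>) h) g = (\<Sum>k\<le>n. ?w k * \<zeta> ^ k * cinner (rs_int F (\<lambda>t. circ_exp t ^ k) h) g)
      + 2 * \<zeta> ^ Suc n * cinner (rs_int F R h) g"
    by (simp only: cinner.add_left cinner.sum_left cinner_scaleC_left)
  have "cmod (cinner (rs_int F R h) g) \<le> 2 / 2 * D"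
    unfolding D_def
  proof (rule rs_int_bound[OF F cR(1)])
    fix t :: real
    have "1 / 2 \<le> cmod (1 - \<zeta> * circ_exp t)" using one_minus_circ_exp_bound(1)[OF \<zeta>1, of t] \<zeta> by linarith
    then have "1 / cmod (1 - \<zeta> * circ_exp t) \<le> 1 / (1 / 2)" by (intro divide_left_mono) auto
    then show "cmod (R t) \<le> 2" by (simp add: R_def norm_divide norm_mult norm_power)
  qed
  then have "cmod (2 * \<zeta> ^ Suc n * cinner (rs_int F R h) g) \<le> 2 * D * cmod \<zeta> ^ Suc n"
    using mult_left_mono[of "cmod (cinner (rs_int F R h) g)" D "2 * cmod \<zeta> ^ Suc n"] by (simp add: norm_mult norm_power mult_ac)
  then show "cmod (cinner (rs_int F (herglotz_kernel \<zeta>) h) g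
      - (\<Sum>k\<le>n. ?w k * \<zeta> ^ k * cinner (rs_int F (\<lambda>t. circ_exp t ^ k) h) g)) \<le> 2 * D * cmod \<zeta> ^ Suc n"
    unfolding JK by simp
qed

text \<open>Serves twice: with c the prescribed moments, and with c the moments of a second
  distribution function with the same transform.\<close>

lemma transform_determines_moments:
  fixes F :: "real \<Rightarrow> 'h \<Rightarrow> 'h::chilbert_space"
  assumes F: "distribution_fun 0 (2 * pi) F"
    and c: "\<And>\<zeta>. 0 < cmod \<zeta> \<Longrightarrow> cmod \<zeta> < 1/2 \<Longrightarrow>
      cmod (cinner (rs_int F (herglotz_kernel \<zeta>) h) g - (\<Sum>k\<le>n. (if k = 0 then 1 else 2) * \<zeta> ^ k * c k)) \<le> C * cmod \<zeta> ^ Suc n"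
    and k: "k \<le> n"
  shows "cinner (rs_int F (\<lambda>t. circ_exp t ^ k) h) g = c k"
proof -
  define J where "J f = cinner (rs_int F f h) g" for f
  let ?w = "\<lambda>k. if k = 0 then 1 else 2 :: complex"
  obtain C' where C': "\<And>\<zeta>. cmod \<zeta> < 1/2 \<Longrightarrow>
      cmod (J (herglotz_kernel \<zeta>) - (\<Sum>k\<le>n. ?w k * \<zeta> ^ k * J (\<lambda>t. circ_exp t ^ k))) \<le> C' * cmod \<zeta> ^ Suc n"
    using transform_expansion[OF F, of h g n] unfolding J_def by blast
  have "cmod (\<Sum>k\<le>n. (?w k * (J (\<lambda>t. circ_exp t ^ k) - c k)) * \<zeta> ^ k) \<le> (C + C') * cmod \<zeta> ^ Suc n"
    if \<zeta>: "0 < cmod \<zeta>" "cmod \<zeta> < 1/2" for \<zeta>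
  proof -
    let ?A = "J (herglotz_kernel \<zeta>) - (\<Sum>k\<le>n. ?w k * \<zeta> ^ k * c k)"
    let ?B = "J (herglotz_kernel \<zeta>) - (\<Sum>k\<le>n. ?w k * \<zeta> ^ k * J (\<lambda>t. circ_exp t ^ k))"
    have "(\<Sum>k\<le>n. (?w k * (J (\<lambda>t. circ_exp t ^ k) - c k)) * \<zeta> ^ k)
        = (\<Sum>k\<le>n. ?w k * \<zeta> ^ k * J (\<lambda>t. circ_exp t ^ k)) - (\<Sum>k\<le>n. ?w k * \<zeta> ^ k * c k)"
      unfolding sum_subtractf[symmetric] by (intro sum.cong) (auto simp: algebra_simps)
    then have eq: "(\<Sum>k\<le>n. (?w k * (J (\<lambda>t. circ_exp t ^ k) - c k)) * \<zeta> ^ k) = ?A - ?B" by simp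
    have "cmod (\<Sum>k\<le>n. (?w k * (J (\<lambda>t. circ_exp t ^ k) - c k)) * \<zeta> ^ k) \<le> cmod ?A + cmod ?B"
      unfolding eq by (rule norm_triangle_ineq4)
    also have "\<dots> \<le> C * cmod \<zeta> ^ Suc n + C' * cmod \<zeta> ^ Suc n"
      using c[OF \<zeta>] C'[OF \<zeta>(2)] by (intro add_mono) (auto simp: J_def)
    finally show ?thesis by (simp add: distrib_right)
  qed
  from poly_coeffs_zero_if_small[of "\<lambda>k. ?w k * (J (\<lambda>t. circ_exp t ^ k) - c k)" n, OF this k]
  show ?thesis by (auto simp: J_def split: if_splits)
qed

section \<open>Moments determine the distribution function\<close>

lemma continuous_circ_exp_powi: "continuous_on A (\<lambda>t. circ_exp t powi n)"
  by (intro continuous_on_power_int continuous_circ_exp) auto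

lemma continuous_on_real_polynomial_circ_exp:
  "real_polynomial_function p \<Longrightarrow> continuous_on A (\<lambda>t. p (circ_exp t))"
  by (rule continuous_on_compose2[of UNIV p A circ_exp])
    (auto intro: continuous_at_imp_continuous_on continuous_real_polymonial_function continuous_circ_exp)

text \<open>The property proved by induction over polynomials is stated as a closure property under
  multiplication, which makes the product case immediate.\<close>

lemma rs_int_agree_polynomial:
  fixes F G :: "real \<Rightarrow> 'h \<Rightarrow> 'h::chilbert_space"
  assumes F: "distribution_fun 0 (2 * pi) F" and G: "distribution_fun 0 (2 * pi) G"
    and p: "real_polynomial_function p"
    and q: "continuous_on {0..2 * pi} q"
    and eq: "\<And>n h. rs_int F (\<lambda>t. q t * circ_exp t powi n) h = rs_int G (\<lambda>t. q t * circ_exp t powi n) h"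
  shows "rs_int F (\<lambda>t. of_real (p (circ_exp t)) * q t * circ_exp t powi n) h
    = rs_int G (\<lambda>t. of_real (p (circ_exp t)) * q t * circ_exp t powi n) h"
  using p q eq
proof (induction p arbitrary: q n h rule: real_polynomial_function.induct)
  case (linear f)
  \<comment> \<open>On the unit circle f(e) = Re e * f(1) + Im e * f(i) = \<alpha> e + \<beta> / e,
    so multiplication by f only shifts the exponent n by one in either direction.\<close>
  define \<alpha> \<beta> where "\<alpha> = (of_real (f 1) - \<i> * of_real (f \<i>)) / 2" and "\<beta> = (of_real (f 1) + \<i> * of_real (f \<i>)) / 2"
  have fe: "of_real (f (circ_exp t)) = \<alpha> * circ_exp t + \<beta> * inverse (circ_exp t)" for t
  proof -
    have "f (circ_exp t) = f (Re (circ_exp t) *\<^sub>R 1 + Im (circ_exp t) *\<^sub>R \<i>)"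
      by (rule arg_cong[where f=f]) (simp add: complex_eq_iff)
    also have "\<dots> = Re (circ_exp t) * f 1 + Im (circ_exp t) * f \<i>"
      using linear(1) by (simp add: linear_simps bounded_linear.linear linear_add linear_scale)
    finally show ?thesis
      by (simp add: \<alpha>_def \<beta>_def circ_exp_reflect(3)[symmetric] complex_eq_iff algebra_simps add_divide_distrib diff_divide_distrib)
  qed
  have "of_real (f (circ_exp t)) * q t * circ_exp t powi n =
      \<alpha> * (q t * circ_exp t powi (n + 1)) + \<beta> * (q t * circ_exp t powi (n - 1))" for t
    unfolding fe by (simp add: power_int_add power_int_diff algebra_simps divide_inverse)
  then have *: "(\<lambda>t. of_real (f (circ_exp t)) * q t * circ_exp t powi n) =
      (\<lambda>t. \<alpha> * (q t * circ_exp t powi (n + 1)) + \<beta> * (q t * circ_exp t powi (n - 1)))" by (rule ext)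
  have c: "continuous_on {0..2 * pi} (\<lambda>t. q t * circ_exp t powi m)" "continuous_on {0..2 * pi} (\<lambda>t. c * (q t * circ_exp t powi m))" for m c
    by (intro continuous_intros linear(2) continuous_circ_exp_powi)+
  show ?case
    unfolding * by (simp only: rs_int_add[OF F c(2) c(2)] rs_int_add[OF G c(2) c(2)] rs_int_mult[OF F c(1)] rs_int_mult[OF G c(1)] linear(3))
next
  case (const c)
  have c: "continuous_on {0..2 * pi} (\<lambda>t. q t * circ_exp t powi m)" for m
    by (intro continuous_intros const(1) continuous_circ_exp_powi)
  show ?case by (simp only: mult.assoc rs_int_mult[OF F c] rs_int_mult[OF G c] const(2))
next
  case (add f g)
  have cont: "continuous_on {0..2 * pi} (\<lambda>t. of_real (p (circ_exp t)) * q t * circ_exp t powi n)"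
    if "real_polynomial_function p" for p
    using add.prems(1) that
    by (intro continuous_intros continuous_circ_exp_powi continuous_on_real_polynomial_circ_exp)
  show ?case
    using add.IH[OF add.prems] rs_int_add[OF F cont[OF add.hyps(1)] cont[OF add.hyps(2)]]
      rs_int_add[OF G cont[OF add.hyps(1)] cont[OF add.hyps(2)]]
    by (simp add: distrib_right)
next
  case (mult f g)
  have cont: "continuous_on {0..2 * pi} (\<lambda>t. of_real (g (circ_exp t)) * q t)"
    using mult.prems(1) mult.hyps(2)
    by (intro continuous_intros continuous_on_real_polynomial_circ_exp)
  show ?case using mult.IH(1)[OF cont mult.IH(2)[OF mult.prems]] by (simp add: mult_ac)
qed

lemma rs_int_powi_neg:
  fixes F :: "real \<Rightarrow> 'h \<Rightarrow> 'h::chilbert_space"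
  assumes F: "distribution_fun 0 (2 * pi) F"
  shows "cinner (rs_int F (\<lambda>t. circ_exp t powi (- n)) h) g = cnj (cinner (rs_int F (\<lambda>t. circ_exp t powi n) g) h)"
proof -
  have "(\<lambda>t. circ_exp t powi (- n)) = (\<lambda>t. cnj (circ_exp t powi n))"
    by (rule ext) (simp add: power_int_def circ_exp_reflect(3) power_inverse)
  then show ?thesis by (simp only: rs_int_cnj[OF F continuous_circ_exp_powi])
qed

text \<open>The strict bound z < 2 pi keeps the first arc from running round to the point 1, where
  the second one begins.\<close>

lemma circ_exp_arcs_disjoint:
  assumes "0 \<le> y" "y < x" "z < 2 * pi"
  shows "circ_exp ` {x..z} \<inter> circ_exp ` {0..y} = {}"
proof -
  have "circ_exp s \<noteq> circ_exp t" if "s \<in> {x..z}" "t \<in> {0..y}" for s t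
  proof
    assume eq: "circ_exp s = circ_exp t"
    have "\<i> * of_real s = \<i> * of_real t"
    proof (rule exp_complex_eqI)
      have "\<bar>s - t\<bar> < 2 * pi" using that assms unfolding atLeastAtMost_iff by linarith
      then show "\<bar>Im (\<i> * of_real s) - Im (\<i> * of_real t)\<bar> < 2 * pi" by simp
      show "exp (\<i> * of_real s) = exp (\<i> * of_real t)" using eq by (simp only: circ_exp_def)
    qed
    then have "s = t" by simp
    then show False using that assms by simp
  qed
  then show ?thesis by blast
qed

text \<open>Conjugation gives the moments of negative order, hence agreement on trigonometric
  polynomials. Real polynomials restricted to the circle are such, and Stone-Weierstrass reaches the
  continuous functions.\<close>

lemma rs_int_agree_circle:
  fixes F G :: "real \<Rightarrow> 'h \<Rightarrow> 'h::chilbert_space"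
  assumes F: "distribution_fun 0 (2 * pi) F" and G: "distribution_fun 0 (2 * pi) G"
    and moments: "\<And>n::nat. rs_int F (\<lambda>t. circ_exp t ^ n) = rs_int G (\<lambda>t. circ_exp t ^ n)"
    and \<phi>: "continuous_on UNIV (\<phi> :: complex \<Rightarrow> real)"
  shows "rs_int F (\<lambda>t. of_real (\<phi> (circ_exp t))) h = rs_int G (\<lambda>t. of_real (\<phi> (circ_exp t))) h"
proof -
  have powi: "rs_int F (\<lambda>t. 1 * circ_exp t powi n) h = rs_int G (\<lambda>t. 1 * circ_exp t powi n) h" for n h
  proof (cases "0 \<le> n")
    case True
    then have "circ_exp t powi n = circ_exp t ^ nat n" for t by (simp add: power_int_def)
    then show ?thesis using moments[of "nat n"] by simp
  next
    case False
    define m where "m = nat (- n)"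
    have n: "n = - int m" using False by (simp add: m_def)
    show ?thesis
    proof (rule cinner_ext_left)
      fix g
      have "cinner (rs_int F (\<lambda>t. circ_exp t powi (- int m)) h) g = cinner (rs_int G (\<lambda>t. circ_exp t powi (- int m)) h) g"
        using moments[of m] by (simp only: rs_int_powi_neg[OF F] rs_int_powi_neg[OF G] power_int_of_nat)
      then show "cinner (rs_int F (\<lambda>t. 1 * circ_exp t powi n) h) g = cinner (rs_int G (\<lambda>t. 1 * circ_exp t powi n) h) g"
        by (simp add: n)
    qed
  qed
  have poly: "rs_int F (\<lambda>t. of_real (p (circ_exp t))) h = rs_int G (\<lambda>t. of_real (p (circ_exp t))) h"
    if "real_polynomial_function p" for p
    using rs_int_agree_polynomial[OF F G that continuous_on_const powi, of 0 h] by simp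
  show ?thesis
  proof (rule cinner_ext_left)
    fix g
    let ?f = "\<lambda>t. of_real (\<phi> (circ_exp t)) :: complex"
    let ?D = "\<lambda>F. Re (cinner (F (2 * pi) h) h) + Re (cinner (F (2 * pi) g) g)"
    have cf: "continuous_on {0..2 * pi} ?f"
      by (intro continuous_intros continuous_on_compose2[OF \<phi> continuous_circ_exp]) auto
    have "cmod (cinner (rs_int F ?f h) g - cinner (rs_int G ?f h) g) \<le> 0 + e" if e: "0 < e" for e
    proof -
      define \<eta> where "\<eta> = e / (?D F + ?D G + 1)"
      have D: "0 \<le> ?D F" "0 \<le> ?D G"
        using rs_int_form_nonneg[OF F] rs_int_form_nonneg[OF G] by (auto intro: add_nonneg_nonneg)
      then have \<eta>: "0 < \<eta>" using e by (simp add: \<eta>_def add_nonneg_pos)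
      obtain p where p: "real_polynomial_function p" "\<And>z. z \<in> sphere 0 1 \<Longrightarrow> \<bar>\<phi> z - p z\<bar> < \<eta>"
        using Stone_Weierstrass_real_polynomial_function[of "sphere 0 1" \<phi> \<eta>] continuous_on_subset[OF \<phi>] \<eta> by auto
      let ?p = "\<lambda>t. of_real (p (circ_exp t)) :: complex"
      have cp: "continuous_on {0..2 * pi} ?p"
        by (intro continuous_intros continuous_on_real_polynomial_circ_exp p)
      have cd: "continuous_on {0..2 * pi} (\<lambda>t. ?f t - ?p t)" by (intro continuous_intros cf cp)
      have b: "cmod (?f t - ?p t) \<le> \<eta>" for t
        using p(2)[of "circ_exp t"] by (simp flip: of_real_diff)
      have "cinner (rs_int F ?f h) g - cinner (rs_int G ?f h) g =
        cinner (rs_int F (\<lambda>t. ?f t - ?p t) h) g - cinner (rs_int G (\<lambda>t. ?f t - ?p t) h) g"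
        by (simp add: rs_int_diff[OF F cf cp] rs_int_diff[OF G cf cp] cinner.diff_left poly[OF p(1)])
      then have "cmod (cinner (rs_int F ?f h) g - cinner (rs_int G ?f h) g) \<le>
        cmod (cinner (rs_int F (\<lambda>t. ?f t - ?p t) h) g) + cmod (cinner (rs_int G (\<lambda>t. ?f t - ?p t) h) g)"
        by (simp only: norm_triangle_ineq4)
      also have "\<dots> \<le> \<eta> / 2 * ?D F + \<eta> / 2 * ?D G"
        by (intro add_mono rs_int_bound[OF F cd b] rs_int_bound[OF G cd b])
      also have "\<dots> = \<eta> * ((?D F + ?D G) / 2)" by (simp add: algebra_simps)
      also have "\<dots> \<le> \<eta> * (?D F + ?D G + 1)" 
      proof (rule mult_left_mono)
        have "(A + B) / 2 \<le> A + B + 1" if "0 \<le> A" "0 \<le> B" for A B :: real using that by simp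
        from this[OF D] show "(?D F + ?D G) / 2 \<le> ?D F + ?D G + 1" .
      qed (use \<eta> in simp)
      also have "\<dots> = e" using D by (simp add: \<eta>_def add_nonneg_pos)
      finally show ?thesis by simp
    qed
    then have "cmod (cinner (rs_int F ?f h) g - cinner (rs_int G ?f h) g) \<le> 0" by (rule field_le_epsilon)
    then show "cinner (rs_int F ?f h) g = cinner (rs_int G ?f h) g" by simp
  qed
qed

text \<open>F x is recovered from Urysohn functions equal to 1 on the arc {0..y} and 0 on {x..z}:
  left-continuity at x and at 2 pi makes the uncontrolled gaps {y..x} and {z..2 * pi} carry little
  mass. At 2 pi the zeroth moment suffices.\<close>

theorem distribution_fun_eqI:
  fixes F G :: "real \<Rightarrow> 'h \<Rightarrow> 'h::chilbert_space"
  assumes F: "distribution_fun 0 (2 * pi) F" and G: "distribution_fun 0 (2 * pi) G"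
    and transform: "\<And>\<zeta>. cmod \<zeta> < 1 \<Longrightarrow> rs_int F (herglotz_kernel \<zeta>) = rs_int G (herglotz_kernel \<zeta>)"
  shows "F = G"
proof -
  have moments: "rs_int F (\<lambda>t. circ_exp t ^ n) = rs_int G (\<lambda>t. circ_exp t ^ n)" for n :: nat
  proof
    fix h show "rs_int F (\<lambda>t. circ_exp t ^ n) h = rs_int G (\<lambda>t. circ_exp t ^ n) h"
    proof (rule cinner_ext_left)
      fix g
      obtain C where C: "\<And>\<zeta>. 0 < cmod \<zeta> \<Longrightarrow> cmod \<zeta> < 1/2 \<Longrightarrow> cmod (cinner (rs_int G (herglotz_kernel \<zeta>) h) g
        - (\<Sum>k\<le>n. (if k = 0 then 1 else 2) * \<zeta> ^ k * cinner (rs_int G (\<lambda>t. circ_exp t ^ k) h) g)) \<le> C * cmod \<zeta> ^ Suc n"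
        using transform_expansion[OF G, of h g n] by blast
      show "cinner (rs_int F (\<lambda>t. circ_exp t ^ n) h) g = cinner (rs_int G (\<lambda>t. circ_exp t ^ n) h) g"
        by (rule transform_determines_moments[OF F, where n=n and C=C]) (use C transform in auto)
    qed
  qed
  have top: "F (2 * pi) = G (2 * pi)"
    using moments[of 0] rs_int_const[OF F, of 1] rs_int_const[OF G, of 1] by (simp add: fun_eq_iff)
  have mid: "F x h = G x h" if x: "0 < x" "x < 2 * pi" for x h
  proof (rule cinner_ext_left)
    fix g
    let ?D = "\<lambda>F u v. (Re (cinner (F v h) h - cinner (F u h) h) + Re (cinner (F v g) g - cinner (F u g) g))"
    have lim: "((\<lambda>u. ?D F u v) \<longlongrightarrow> ?D F v v) (at_left v)" if "distribution_fun 0 (2 * pi) F" "0 < v" "v \<le> 2 * pi" for F :: "real \<Rightarrow> 'h \<Rightarrow> 'h" and v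
      by (intro tendsto_intros cinner.tendsto distribution_left[OF that(1)] that tendsto_const)
    have small: "\<forall>\<^sub>F u in at_left v. ?D F u v < e"
      if "distribution_fun 0 (2 * pi) F" "0 < v" "v \<le> 2 * pi" "0 < e" for F :: "real \<Rightarrow> 'h \<Rightarrow> 'h" and v e
      using order_tendstoD(2)[OF lim[OF that(1-3)], of e] that(4) by simp
    have "cmod (cinner (F x h) g - cinner (G x h) g) \<le> 0 + e" if e: "0 < e" for e
    proof -
      \<comment> \<open>Two gaps for each of F and G: four errors of size e / 4.\<close>
      have e4: "0 < e / 4" and pi2: "0 < 2 * pi" using e by simp_all
      have "\<forall>\<^sub>F y in at_left x. 0 < y \<and> y < x"
        using x(1) by (auto simp: eventually_at_left[OF x(1)])
      then have "\<forall>\<^sub>F y in at_left x. (0 < y \<and> y < x) \<and> ?D F y x < e / 4 \<and> ?D G y x < e / 4"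
        by (rule eventually_conj[OF _ eventually_conj[OF small[OF F x(1) less_imp_le[OF x(2)] e4] small[OF G x(1) less_imp_le[OF x(2)] e4]]])
      then obtain y where y: "0 < y" "y < x" "?D F y x < e / 4" "?D G y x < e / 4"
        using eventually_happens'[OF trivial_limit_at_left_real] by blast
      have "\<forall>\<^sub>F z in at_left (2 * pi). x < z \<and> z < 2 * pi"
        using x(2) by (auto simp: eventually_at_left[OF x(2)])
      then have "\<forall>\<^sub>F z in at_left (2 * pi). (x < z \<and> z < 2 * pi) \<and> ?D F z (2 * pi) < e / 4 \<and> ?D G z (2 * pi) < e / 4"
        by (rule eventually_conj[OF _ eventually_conj[OF small[OF F pi2 order_refl e4] small[OF G pi2 order_refl e4]]])
      then obtain z where z: "x < z" "z < 2 * pi" "?D F z (2 * pi) < e / 4" "?D G z (2 * pi) < e / 4"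
        using eventually_happens'[OF trivial_limit_at_left_real] by blast
      have closed: "closed (circ_exp ` A)" if "compact A" for A
        by (rule compact_imp_closed[OF compact_continuous_image[OF continuous_circ_exp that]])
      obtain \<phi> :: "complex \<Rightarrow> real" where \<phi>: "continuous_on UNIV \<phi>" "\<And>w. \<phi> w \<in> closed_segment 0 1"
        "\<And>w. w \<in> circ_exp ` {x..z} \<Longrightarrow> \<phi> w = 0" "\<And>w. w \<in> circ_exp ` {0..y} \<Longrightarrow> \<phi> w = 1"
        using Urysohn[OF closed[OF compact_Icc] closed[OF compact_Icc] circ_exp_arcs_disjoint, of y x z 0 "1::real"] y z
        by (metis less_imp_le)
      let ?f = "\<lambda>t. of_real (\<phi> (circ_exp t)) :: complex"
      have cf: "continuous_on {0..2 * pi} ?f"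
        by (intro continuous_intros continuous_on_compose2[OF \<phi>(1) continuous_circ_exp]) auto
      have b: "cmod (?f t) \<le> 1" for t using \<phi>(2)[of "circ_exp t"] by (simp add: closed_segment_eq_real_ivl)
      have approx: "cmod (cinner (rs_int F ?f h) g - cinner (F x h) g) \<le> ?D F y x + ?D F z (2 * pi)"
        if "distribution_fun 0 (2 * pi) F" for F :: "real \<Rightarrow> 'h \<Rightarrow> 'h"
        by (rule rs_int_step_approx[OF that cf b]) (use x y z \<phi> in auto)
      have "cmod (cinner (F x h) g - cinner (G x h) g) \<le>
          cmod (cinner (rs_int F ?f h) g - cinner (F x h) g) + cmod (cinner (rs_int G ?f h) g - cinner (G x h) g)"
        using norm_triangle_ineq4[of "cinner (rs_int G ?f h) g - cinner (G x h) g" "cinner (rs_int F ?f h) g - cinner (F x h) g"]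
        by (simp add: rs_int_agree_circle[OF F G moments \<phi>(1)])
      then show ?thesis using approx[OF F] approx[OF G] y z by linarith
    qed
    then have "cmod (cinner (F x h) g - cinner (G x h) g) \<le> 0" by (rule field_le_epsilon)
    then show "cinner (F x h) g = cinner (G x h) g" by simp
  qed
  show ?thesis
  proof (rule extensionalityI)
    show "F \<in> extensional {0..2 * pi}" "G \<in> extensional {0..2 * pi}" using F G by (auto simp: distribution_fun_def)
    fix x assume "x \<in> {0..2 * pi}"
    then consider "x = 0" | "0 < x" "x < 2 * pi" | "x = 2 * pi" by fastforce
    then show "F x = G x"
      by cases (auto simp: distribution_zero[OF F] distribution_zero[OF G] mid top)
  qed
qed

section \<open>Resolvents of contractions\<close>

text \<open>The map x |-> y + z T x is a strict contraction of V. A general closed subspace is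
  allowed because the result is applied on the whole space and also on D(A), to the compression of
  A.\<close>

lemma contraction_resolvent:
  fixes V :: "'a::chilbert_space set"
  assumes V: "csubspace V" "closed V" and T: "\<And>x. x \<in> V \<Longrightarrow> T x \<in> V"
    "\<And>x y. x \<in> V \<Longrightarrow> y \<in> V \<Longrightarrow> T (x - y) = T x - T y" "\<And>x. x \<in> V \<Longrightarrow> norm (T x) \<le> norm x"
    and z: "cmod z < 1" and y: "y \<in> V"
  shows "\<exists>!x. x \<in> V \<and> x - z *\<^sub>C T x = y"
proof -
  have "\<exists>!x\<in>V. y + z *\<^sub>C T x = x"
  proof (rule Banach_fix[where c="cmod z"])
    show "complete V" using V(2) by (simp add: complete_eq_closed)
    show "V \<noteq> {}" using y by auto
    show "(\<lambda>x. y + z *\<^sub>C T x) ` V \<subseteq> V" using V(1) T(1) y by (auto intro: csubspace_add csubspace_scaleC)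
    show "dist (y + z *\<^sub>C T a) (y + z *\<^sub>C T b) \<le> cmod z * dist a b" if "a \<in> V" "b \<in> V" for a b
    proof -
      have "dist (y + z *\<^sub>C T a) (y + z *\<^sub>C T b) = norm (z *\<^sub>C T (a - b))"
        using that by (simp add: dist_norm T(2) scaleC.diff_right)
      also have "\<dots> \<le> cmod z * norm (a - b)"
        using T(3)[OF csubspace_diff[OF V(1) that]] by (simp add: mult_left_mono)
      finally show ?thesis by (simp add: dist_norm)
    qed
  qed (use z in auto)
  moreover have "y + z *\<^sub>C T x = x \<longleftrightarrow> x - z *\<^sub>C T x = y" for x by (auto simp: algebra_simps)
  ultimately show ?thesis by simp
qed

definition contraction :: "('a::complex_inner \<Rightarrow> 'a) \<Rightarrow> bool"
  where "contraction T \<longleftrightarrow> bounded_clinear T \<and> (\<forall>x. norm (T x) \<le> norm x)"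

definition resolvent :: "('a::chilbert_space \<Rightarrow> 'a) \<Rightarrow> complex \<Rightarrow> 'a \<Rightarrow> 'a"
  where "resolvent T z y = (THE x. x - z *\<^sub>C T x = y)"

lemma contractionI:
  assumes "\<And>x y. T (x + y) = T x + T y" "\<And>c x. T (c *\<^sub>C x) = c *\<^sub>C T x" "\<And>x. norm (T x) \<le> norm x"
  shows "contraction T"
  using bounded_clinearI[of T 1] assms by (simp add: contraction_def)

context
  fixes T :: "'a::chilbert_space \<Rightarrow> 'a" and z :: complex
  assumes T: "contraction T" and z: "cmod z < 1"
begin

lemma resolvent_ex1: "\<exists>!x. x - z *\<^sub>C T x = y"
  using contraction_resolvent[OF csubspace_UNIV closed_UNIV, of T z y] T z
  by (simp add: contraction_def bounded_clinear_diff)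

lemma resolvent_eq: "resolvent T z y - z *\<^sub>C T (resolvent T z y) = y"
  unfolding resolvent_def by (rule theI'[OF resolvent_ex1])

lemma resolvent_eqI: "x - z *\<^sub>C T x = y \<Longrightarrow> resolvent T z y = x"
  unfolding resolvent_def by (rule the1_equality[OF resolvent_ex1])

lemma resolvent_rec: "resolvent T z y = y + z *\<^sub>C T (resolvent T z y)"
  using resolvent_eq[of y] by (simp add: algebra_simps)

lemma resolvent_add: "resolvent T z (x + y) = resolvent T z x + resolvent T z y"
proof (rule resolvent_eqI)
  have "T (resolvent T z x + resolvent T z y) = T (resolvent T z x) + T (resolvent T z y)"
    using T by (simp add: contraction_def bounded_clinear_add)
  then show "resolvent T z x + resolvent T z y - z *\<^sub>C T (resolvent T z x + resolvent T z y) = x + y"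
    using arg_cong2[OF resolvent_eq[of x] resolvent_eq[of y], of "(+)"] by (simp add: scaleC_add_right add_diff_add)
qed

lemma resolvent_scaleC: "resolvent T z (c *\<^sub>C x) = c *\<^sub>C resolvent T z x"
proof (rule resolvent_eqI)
  have "T (c *\<^sub>C resolvent T z x) = c *\<^sub>C T (resolvent T z x)"
    using T by (simp add: contraction_def bounded_clinear_scaleC)
  then have "c *\<^sub>C resolvent T z x - z *\<^sub>C T (c *\<^sub>C resolvent T z x) = c *\<^sub>C (resolvent T z x - z *\<^sub>C T (resolvent T z x))"
    by (simp add: scaleC.diff_right scaleC_scaleC mult.commute)
  then show "c *\<^sub>C resolvent T z x - z *\<^sub>C T (c *\<^sub>C resolvent T z x) = c *\<^sub>C x" by (simp add: resolvent_eq)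
qed

lemma norm_resolvent: "norm (resolvent T z y) \<le> norm y / (1 - cmod z)"
proof -
  have "norm (resolvent T z y) \<le> norm y + norm (z *\<^sub>C T (resolvent T z y))"
    using norm_triangle_ineq[of y "z *\<^sub>C T (resolvent T z y)"] by (simp add: resolvent_rec[symmetric])
  also have "norm (z *\<^sub>C T (resolvent T z y)) \<le> cmod z * norm (resolvent T z y)"
    using T by (simp add: contraction_def mult_left_mono)
  finally have "norm (resolvent T z y) * (1 - cmod z) \<le> norm y" by (simp add: algebra_simps)
  then show ?thesis using z by (simp add: pos_le_divide_eq)
qed

lemma bounded_clinear_resolvent: "bounded_clinear (resolvent T z)"
  by (rule bounded_clinearI[of _ "1 / (1 - cmod z)"])
    (use norm_resolvent in \<open>auto simp: resolvent_add resolvent_scaleC\<close>)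

text \<open>For x = \<open>resolvent T z y\<close> the vector x - y = z T x is no longer than x, and
  |x - y|^2 <= |x|^2 expands to the claim. This is the positivity required by the Herglotz
  theorem.\<close>

lemma Re_resolvent_nonneg: "0 \<le> 2 * Re (cinner (resolvent T z y) y) - (norm y)\<^sup>2"
proof -
  let ?x = "resolvent T z y"
  have y: "y = ?x - z *\<^sub>C T ?x" by (simp add: resolvent_eq)
  have "norm (z *\<^sub>C T ?x) \<le> 1 * norm ?x"
    using T z unfolding norm_scaleC by (intro mult_mono) (auto simp: contraction_def)
  then have "(norm (z *\<^sub>C T ?x))\<^sup>2 \<le> (norm ?x)\<^sup>2" by (simp only: mult_1 power_mono norm_ge_zero)
  moreover have "(norm (?x - y))\<^sup>2 = (norm ?x)\<^sup>2 - 2 * Re (cinner ?x y) + (norm y)\<^sup>2" by (rule norm_diff_cinner)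
  moreover have "?x - y = z *\<^sub>C T ?x" using y by (simp add: algebra_simps)
  then have "(norm (?x - y))\<^sup>2 = (norm (z *\<^sub>C T ?x))\<^sup>2" by (rule arg_cong)
  ultimately show ?thesis by linarith
qed

end

section \<open>The moment space\<close>

locale moment_space =
  fixes d :: nat and S :: "nat \<Rightarrow> 'h::chilbert_space \<Rightarrow> 'h" and cls :: "(nat \<Rightarrow> 'h) \<Rightarrow> 'k::chilbert_space"
  assumes d: "1 \<le> d" and S: "\<And>n. n \<le> d \<Longrightarrow> bounded_clinear (S n)"
    and ms: "is_moment_space d S cls"
begin

abbreviation "D \<equiv> domA d cls"
abbreviation "R \<equiv> ranA d cls"
abbreviation "A \<equiv> opA d cls"
abbreviation "P \<equiv> oproj D"
abbreviation "x_gen \<equiv> gen cls"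

lemma cls_add: "h \<in> formal_sums d \<Longrightarrow> g \<in> formal_sums d \<Longrightarrow> cls (\<lambda>j. h j + g j) = cls h + cls g"
  and cls_scaleC: "h \<in> formal_sums d \<Longrightarrow> cls (\<lambda>j. c *\<^sub>C h j) = c *\<^sub>C cls h"
  and cls_cinner: "h \<in> formal_sums d \<Longrightarrow> g \<in> formal_sums d \<Longrightarrow> cinner (cls h) (cls g) = moment_form d S h g"
  and cls_dense: "closure (cls ` formal_sums d) = UNIV"
  using ms by (auto simp: is_moment_space_def)

lemma single_formal: "j \<le> d \<Longrightarrow> (\<lambda>i. if i = j then h else 0) \<in> formal_sums d"
  by (simp add: formal_sums_def)

lemma gen_add: "j \<le> d \<Longrightarrow> x_gen (h + g) j = x_gen h j + x_gen g j"
  unfolding gen_def by (subst cls_add[symmetric]) (auto simp: single_formal intro!: arg_cong[where f=cls])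

lemma gen_scaleC: "j \<le> d \<Longrightarrow> x_gen (c *\<^sub>C h) j = c *\<^sub>C x_gen h j"
  unfolding gen_def by (subst cls_scaleC[symmetric]) (auto simp: single_formal scaleC.zero_right intro!: arg_cong[where f=cls])

lemma gen_cinner:
  assumes "j \<le> d" "k \<le> d"
  shows "cinner (x_gen h j) (x_gen g k) = cinner (moment_op S (int j - int k) h) g"
proof -
  have m0: "moment_op S (int a - int b) 0 = 0" if "a \<le> d" "b \<le> d" for a b
  proof (cases "b \<le> a")
    case True
    then show ?thesis using bounded_clinear_0[OF S[of "a - b"]] that by (simp add: moment_op_def nat_diff_distrib)
  next
    case False
    have "cinner x (cadjoint (S (b - a)) 0) = cinner x 0" for x
      using cadjoint_cinner[OF S[of "b - a"], of x 0] that by (simp add: cinner.zero_right)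
    then have "cadjoint (S (b - a)) 0 = 0" by (metis cinner_ext_left cinner_commute)
    then show ?thesis using False by (simp add: moment_op_def nat_diff_distrib)
  qed
  have "cinner (x_gen h j) (x_gen g k) = (\<Sum>a\<le>d. \<Sum>b\<le>d. cinner (moment_op S (int a - int b) (if a = j then h else 0)) (if b = k then g else 0))"
    unfolding gen_def by (simp add: cls_cinner single_formal assms moment_form_def)
  also have "\<dots> = (\<Sum>a\<le>d. if a = j then \<Sum>b\<le>d. if b = k then cinner (moment_op S (int a - int b) h) g else 0 else 0)"
  proof (intro sum.cong refl)
    fix a assume a: "a \<in> {..d}"
    show "(\<Sum>b\<le>d. cinner (moment_op S (int a - int b) (if a = j then h else 0)) (if b = k then g else 0)) =
        (if a = j then \<Sum>b\<le>d. if b = k then cinner (moment_op S (int a - int b) h) g else 0 else 0)"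
    proof (cases "a = j")
      case True
      show ?thesis unfolding if_P[OF True]
        by (rule sum.cong) (simp_all add: cinner.zero_right)
    next
      case False
      then show ?thesis using a by (auto intro!: sum.neutral simp: m0 cinner.zero_left)
    qed
  qed
  also have "\<dots> = cinner (moment_op S (int j - int k) h) g" using assms by simp
  finally show ?thesis .
qed

definition pre_graph :: "('k \<times> 'k) set"
  where "pre_graph = {(\<Sum>j<d. x_gen (h j) j, \<Sum>j<d. x_gen (h j) (Suc j)) | h. True}"

lemma shift_graph_closure: "shift_graph d cls = closure pre_graph"
  by (simp add: shift_graph_def pre_graph_def)

lemma pre_graph_subset: "pre_graph \<subseteq> shift_graph d cls"
  unfolding shift_graph_closure by (rule closure_subset)

lemma pre_graph_add: assumes "p \<in> pre_graph" "q \<in> pre_graph" shows "p + q \<in> pre_graph"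
proof -
  obtain h g where "p = (\<Sum>j<d. x_gen (h j) j, \<Sum>j<d. x_gen (h j) (Suc j))"
    "q = (\<Sum>j<d. x_gen (g j) j, \<Sum>j<d. x_gen (g j) (Suc j))" using assms by (auto simp: pre_graph_def)
  then have "p + q = (\<Sum>j<d. x_gen (h j + g j) j, \<Sum>j<d. x_gen (h j + g j) (Suc j))"
    by (simp add: gen_add sum.distrib)
  then show ?thesis unfolding pre_graph_def by (auto intro!: exI[of _ "\<lambda>j. h j + g j"])
qed

lemma graph_add: assumes "p \<in> shift_graph d cls" "q \<in> shift_graph d cls" shows "p + q \<in> shift_graph d cls"
proof -
  \<comment> \<open>Passage to the closure in one argument only; two applications, with the roles
    exchanged by commutativity, cover both.\<close>
  have step: "p + q \<in> shift_graph d cls"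
    if "\<forall>q\<in>pre_graph. p + q \<in> shift_graph d cls" "q \<in> shift_graph d cls" for p q
  proof -
    have "(\<lambda>q. p + q) ` closure pre_graph \<subseteq> shift_graph d cls"
      using that by (intro image_closure_subset continuous_intros) (auto simp: shift_graph_closure)
    then show ?thesis using that(2) by (auto simp: shift_graph_closure)
  qed
  have "\<forall>q\<in>pre_graph. p + q \<in> shift_graph d cls"
  proof
    fix q assume q: "q \<in> pre_graph"
    have "q + p \<in> shift_graph d cls"
      by (rule step[OF _ assms(1)]) (use q pre_graph_add pre_graph_subset in blast)
    then show "p + q \<in> shift_graph d cls" by (simp add: add.commute)
  qed
  then show ?thesis by (rule step) (rule assms(2))
qed

lemma graph_scaleC: assumes "(x, y) \<in> shift_graph d cls" shows "(c *\<^sub>C x, c *\<^sub>C y) \<in> shift_graph d cls"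
proof -
  let ?f = "\<lambda>p::'k \<times> 'k. (c *\<^sub>C fst p, c *\<^sub>C snd p)"
  have "?f p \<in> pre_graph" if p: "p \<in> pre_graph" for p
  proof -
    obtain h where "p = (\<Sum>j<d. x_gen (h j) j, \<Sum>j<d. x_gen (h j) (Suc j))" using p by (auto simp: pre_graph_def)
    then have "?f p = (\<Sum>j<d. x_gen (c *\<^sub>C h j) j, \<Sum>j<d. x_gen (c *\<^sub>C h j) (Suc j))"
      by (simp add: gen_scaleC scaleC.sum_right)
    then show ?thesis unfolding pre_graph_def by (auto intro!: exI[of _ "\<lambda>j. c *\<^sub>C h j"])
  qed
  then have "?f ` closure pre_graph \<subseteq> shift_graph d cls"
    using pre_graph_subset
    by (intro image_closure_subset continuous_intros scaleC.continuous_on) (auto simp: shift_graph_closure)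
  then show ?thesis using assms by (auto simp: shift_graph_closure image_subset_iff)
qed

text \<open>The scalar product of generators depends only on j - k, so raising both indices by one
  preserves it; this is the isometry of A.\<close>

lemma pre_graph_cinner:
  assumes "p \<in> pre_graph" "q \<in> pre_graph" shows "cinner (snd p) (snd q) = cinner (fst p) (fst q)"
proof -
  obtain h g where "p = (\<Sum>j<d. x_gen (h j) j, \<Sum>j<d. x_gen (h j) (Suc j))"
    "q = (\<Sum>j<d. x_gen (g j) j, \<Sum>j<d. x_gen (g j) (Suc j))" using assms by (auto simp: pre_graph_def)
  then show ?thesis
    by (simp add: cinner.sum_left cinner.sum_right gen_cinner)
qed

lemma graph_cinner:
  assumes "p \<in> shift_graph d cls" "q \<in> shift_graph d cls" shows "cinner (snd p) (snd q) = cinner (fst p) (fst q)"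
proof -
  have closed: "closed {q::'k \<times> 'k. cinner (snd p) (snd q) = cinner (fst p) (fst q)}" for p :: "'k \<times> 'k"
    by (intro closed_Collect_eq continuous_intros cinner.continuous_on)
  have step: "cinner (snd p) (snd q) = cinner (fst p) (fst q)"
    if "\<forall>q\<in>pre_graph. cinner (snd p) (snd q) = cinner (fst p) (fst q)" "q \<in> shift_graph d cls" for p q
    using closure_minimal[OF _ closed[of p], of pre_graph] that by (auto simp: shift_graph_closure)
  have "\<forall>q\<in>pre_graph. cinner (snd p) (snd q) = cinner (fst p) (fst q)"
  proof
    fix q assume q: "q \<in> pre_graph"
    have "cinner (snd q) (snd p) = cinner (fst q) (fst p)"
      by (rule step[OF _ assms(1)]) (use q pre_graph_cinner in blast)
    then show "cinner (snd p) (snd q) = cinner (fst p) (fst q)" by (metis cinner_commute)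
  qed
  then show ?thesis by (rule step) (rule assms(2))
qed

lemma graph_norm: assumes "(x, y) \<in> shift_graph d cls" shows "norm y = norm x"
proof -
  have "(complex_of_real (norm y))\<^sup>2 = (complex_of_real (norm x))\<^sup>2"
    using graph_cinner[OF assms assms] by (simp add: cinner_self)
  then have "(norm y)\<^sup>2 = (norm x)\<^sup>2" by (metis of_real_eq_iff of_real_power)
  then show ?thesis by (simp add: power2_eq_iff_nonneg)
qed

lemma graph_diff: "(x, y) \<in> shift_graph d cls \<Longrightarrow> (x', y') \<in> shift_graph d cls \<Longrightarrow> (x - x', y - y') \<in> shift_graph d cls"
  using graph_add[of "(x, y)" "(- x', - y')"] graph_scaleC[of x' y' "-1"] by (simp add: scaleC_minus_one)

lemma graph_zero: "(0, 0) \<in> shift_graph d cls"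
proof -
  have "(\<Sum>j<d. x_gen 0 j, \<Sum>j<d. x_gen 0 (Suc j)) \<in> shift_graph d cls"
    using pre_graph_subset by (auto simp: pre_graph_def)
  from graph_scaleC[OF this, of 0] show ?thesis by (simp add: scaleC.zero_left)
qed

text \<open>Two images of x differ by an image of 0, which the isometry forces to be 0; so the
  closure of the graph is again a graph.\<close>

lemma graph_unique: "(x, y) \<in> shift_graph d cls \<Longrightarrow> (x, y') \<in> shift_graph d cls \<Longrightarrow> y = y'"
  using graph_norm[OF graph_diff, of x y x y'] by simp

lemma A_eqI: "(x, y) \<in> shift_graph d cls \<Longrightarrow> A x = y"
  unfolding opA_def using graph_unique by blast

lemma A_graph: "x \<in> D \<Longrightarrow> (x, A x) \<in> shift_graph d cls"
  unfolding domA_def using A_eqI by fastforce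

lemma A_in_R: "x \<in> D \<Longrightarrow> A x \<in> R"
  using A_graph unfolding ranA_def by force

lemma R_obtains: assumes "y \<in> R" obtains x where "x \<in> D" "y = A x"
  using assms A_eqI unfolding ranA_def domA_def by force

lemma csubspace_D: "csubspace D"
proof -
  have "x + y \<in> D" if "x \<in> D" "y \<in> D" for x y
    using graph_add[OF A_graph[OF that(1)] A_graph[OF that(2)]] unfolding domA_def by force
  moreover have "c *\<^sub>C x \<in> D" if "x \<in> D" for c x
    using graph_scaleC[OF A_graph[OF that]] unfolding domA_def by force
  moreover have "0 \<in> D" using graph_zero unfolding domA_def by force
  ultimately show ?thesis by (simp add: csubspace_def)
qed

lemma A_add: "x \<in> D \<Longrightarrow> y \<in> D \<Longrightarrow> A (x + y) = A x + A y"
  using graph_add[OF A_graph A_graph] by (intro A_eqI) simp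

lemma A_diff: "x \<in> D \<Longrightarrow> y \<in> D \<Longrightarrow> A (x - y) = A x - A y"
  by (intro A_eqI graph_diff A_graph)

lemma A_scaleC: "x \<in> D \<Longrightarrow> A (c *\<^sub>C x) = c *\<^sub>C A x"
  by (intro A_eqI graph_scaleC A_graph)

lemma norm_A: "x \<in> D \<Longrightarrow> norm (A x) = norm x"
  by (intro graph_norm A_graph)

lemma A_cinner: "x \<in> D \<Longrightarrow> y \<in> D \<Longrightarrow> cinner (A x) (A y) = cinner x y"
  using graph_cinner[OF A_graph A_graph] by simp

text \<open>For an isometry, convergence in the domain makes the images Cauchy, and the closed graph
  contains the limit pair.\<close>

lemma closed_D: "closed D"
  unfolding closed_sequential_limits
proof (intro allI impI, elim conjE)
  fix X l assume X: "\<forall>n. X n \<in> D" "X \<longlonglongrightarrow> l"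
  have "Cauchy (\<lambda>n. A (X n))"
    using LIMSEQ_imp_Cauchy[OF X(2)] X(1)
    by (simp add: Cauchy_def dist_norm A_diff[symmetric] norm_A csubspace_diff[OF csubspace_D])
  then obtain y where y: "(\<lambda>n. A (X n)) \<longlonglongrightarrow> y" by (auto simp: Cauchy_convergent_iff convergent_def)
  have "(l, y) \<in> shift_graph d cls"
    by (rule closed_sequentially[OF _ _ tendsto_Pair[OF X(2) y]]) (use X(1) A_graph in \<open>auto simp: shift_graph_closure\<close>)
  then show "l \<in> D" unfolding domA_def by force
qed

lemmas D_sub = csubspace_D closed_D

lemma gen_in_D: assumes "j < d" shows "x_gen h j \<in> D" "A (x_gen h j) = x_gen h (Suc j)"
proof -
  have z: "x_gen 0 i = 0" if "i \<le> d" for i using gen_add[OF that, of 0 0] by simp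
  have "(\<Sum>i<d. x_gen (if i = j then h else 0) (k i)) = x_gen h (k j)" if "\<And>i. i < d \<Longrightarrow> k i \<le> d" for k
  proof -
    have "(\<Sum>i<d. x_gen (if i = j then h else 0) (k i)) = (\<Sum>i<d. if i = j then x_gen h (k i) else 0)"
      using z that by (intro sum.cong) auto
    then show ?thesis using assms by simp
  qed
  from this[of "\<lambda>i. i"] this[of Suc] have "(x_gen h j, x_gen h (Suc j)) \<in> pre_graph"
    unfolding pre_graph_def by (auto intro!: exI[of _ "\<lambda>i. if i = j then h else 0"])
  then have "(x_gen h j, x_gen h (Suc j)) \<in> shift_graph d cls" using pre_graph_subset by blast
  then show "x_gen h j \<in> D" "A (x_gen h j) = x_gen h (Suc j)"
    using A_eqI unfolding domA_def by force+
qed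

lemma opI_in_D: "opI cls h \<in> D"
  using gen_in_D(1)[of 0 h] d by (simp add: opI_def)

lemma opI_cinner: "cinner (opI cls h) (opI cls g) = cinner (S 0 h) g"
  using gen_cinner[of 0 0 h g] by (simp add: opI_def moment_op_def)

lemma bounded_clinear_opI: "bounded_clinear (opI cls)"
proof -
  obtain K where K: "\<And>h. norm (S 0 h) \<le> norm h * K" "0 < K" using bounded_clinear_bound[OF S[of 0]] by auto
  show ?thesis
  proof (rule bounded_clinearI)
    show "opI cls (x + y) = opI cls x + opI cls y" for x y by (simp add: opI_def gen_add)
    show "opI cls (c *\<^sub>C x) = c *\<^sub>C opI cls x" for c x by (simp add: opI_def gen_scaleC)
    show "norm (opI cls h) \<le> norm h * sqrt K" for h
    proof -
      have "(norm (opI cls h))\<^sup>2 = Re (cinner (S 0 h) h)" using opI_cinner[of h h] by (simp add: cinner_self flip: of_real_power) (metis Re_complex_of_real)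
      also have "\<dots> \<le> norm (S 0 h) * norm h" by (rule Re_cinner_le)
      also have "\<dots> \<le> (norm h * K) * norm h" by (intro mult_right_mono K) auto
      also have "\<dots> = (norm h * sqrt K)\<^sup>2" using K(2) by (simp add: power_mult_distrib power2_eq_square)
      finally show ?thesis by (rule power2_le_imp_le) (use K(2) in auto)
    qed
  qed
qed

lemma cadjoint_opI: "cinner (cadjoint (opI cls) x) h = cinner x (opI cls h)"
  using cadjoint_cinner[OF bounded_clinear_opI, of h x] by (metis cinner_commute)

end

section \<open>The block form of the generalised resolvent\<close>

context moment_space
begin

abbreviation "N \<equiv> ocompl D"
abbreviation "N' \<equiv> ocompl R"

lemmas N_sub = csubspace_ocompl[of D] closed_ocompl[of D]

definition ext_op :: "('k \<Rightarrow> 'k) \<Rightarrow> 'k \<Rightarrow> 'k"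
  where "ext_op \<phi> x = A (P x) + \<phi> (x - P x)"

lemma P_in: "P x \<in> D" and P_diff: "x - P x \<in> N"
  by (simp_all add: oproj_in[OF D_sub] oproj_diff[OF D_sub])

lemma P_N: "y \<in> N \<Longrightarrow> P y = 0"
  by (rule oproj_eqI[OF D_sub]) (auto simp: csubspace_0[OF csubspace_D])

lemma A_zero: "A 0 = 0"
  using A_eqI[OF graph_zero] .

context
  fixes \<phi> assumes \<phi>: "\<phi> \<in> contractions N N'"
begin

lemma param_in: "x \<in> N \<Longrightarrow> \<phi> x \<in> N'"
  and param_add: "x \<in> N \<Longrightarrow> y \<in> N \<Longrightarrow> \<phi> (x + y) = \<phi> x + \<phi> y"
  and param_scaleC: "x \<in> N \<Longrightarrow> \<phi> (c *\<^sub>C x) = c *\<^sub>C \<phi> x"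
  and param_norm: "x \<in> N \<Longrightarrow> norm (\<phi> x) \<le> norm x"
  using \<phi> by (auto simp: contractions_def)

lemma param_zero: "\<phi> 0 = 0"
  using param_scaleC[of 0 0] csubspace_0[OF N_sub(1)] by (simp add: scaleC.zero_left)

lemma ext_op_D: "x \<in> D \<Longrightarrow> ext_op \<phi> x = A x"
  by (simp add: ext_op_def oproj_id[OF D_sub] param_zero)

lemma ext_op_N: "y \<in> N \<Longrightarrow> ext_op \<phi> y = \<phi> y"
  by (simp add: ext_op_def P_N A_zero)

text \<open>A maps D isometrically into R and the parameter maps N into the complement of R. The two
  parts of the value are therefore orthogonal, and Pythagoras applies before and after.\<close>

lemma contraction_ext_op: "contraction (ext_op \<phi>)"
proof (rule contractionI)
  show "ext_op \<phi> (x + y) = ext_op \<phi> x + ext_op \<phi> y" for x y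
  proof -
    have "x + y - (P x + P y) = (x - P x) + (y - P y)" by simp
    then show ?thesis
      unfolding ext_op_def oproj_add[OF D_sub] by (simp only: A_add[OF P_in P_in] param_add[OF P_diff P_diff] add_ac)
  qed
  show "ext_op \<phi> (c *\<^sub>C x) = c *\<^sub>C ext_op \<phi> x" for c x
    unfolding ext_op_def oproj_scaleC[OF D_sub]
    by (simp only: scaleC.diff_right[symmetric] A_scaleC[OF P_in] param_scaleC[OF P_diff] scaleC_add_right)
  show "norm (ext_op \<phi> x) \<le> norm x" for x
  proof -
    have "cinner (\<phi> (x - P x)) (A (P x)) = 0"
      using param_in[OF P_diff[of x]] A_in_R[OF P_in[of x]] by (auto simp: ocompl_def)
    then have "cinner (A (P x)) (\<phi> (x - P x)) = 0" by (simp add: cinner_eq_zero_commute)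
    then have "(norm (ext_op \<phi> x))\<^sup>2 = (norm (P x))\<^sup>2 + (norm (\<phi> (x - P x)))\<^sup>2"
      by (simp add: ext_op_def norm_add_cinner norm_A[OF P_in])
    also have "\<dots> \<le> (norm (P x))\<^sup>2 + (norm (x - P x))\<^sup>2"
      using param_norm[OF P_diff[of x]] by (intro add_left_mono power_mono) auto
    also have "\<dots> = (norm x)\<^sup>2" by (rule norm_oproj_pythagoras[OF D_sub, symmetric])
    finally show ?thesis by (rule power2_le_imp_le) simp
  qed
qed

end

lemma bij_betw_if_ex1:
  assumes "\<And>x. x \<in> V \<Longrightarrow> f x \<in> V" "\<And>y. y \<in> V \<Longrightarrow> \<exists>!x. x \<in> V \<and> f x = y"
  shows "bij_betw f V V"
  unfolding bij_betw_def inj_on_def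
proof
  show "\<forall>x\<in>V. \<forall>y\<in>V. f x = f y \<longrightarrow> x = y" using assms by metis
  show "f ` V = V" using assms by (auto simp: image_iff) metis
qed

lemma preA_in: "x \<in> D \<Longrightarrow> preA d cls \<zeta> x \<in> D"
  by (simp add: preA_def csubspace_diff[OF csubspace_D] csubspace_scaleC[OF csubspace_D] P_in)

lemma preA_bij: assumes "cmod \<zeta> < 1" shows "bij_betw (preA d cls \<zeta>) D D"
proof (rule bij_betw_if_ex1[OF preA_in])
  fix y assume y: "y \<in> D"
  show "\<exists>!x. x \<in> D \<and> preA d cls \<zeta> x = y"
    unfolding preA_def
  proof (rule contraction_resolvent[OF D_sub _ _ _ assms y])
    show "P (A (x - y)) = P (A x) - P (A y)" if "x \<in> D" "y \<in> D" for x y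
      using that oproj_add[OF D_sub, of "A x - A y" "A y"] by (simp add: A_diff)
    show "norm (P (A x)) \<le> norm x" if "x \<in> D" for x
      using norm_oproj_le[OF D_sub, of "A x"] norm_A[OF that] by simp
  qed (rule P_in)
qed

context
  fixes \<zeta> assumes \<zeta>: "cmod \<zeta> < 1"
begin

lemma bfA_in: "v \<in> D \<Longrightarrow> bfA d cls \<zeta> v \<in> D"
  and preA_bfA: "v \<in> D \<Longrightarrow> preA d cls \<zeta> (bfA d cls \<zeta> v) = v"
  using preA_bij[OF \<zeta>] unfolding bfA_def bij_betw_def by (auto intro: inv_into_into f_inv_into_f)

lemma bfA_eqI: "x \<in> D \<Longrightarrow> preA d cls \<zeta> x = v \<Longrightarrow> bfA d cls \<zeta> v = x"
  using preA_bij[OF \<zeta>] unfolding bfA_def bij_betw_def by (auto simp: inv_into_f_f)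

lemma preA_add: "x \<in> D \<Longrightarrow> y \<in> D \<Longrightarrow> preA d cls \<zeta> (x + y) = preA d cls \<zeta> x + preA d cls \<zeta> y"
  by (simp add: preA_def A_add oproj_add[OF D_sub] scaleC_add_right)

lemma preA_scaleC: "x \<in> D \<Longrightarrow> preA d cls \<zeta> (c *\<^sub>C x) = c *\<^sub>C preA d cls \<zeta> x"
  by (simp add: preA_def A_scaleC oproj_scaleC[OF D_sub] scaleC.diff_right scaleC_scaleC mult.commute)

lemma bfA_add: "u \<in> D \<Longrightarrow> v \<in> D \<Longrightarrow> bfA d cls \<zeta> (u + v) = bfA d cls \<zeta> u + bfA d cls \<zeta> v"
  by (rule bfA_eqI) (simp_all add: bfA_in preA_add preA_bfA csubspace_add[OF csubspace_D])

lemma bfA_scaleC: "u \<in> D \<Longrightarrow> bfA d cls \<zeta> (c *\<^sub>C u) = c *\<^sub>C bfA d cls \<zeta> u"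
  by (rule bfA_eqI) (simp_all add: bfA_in preA_scaleC preA_bfA csubspace_scaleC[OF csubspace_D])

lemma bfD_add: "u \<in> D \<Longrightarrow> v \<in> D \<Longrightarrow> bfD d cls \<zeta> (u + v) = bfD d cls \<zeta> u + bfD d cls \<zeta> v"
  by (simp add: bfD_def bfA_add A_add bfA_in oproj_add[OF N_sub] scaleC_add_right)

lemma bfD_scaleC: "u \<in> D \<Longrightarrow> bfD d cls \<zeta> (c *\<^sub>C u) = c *\<^sub>C bfD d cls \<zeta> u"
  by (simp add: bfD_def bfA_scaleC A_scaleC bfA_in oproj_scaleC[OF N_sub] scaleC_scaleC mult.commute)

lemma bfD_zero: "bfD d cls \<zeta> 0 = 0"
  using bfD_scaleC[OF csubspace_0[OF csubspace_D], of 0] by (simp add: scaleC.zero_left)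

lemma bfD_in: "bfD d cls \<zeta> u \<in> N"
  unfolding bfD_def by (intro csubspace_scaleC[OF N_sub(1)] oproj_in[OF N_sub])

lemma bfC_in: "bfC d cls \<zeta> u \<in> N"
  unfolding bfC_def by (intro csubspace_add[OF N_sub(1)] csubspace_scaleC[OF N_sub(1)] oproj_in[OF N_sub] bfD_in)

context
  fixes \<Phi> assumes \<Phi>: "\<Phi> \<zeta> \<in> contractions N N'"
begin

lemma denom_eq: "y \<in> N \<Longrightarrow> denom d cls \<Phi> \<zeta> y = y + bfC d cls \<zeta> (\<Phi> \<zeta> y)"
  using param_in[OF \<Phi>] by (simp add: denom_def calC_def)

lemma denom_in: "y \<in> N \<Longrightarrow> denom d cls \<Phi> \<zeta> y \<in> N"
  by (simp add: denom_eq csubspace_add[OF N_sub(1)] bfC_in)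

text \<open>Solving the first row of \<open>1 - \<zeta> T\<close>, written as a block operator on \<open>D \<oplus> N\<close>, for the component
  in \<open>D\<close> leaves the Schur complement \<open>denom\<close> in the second row.\<close>

lemma block_equation:
  assumes u: "u \<in> D" and y: "y \<in> N"
  defines "x \<equiv> bfA d cls \<zeta> (u + \<zeta> *\<^sub>C P (\<Phi> \<zeta> y))"
  shows "(x + y) - \<zeta> *\<^sub>C ext_op (\<Phi> \<zeta>) (x + y) = u + (denom d cls \<Phi> \<zeta> y + bfD d cls \<zeta> u)"
proof -
  let ?w = "\<Phi> \<zeta> y"
  have v: "\<zeta> *\<^sub>C P ?w \<in> D" "u + \<zeta> *\<^sub>C P ?w \<in> D"
    using u by (simp_all add: csubspace_add[OF csubspace_D] csubspace_scaleC[OF csubspace_D] P_in)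
  have x: "x \<in> D" "x - \<zeta> *\<^sub>C P (A x) = u + \<zeta> *\<^sub>C P ?w"
    using bfA_in[OF v(2)] preA_bfA[OF v(2)] by (simp_all add: x_def preA_def)
  have T: "ext_op (\<Phi> \<zeta>) (x + y) = A x + ?w"
    using contraction_ext_op[OF \<Phi>] x(1) y by (simp add: contraction_def bounded_clinear_add ext_op_D[OF \<Phi>] ext_op_N[OF \<Phi>])
  have "- (\<zeta> *\<^sub>C (A x - P (A x))) = bfD d cls \<zeta> (u + \<zeta> *\<^sub>C P ?w)"
    by (simp add: bfD_def x_def oproj_ocompl[OF D_sub] scaleC.minus_left)
  also have "\<dots> = bfD d cls \<zeta> u + \<zeta> *\<^sub>C bfD d cls \<zeta> (P ?w)"
    by (simp add: bfD_add[OF u v(1)] bfD_scaleC[OF P_in])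
  finally have 1: "- (\<zeta> *\<^sub>C (A x - P (A x))) = bfD d cls \<zeta> u + \<zeta> *\<^sub>C bfD d cls \<zeta> (P ?w)" .
  have 2: "denom d cls \<Phi> \<zeta> y = y - \<zeta> *\<^sub>C (?w - P ?w) + \<zeta> *\<^sub>C bfD d cls \<zeta> (P ?w)"
    by (simp add: denom_eq[OF y] bfC_def oproj_ocompl[OF D_sub] scaleC.minus_left)
  have "(x + y) - \<zeta> *\<^sub>C ext_op (\<Phi> \<zeta>) (x + y) =
      (x - \<zeta> *\<^sub>C P (A x)) - \<zeta> *\<^sub>C P ?w + y + (- (\<zeta> *\<^sub>C (A x - P (A x)))) - \<zeta> *\<^sub>C (?w - P ?w)"
    by (simp add: T scaleC_add_right scaleC.diff_right algebra_simps)
  also have "\<dots> = u + (denom d cls \<Phi> \<zeta> y + bfD d cls \<zeta> u)"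
    unfolding x(2) 1 2 by (simp add: algebra_simps)
  finally show ?thesis .
qed

text \<open>For w in N the equation \<open>denom\<close> y = w is the resolvent equation (1 -
  \<zeta> T) v = w, whose D-row expresses P v through the N-component y of v. Unique solvability for
  v yields both existence and uniqueness of y.\<close>

lemma denom_bij: "bij_betw (denom d cls \<Phi> \<zeta>) N N"
proof (rule bij_betw_if_ex1[OF denom_in])
  fix w assume w: "w \<in> N"
  let ?T = "ext_op (\<Phi> \<zeta>)"
  note T = contraction_ext_op[OF \<Phi>]
  define v where "v = resolvent ?T \<zeta> w"
  have v: "v - \<zeta> *\<^sub>C ?T v = w" unfolding v_def by (rule resolvent_eq[OF T \<zeta>])
  define y where "y = v - P v"
  have y: "y \<in> N" by (simp add: y_def P_diff)
  have "P (v - \<zeta> *\<^sub>C ?T v) = 0" unfolding v by (rule P_N[OF w])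
  then have "P v = \<zeta> *\<^sub>C P (?T v)"
    using oproj_add[OF D_sub, of "v - \<zeta> *\<^sub>C ?T v" "\<zeta> *\<^sub>C ?T v"] by (simp add: oproj_scaleC[OF D_sub])
  then have "P v = \<zeta> *\<^sub>C P (A (P v)) + \<zeta> *\<^sub>C P (\<Phi> \<zeta> y)"
    by (simp add: ext_op_def y_def oproj_add[OF D_sub] scaleC_add_right)
  then have "preA d cls \<zeta> (P v) = \<zeta> *\<^sub>C P (\<Phi> \<zeta> y)"
    unfolding preA_def by (simp only: diff_eq_eq add.commute)
  then have "bfA d cls \<zeta> (\<zeta> *\<^sub>C P (\<Phi> \<zeta> y)) = P v" by (intro bfA_eqI P_in)
  then have "denom d cls \<Phi> \<zeta> y = w"
    using block_equation[OF csubspace_0[OF csubspace_D] y] v by (simp add: bfD_zero y_def)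
  moreover have "y' = y" if y': "y' \<in> N" "denom d cls \<Phi> \<zeta> y' = w" for y'
  proof -
    define x' where "x' = bfA d cls \<zeta> (\<zeta> *\<^sub>C P (\<Phi> \<zeta> y'))"
    have x': "x' \<in> D" unfolding x'_def by (intro bfA_in csubspace_scaleC[OF csubspace_D] P_in)
    have "(x' + y') - \<zeta> *\<^sub>C ?T (x' + y') = w"
      using block_equation[OF csubspace_0[OF csubspace_D] y'(1)] y'(2) by (simp add: bfD_zero x'_def)
    then have "v = x' + y'" unfolding v_def by (rule resolvent_eqI[OF T \<zeta>])
    moreover have "P (x' + y') = x'" using x' y'(1) by (simp add: oproj_add[OF D_sub] oproj_id[OF D_sub] P_N)
    ultimately show "y' = y" by (simp add: y_def)
  qed
  ultimately show "\<exists>!y. y \<in> N \<and> denom d cls \<Phi> \<zeta> y = w" using y by blast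
qed

text \<open>With \<open>denom\<close> y = D(\<zeta>) I h, the second row of the block equation
  vanishes at the N-component - y, so the resolvent of I h is x - y. The sign is absorbed by the
  factor - \<zeta> in B(\<zeta>), and the adjoint of I annihilates y because the range of I lies in
  D.\<close>

lemma transform_formula:
  "calA d S cls \<zeta> h + calB d cls \<zeta> (\<Phi> \<zeta> (inv_into N (denom d cls \<Phi> \<zeta>) (calD d cls \<zeta> h))) =
    2 *\<^sub>C cadjoint (opI cls) (resolvent (ext_op (\<Phi> \<zeta>)) \<zeta> (opI cls h)) - S 0 h"
proof -
  let ?u = "opI cls h"
  define y where "y = inv_into N (denom d cls \<Phi> \<zeta>) (calD d cls \<zeta> h)"
  have y: "y \<in> N" "denom d cls \<Phi> \<zeta> y = bfD d cls \<zeta> ?u"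
    using denom_bij bfD_in[of ?u] unfolding y_def bij_betw_def calD_def
    by (auto intro: inv_into_into f_inv_into_f)
  have my: "- y \<in> N" using csubspace_uminus[OF N_sub(1) y(1)] .
  have \<Phi>m: "\<Phi> \<zeta> (- y) = - \<Phi> \<zeta> y" using param_scaleC[OF \<Phi> y(1), of "-1"] by (simp add: scaleC_minus_one)
  have "denom d cls \<Phi> \<zeta> (- y) = - denom d cls \<Phi> \<zeta> y"
  proof -
    have Pm: "P (- w) = - P w" "oproj N (- w) = - oproj N w" for w
      using oproj_scaleC[OF D_sub, of "-1" w] oproj_scaleC[OF N_sub, of "-1" w] by (simp_all add: scaleC_minus_one)
    have "bfD d cls \<zeta> (- P w) = - bfD d cls \<zeta> (P w)" for w
      using bfD_scaleC[OF P_in, of "-1" w] by (simp add: scaleC_minus_one)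
    then show ?thesis by (simp add: denom_eq[OF my] denom_eq[OF y(1)] \<Phi>m bfC_def Pm scaleC.minus_right)
  qed
  then have eq: "denom d cls \<Phi> \<zeta> (- y) + bfD d cls \<zeta> ?u = 0" using y(2) by simp
  define x where "x = bfA d cls \<zeta> (?u + \<zeta> *\<^sub>C P (\<Phi> \<zeta> (- y)))"
  have R: "resolvent (ext_op (\<Phi> \<zeta>)) \<zeta> ?u = x + - y"
    by (rule resolvent_eqI[OF contraction_ext_op[OF \<Phi>] \<zeta>])
      (use block_equation[OF opI_in_D my, of h] eq in \<open>simp add: x_def\<close>)
  have "\<zeta> *\<^sub>C P (\<Phi> \<zeta> (- y)) = (- \<zeta>) *\<^sub>C P (\<Phi> \<zeta> y)"
    using oproj_scaleC[OF D_sub, of "-1" "\<Phi> \<zeta> y"] by (simp add: \<Phi>m scaleC_minus_one scaleC.minus_left scaleC.minus_right)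
  then have x: "x = bfA d cls \<zeta> ?u + bfB d cls \<zeta> (\<Phi> \<zeta> y)"
    by (simp add: x_def bfB_def bfA_add opI_in_D csubspace_scaleC[OF csubspace_D] P_in bfA_scaleC[OF P_in])
  have calB: "calB d cls \<zeta> (\<Phi> \<zeta> y) = 2 *\<^sub>C cadjoint (opI cls) (bfB d cls \<zeta> (\<Phi> \<zeta> y))"
    using param_in[OF \<Phi> y(1)] by (simp add: calB_def)
  show ?thesis
    unfolding y_def[symmetric]
  proof (rule cinner_ext_left)
    fix g
    have "cinner (- y) (opI cls g) = 0" using y(1) opI_in_D[of g] by (simp add: ocompl_def cinner.minus_left)
    then show "cinner (calA d S cls \<zeta> h + calB d cls \<zeta> (\<Phi> \<zeta> y)) g =
      cinner (2 *\<^sub>C cadjoint (opI cls) (resolvent (ext_op (\<Phi> \<zeta>)) \<zeta> ?u) - S 0 h) g"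
      by (simp add: R x calB calA_def cinner.add_left cinner.diff_left cinner_scaleC_left cadjoint_opI distrib_left cinner.minus_left)
  qed
qed

end

end

text \<open>From here on the parameter enters through the resolvent of its extension of A; the four
  coefficients need not be unfolded again.\<close>

lemma nevanlinna_relation_iff:
  assumes \<Phi>: "\<Phi> \<in> schur_class N N'"
  shows "nevanlinna_relation d S cls \<Phi> F \<longleftrightarrow> (\<forall>\<zeta>. cmod \<zeta> < 1 \<longrightarrow> has_rs_integral (herglotz_kernel \<zeta>) F 0 (2 * pi)
    (\<lambda>h. 2 *\<^sub>C cadjoint (opI cls) (resolvent (ext_op (\<Phi> \<zeta>)) \<zeta> (opI cls h)) - S 0 h))"
proof -
  have c: "\<Phi> \<zeta> \<in> contractions N N'" if "cmod \<zeta> < 1" for \<zeta> using \<Phi> that by (auto simp: schur_class_def)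
  have k: "(\<lambda>t. (1 + \<zeta> * exp (\<i> * of_real t)) / (1 - \<zeta> * exp (\<i> * of_real t))) = herglotz_kernel \<zeta>" for \<zeta>
    by (simp add: herglotz_kernel_def[abs_def] circ_exp_def)
  show ?thesis
  proof -
    have eq: "(\<lambda>h. calA d S cls \<zeta> h + calB d cls \<zeta> (\<Phi> \<zeta> (inv_into N (denom d cls \<Phi> \<zeta>) (calD d cls \<zeta> h)))) =
      (\<lambda>h. 2 *\<^sub>C cadjoint (opI cls) (resolvent (ext_op (\<Phi> \<zeta>)) \<zeta> (opI cls h)) - S 0 h)" if "cmod \<zeta> < 1" for \<zeta>
      by (rule ext) (rule transform_formula[where \<Phi>=\<Phi>, OF that c[OF that]])
    show ?thesis unfolding nevanlinna_relation_def k by (auto simp: eq)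
  qed
qed

lemma solutions_iff:
  "F \<in> solutions d S \<longleftrightarrow> distribution_fun 0 (2 * pi) F \<and>
    (\<forall>n\<le>d. has_rs_integral (\<lambda>t. circ_exp t ^ n) F 0 (2 * pi) (S n))"
proof -
  have "(\<lambda>t. exp (\<i> * of_nat n * of_real t)) = (\<lambda>t. circ_exp t ^ n)" for n
    by (rule ext) (simp add: circ_exp_def exp_of_nat_mult[symmetric] mult_ac)
  then show ?thesis by (auto simp: solutions_def distribution_fun_def)
qed

end

section \<open>From the parameter to the solution\<close>

text \<open>The second resolvent identity with both the operator and the spectral variable changing:
  x is (1 - w T') u plus a correction, where u is the first resolvent of x.\<close>

lemma resolvent_difference:
  assumes T: "contraction T" and T': "contraction T'" and z: "cmod z < 1" and w: "cmod w < 1"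
  shows "resolvent T' w x - resolvent T z x =
    resolvent T' w (w *\<^sub>C T' (resolvent T z x) - z *\<^sub>C T (resolvent T z x))"
proof -
  let ?u = "resolvent T z x"
  have "x = (?u - w *\<^sub>C T' ?u) + (w *\<^sub>C T' ?u - z *\<^sub>C T ?u)"
    using resolvent_eq[OF T z, of x] by simp
  then have "resolvent T' w x = resolvent T' w (?u - w *\<^sub>C T' ?u) + resolvent T' w (w *\<^sub>C T' ?u - z *\<^sub>C T ?u)"
    using resolvent_add[OF T' w] by metis
  moreover have "resolvent T' w (?u - w *\<^sub>C T' ?u) = ?u" by (rule resolvent_eqI[OF T' w refl])
  ultimately show ?thesis by simp
qed

lemma resolvent_tendsto_zero:
  assumes T: "\<And>w. cmod w < 1 \<Longrightarrow> contraction (T w)" and z: "cmod z < 1" and v: "(v \<longlongrightarrow> 0) (at z)"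
  shows "((\<lambda>w. resolvent (T w) w (v w)) \<longlongrightarrow> 0) (at z)"
proof (rule Lim_null_comparison)
  have lt: "\<forall>\<^sub>F w in at z. cmod w < 1"
    using order_tendstoD(2)[OF tendsto_norm[OF tendsto_ident_at], of z 1] z by simp
  show "\<forall>\<^sub>F w in at z. norm (resolvent (T w) w (v w)) \<le> norm (v w) / (1 - cmod w)"
    using lt by eventually_elim (rule norm_resolvent[OF T])
  have "((\<lambda>w. norm (v w) / (1 - cmod w)) \<longlongrightarrow> 0 / (1 - cmod z)) (at z)"
    using z v by (intro tendsto_intros tendsto_norm_zero) auto
  then show "((\<lambda>w. norm (v w) / (1 - cmod w)) \<longlongrightarrow> 0) (at z)" by simp
qed

text \<open>By the resolvent identity the difference quotient of R is R_w applied to the quotient of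
  w T_w at u = R_z x. That quotient converges to some c, while R_w is bounded near z and converges
  strongly, by the same identity.\<close>

lemma resolvent_holomorphic:
  fixes T :: "complex \<Rightarrow> 'a::chilbert_space \<Rightarrow> 'a"
  assumes T: "\<And>w. cmod w < 1 \<Longrightarrow> contraction (T w)"
    and deriv: "\<And>z u. cmod z < 1 \<Longrightarrow> \<exists>t. ((\<lambda>w. inverse (w - z) *\<^sub>C (T w u - T z u)) \<longlongrightarrow> t) (at z)"
  shows "(\<lambda>z. cinner (resolvent (T z) z x) y) holomorphic_on ball 0 1"
proof (rule holomorphic_onI)
  fix z assume "z \<in> ball (0::complex) 1"
  then have z: "cmod z < 1" by simp
  have lt: "\<forall>\<^sub>F w in at z. cmod w < 1"
    using order_tendstoD(2)[OF tendsto_norm[OF tendsto_ident_at], of z 1] z by simp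
  have ne: "\<forall>\<^sub>F w in at z. w \<noteq> z" by (simp add: eventually_at_filter)
  have quot: "\<exists>c. ((\<lambda>w. inverse (w - z) *\<^sub>C (w *\<^sub>C T w u - z *\<^sub>C T z u)) \<longlongrightarrow> c) (at z)" for u
  proof -
    obtain t where t: "((\<lambda>w. inverse (w - z) *\<^sub>C (T w u - T z u)) \<longlongrightarrow> t) (at z)" using deriv[OF z] by blast
    have "((\<lambda>w. T z u + (w - z) *\<^sub>C (inverse (w - z) *\<^sub>C (T w u - T z u)) + z *\<^sub>C (inverse (w - z) *\<^sub>C (T w u - T z u)))
       \<longlongrightarrow> T z u + (z - z) *\<^sub>C t + z *\<^sub>C t) (at z)"
      by (intro tendsto_intros scaleC.tendsto t)
    moreover have "\<forall>\<^sub>F w in at z. T z u + (w - z) *\<^sub>C (inverse (w - z) *\<^sub>C (T w u - T z u)) + z *\<^sub>C (inverse (w - z) *\<^sub>C (T w u - T z u))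
        = inverse (w - z) *\<^sub>C (w *\<^sub>C T w u - z *\<^sub>C T z u)"
      using ne
    proof eventually_elim
      case (elim w)
      have "w *\<^sub>C T w u - z *\<^sub>C T z u = (w - z) *\<^sub>C T z u + w *\<^sub>C (T w u - T z u)"
        by (simp add: scaleC.diff_right scaleC.diff_left)
      also have "\<dots> = (w - z) *\<^sub>C T z u + ((w - z) *\<^sub>C (T w u - T z u) + z *\<^sub>C (T w u - T z u))"
        by (simp add: scaleC.diff_left)
      finally have eq: "w *\<^sub>C T w u - z *\<^sub>C T z u = (w - z) *\<^sub>C T z u + ((w - z) *\<^sub>C (T w u - T z u) + z *\<^sub>C (T w u - T z u))" .
      have "b + m *\<^sub>C (inverse m *\<^sub>C a) + z *\<^sub>C (inverse m *\<^sub>C a) = inverse m *\<^sub>C (m *\<^sub>C b + (m *\<^sub>C a + z *\<^sub>C a))"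
        if "m \<noteq> 0" for m and a b :: 'a
        using that by (simp add: scaleC_add_right scaleC_scaleC mult.commute)
      from this[of "w - z" "T z u" "T w u - T z u"] elim show ?case unfolding eq by simp
    qed
    ultimately show ?thesis by (blast intro: Lim_transform_eventually)
  qed
  let ?R = "\<lambda>w. resolvent (T w) w"
  have cont: "((\<lambda>w. ?R w c) \<longlongrightarrow> ?R z c) (at z)" for c
  proof -
    let ?u = "?R z c"
    obtain q where q: "((\<lambda>w. inverse (w - z) *\<^sub>C (w *\<^sub>C T w ?u - z *\<^sub>C T z ?u)) \<longlongrightarrow> q) (at z)" using quot by blast
    have "((\<lambda>w. (w - z) *\<^sub>C (inverse (w - z) *\<^sub>C (w *\<^sub>C T w ?u - z *\<^sub>C T z ?u))) \<longlongrightarrow> (z - z) *\<^sub>C q) (at z)"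
      by (intro scaleC.tendsto tendsto_intros q)
    moreover have "\<forall>\<^sub>F w in at z. (w - z) *\<^sub>C (inverse (w - z) *\<^sub>C (w *\<^sub>C T w ?u - z *\<^sub>C T z ?u)) = w *\<^sub>C T w ?u - z *\<^sub>C T z ?u"
      using ne by eventually_elim (simp add: scaleC_scaleC)
    ultimately have "((\<lambda>w. w *\<^sub>C T w ?u - z *\<^sub>C T z ?u) \<longlongrightarrow> 0) (at z)"
      by (auto intro: Lim_transform_eventually simp: scaleC.zero_left)
    note lim = this
    have "((\<lambda>w. ?R w (w *\<^sub>C T w ?u - z *\<^sub>C T z ?u)) \<longlongrightarrow> 0) (at z)"
      by (rule resolvent_tendsto_zero[where T=T and v="\<lambda>w. w *\<^sub>C T w ?u - z *\<^sub>C T z ?u", OF T z lim])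
    moreover have "\<forall>\<^sub>F w in at z. ?R w (w *\<^sub>C T w ?u - z *\<^sub>C T z ?u) = ?R w c - ?R z c"
      using lt
    proof eventually_elim
      case (elim w)
      show ?case by (rule resolvent_difference[OF T[OF z] T[OF elim] z elim, symmetric])
    qed
    ultimately have "((\<lambda>w. ?R w c - ?R z c) \<longlongrightarrow> 0) (at z)" by (rule Lim_transform_eventually)
    then show ?thesis by (simp add: LIM_zero_iff)
  qed
  let ?u = "?R z x"
  obtain c where c: "((\<lambda>w. inverse (w - z) *\<^sub>C (w *\<^sub>C T w ?u - z *\<^sub>C T z ?u)) \<longlongrightarrow> c) (at z)" using quot by blast
  let ?q = "\<lambda>w. inverse (w - z) *\<^sub>C (w *\<^sub>C T w ?u - z *\<^sub>C T z ?u)"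
  \<comment> \<open>Splitting off the limit c: local boundedness of R_w handles the first term,
    strong continuity the second.\<close>
  have "((\<lambda>w. ?R w (?q w - c) + ?R w c) \<longlongrightarrow> 0 + ?R z c) (at z)"
    using c by (intro tendsto_add resolvent_tendsto_zero[OF T z] cont) (simp_all add: LIM_zero_iff)
  moreover have "\<forall>\<^sub>F w in at z. ?R w (?q w - c) + ?R w c = inverse (w - z) *\<^sub>C (?R w x - ?R z x)"
    using lt
  proof eventually_elim
    case (elim w)
    have "?R w (?q w - c) + ?R w c = ?R w (?q w)" using resolvent_add[OF T[OF elim] elim, of "?q w - c" c] by simp
    also have "\<dots> = inverse (w - z) *\<^sub>C (?R w x - ?R z x)"
      by (simp add: resolvent_scaleC[OF T[OF elim] elim] resolvent_difference[OF T[OF z] T[OF elim] z elim])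
    finally show ?case .
  qed
  ultimately have "((\<lambda>w. inverse (w - z) *\<^sub>C (?R w x - ?R z x)) \<longlongrightarrow> ?R z c) (at z)"
    by (auto intro: Lim_transform_eventually)
  then have "((\<lambda>w. cinner (inverse (w - z) *\<^sub>C (?R w x - ?R z x)) y) \<longlongrightarrow> cinner (?R z c) y) (at z)"
    by (intro cinner.tendsto tendsto_const)
  then have "((\<lambda>w. (cinner (?R w x) y - cinner (?R z x) y) / (w - z)) \<longlongrightarrow> cinner (?R z c) y) (at z)"
    by (simp add: cinner_scaleC_left cinner.diff_left divide_inverse mult.commute)
  then have "((\<lambda>z. cinner (?R z x) y) has_field_derivative cinner (?R z c) y) (at z)"
    by (simp add: has_field_derivative_iff)
  then show "(\<lambda>z. cinner (?R z x) y) field_differentiable at z within ball 0 1"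
    using field_differentiable_def field_differentiable_at_within by blast
qed

context moment_space
begin

lemma schur_contraction: "\<Phi> \<in> schur_class N N' \<Longrightarrow> cmod \<zeta> < 1 \<Longrightarrow> \<Phi> \<zeta> \<in> contractions N N'"
  by (auto simp: schur_class_def)

lemma schur_ext_op: "\<Phi> \<in> schur_class N N' \<Longrightarrow> cmod \<zeta> < 1 \<Longrightarrow> contraction (ext_op (\<Phi> \<zeta>))"
  by (intro contraction_ext_op schur_contraction)

lemma schur_quotient_limit:
  assumes \<Phi>: "\<Phi> \<in> schur_class N N'" and z: "cmod z < 1"
  shows "\<exists>t. ((\<lambda>w. inverse (w - z) *\<^sub>C (ext_op (\<Phi> w) u - ext_op (\<Phi> z) u)) \<longlongrightarrow> t) (at z)"
proof -
  let ?n = "u - P u"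
  have "op_analytic_on_disc N \<Phi>" using \<Phi> by (simp add: schur_class_def)
  then obtain T where T: "\<And>\<epsilon>. 0 < \<epsilon> \<Longrightarrow> \<forall>\<^sub>F w in at z. \<forall>x\<in>N. norm (inverse (w - z) *\<^sub>C (\<Phi> w x - \<Phi> z x) - T x) \<le> \<epsilon> * norm x"
  proof -
    have "z \<in> ball 0 1" using z by simp
    with \<open>op_analytic_on_disc N \<Phi>\<close> have "\<exists>T. \<forall>\<epsilon>>0. \<forall>\<^sub>F w in at z. \<forall>x\<in>N. norm (inverse (w - z) *\<^sub>C (\<Phi> w x - \<Phi> z x) - T x) \<le> \<epsilon> * norm x"
      unfolding op_analytic_on_disc_def by (rule bspec)
    then show ?thesis using that by blast
  qed
  have "((\<lambda>w. inverse (w - z) *\<^sub>C (\<Phi> w ?n - \<Phi> z ?n)) \<longlongrightarrow> T ?n) (at z)"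
  proof (rule tendstoI)
    fix e :: real assume e: "0 < e"
    have "0 < e / (norm ?n + 1)" using e by (simp add: add_nonneg_pos)
    from T[OF this] show "\<forall>\<^sub>F w in at z. dist (inverse (w - z) *\<^sub>C (\<Phi> w ?n - \<Phi> z ?n)) (T ?n) < e"
    proof eventually_elim
      case (elim w)
      have "norm (inverse (w - z) *\<^sub>C (\<Phi> w ?n - \<Phi> z ?n) - T ?n) \<le> e / (norm ?n + 1) * norm ?n"
        using elim P_diff by blast
      also have "\<dots> < e / (norm ?n + 1) * (norm ?n + 1)" using e by (intro mult_strict_left_mono) (auto simp: add_nonneg_pos)
      also have "\<dots> = e"
      proof -
        have "norm ?n + 1 \<noteq> 0" using norm_ge_zero[of ?n] by linarith
        then show ?thesis by simp
      qed
      finally show ?case by (simp add: dist_norm)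
    qed
  qed
  then show ?thesis by (auto simp: ext_op_def)
qed

text \<open>Below index d the operator T is the shift, so 1 - z T maps x_{h,j} to x_{h,j} - z
  x_{h,j+1}.\<close>

lemma resolvent_generators:
  assumes T: "contraction T" "\<And>x. x \<in> D \<Longrightarrow> T x = A x" and z: "cmod z < 1" and j: "j < d"
  shows "resolvent T z (x_gen h j) = x_gen h j + z *\<^sub>C resolvent T z (x_gen h (Suc j))"
proof -
  have "T (x_gen h j) = x_gen h (Suc j)" using T(2) gen_in_D[OF j] by metis
  then have "resolvent T z (x_gen h j - z *\<^sub>C x_gen h (Suc j)) = x_gen h j"
    by (intro resolvent_eqI[OF T(1) z]) simp
  moreover have "x_gen h j = (x_gen h j - z *\<^sub>C x_gen h (Suc j)) + z *\<^sub>C x_gen h (Suc j)" by simp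
  ultimately show ?thesis
    using resolvent_add[OF T(1) z, of "x_gen h j - z *\<^sub>C x_gen h (Suc j)" "z *\<^sub>C x_gen h (Suc j)"]
      resolvent_scaleC[OF T(1) z, of z "x_gen h (Suc j)"] by simp
qed

lemma resolvent_expansion:
  assumes T: "contraction T" "\<And>x. x \<in> D \<Longrightarrow> T x = A x" and z: "cmod z < 1" and j: "j \<le> d"
  shows "resolvent T z (opI cls h) = (\<Sum>k<j. z ^ k *\<^sub>C x_gen h k) + z ^ j *\<^sub>C resolvent T z (x_gen h j)"
  using j
proof (induction j)
  case (Suc j)
  have "resolvent T z (x_gen h j) = x_gen h j + z *\<^sub>C resolvent T z (x_gen h (Suc j))"
    using Suc.prems by (intro resolvent_generators[OF T z]) auto
  then show ?case using Suc by (simp add: scaleC_add_right scaleC_scaleC mult.commute)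
qed (simp add: opI_def)

definition transform_form :: "(complex \<Rightarrow> 'k \<Rightarrow> 'k) \<Rightarrow> complex \<Rightarrow> 'h \<Rightarrow> 'h \<Rightarrow> complex"
  where "transform_form \<Phi> \<zeta> h g =
    2 * cinner (resolvent (ext_op (\<Phi> \<zeta>)) \<zeta> (opI cls h)) (opI cls g) - cinner (opI cls h) (opI cls g)"

lemma cinner_transform: "cinner (2 *\<^sub>C cadjoint (opI cls) (resolvent (ext_op (\<Phi> \<zeta>)) \<zeta> (opI cls h)) - S 0 h) g
    = transform_form \<Phi> \<zeta> h g"
  by (simp add: transform_form_def cinner.diff_left cinner_scaleC_left cadjoint_opI opI_cinner)

text \<open>The expansion is explicit up to x_{h,d}, where T stops being prescribed; one more step
  leaves a remainder of which only the norm matters. The factor 4 combines the 2 of the transform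
  with 1 / (1 - |\<zeta>|) <= 2.\<close>

lemma moment_form_expansion:
  assumes \<Phi>: "\<Phi> \<in> schur_class N N'" and \<zeta>: "cmod \<zeta> < 1/2"
  shows "cmod (transform_form \<Phi> \<zeta> h g - (\<Sum>k\<le>d. (if k = 0 then 1 else 2) * \<zeta> ^ k * cinner (S k h) g))
    \<le> 4 * norm (x_gen h d) * norm (opI cls g) * cmod \<zeta> ^ Suc d"
proof -
  let ?T = "ext_op (\<Phi> \<zeta>)" and ?v = "resolvent (ext_op (\<Phi> \<zeta>)) \<zeta> (ext_op (\<Phi> \<zeta>) (x_gen h d))"
  have \<zeta>1: "cmod \<zeta> < 1" using \<zeta> by simp
  note T = schur_ext_op[OF \<Phi> \<zeta>1] and TD = ext_op_D[OF schur_contraction[OF \<Phi> \<zeta>1]]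
  have gk: "cinner (x_gen h k) (opI cls g) = cinner (S k h) g" if "k \<le> d" for k
    using gen_cinner[OF that, of 0 h g] by (simp add: opI_def moment_op_def)
  have "resolvent ?T \<zeta> (x_gen h d - \<zeta> *\<^sub>C ?T (x_gen h d)) = x_gen h d"
    by (rule resolvent_eqI[OF T \<zeta>1 refl])
  then have last: "resolvent ?T \<zeta> (x_gen h d) = x_gen h d + \<zeta> *\<^sub>C ?v"
    using resolvent_add[OF T \<zeta>1, of "x_gen h d - \<zeta> *\<^sub>C ?T (x_gen h d)" "\<zeta> *\<^sub>C ?T (x_gen h d)"]
    by (simp add: resolvent_scaleC[OF T \<zeta>1])
  have "resolvent ?T \<zeta> (opI cls h) = (\<Sum>k<Suc d. \<zeta> ^ k *\<^sub>C x_gen h k) + \<zeta> ^ Suc d *\<^sub>C ?v"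
    using resolvent_expansion[OF T TD \<zeta>1 order_refl, of h] by (simp add: last scaleC_add_right scaleC_scaleC mult.commute)
  then have "cinner (resolvent ?T \<zeta> (opI cls h)) (opI cls g) = (\<Sum>k\<le>d. \<zeta> ^ k * cinner (S k h) g) + \<zeta> ^ Suc d * cinner ?v (opI cls g)"
    by (simp add: cinner.add_left cinner.sum_left cinner_scaleC_left gk lessThan_Suc_atMost del: sum.lessThan_Suc)
  moreover have "(\<Sum>k\<le>d. (if k = 0 then 1 else 2) * \<zeta> ^ k * cinner (S k h) g) = 2 * (\<Sum>k\<le>d. \<zeta> ^ k * cinner (S k h) g) - cinner (S 0 h) g"
  proof -
    have "(\<Sum>k\<le>d. (if k = 0 then 1 else 2) * \<zeta> ^ k * cinner (S k h) g) = (\<Sum>k\<le>d. 2 * (\<zeta> ^ k * cinner (S k h) g) - (if k = 0 then cinner (S 0 h) g else 0))"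
      by (intro sum.cong) auto
    then show ?thesis by (simp add: sum_subtractf sum_distrib_left)
  qed
  ultimately have "transform_form \<Phi> \<zeta> h g - (\<Sum>k\<le>d. (if k = 0 then 1 else 2) * \<zeta> ^ k * cinner (S k h) g) = 2 * \<zeta> ^ Suc d * cinner ?v (opI cls g)"
    by (simp add: transform_form_def opI_cinner algebra_simps)
  moreover have "cmod (cinner ?v (opI cls g)) \<le> 2 * norm (x_gen h d) * norm (opI cls g)"
  proof -
    have "norm ?v \<le> norm (?T (x_gen h d)) / (1 - cmod \<zeta>)" by (rule norm_resolvent[OF T \<zeta>1])
    also have "\<dots> \<le> norm (x_gen h d) / (1 / 2)"
      using T \<zeta> by (intro frac_le) (auto simp: contraction_def)
    finally have "norm ?v * norm (opI cls g) \<le> 2 * norm (x_gen h d) * norm (opI cls g)" by (intro mult_right_mono) auto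
    then show ?thesis using cmod_cinner_le[of ?v "opI cls g"] by linarith
  qed
  then have "2 * cmod \<zeta> ^ Suc d * cmod (cinner ?v (opI cls g)) \<le> 2 * cmod \<zeta> ^ Suc d * (2 * norm (x_gen h d) * norm (opI cls g))"
    by (intro mult_left_mono) auto
  ultimately show ?thesis by (simp add: norm_mult norm_power mult_ac)
qed

theorem parameter_to_solution:
  assumes \<Phi>: "\<Phi> \<in> schur_class N N'"
  shows "\<exists>!F. F \<in> solutions d S \<and> nevanlinna_relation d S cls \<Phi> F"
proof -
  note T = schur_ext_op[OF \<Phi>]
  obtain K where K: "\<And>h. norm (opI cls h) \<le> norm h * K" using bounded_clinear_bound[OF bounded_clinear_opI] by metis
  have zero: "transform_form \<Phi> 0 h g = cinner (opI cls h) (opI cls g)" for h g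
    using resolvent_rec[OF T[of 0], of 0 "opI cls h"] by (simp add: transform_form_def scaleC.zero_left)
  obtain F where F: "distribution_fun 0 (2 * pi) F"
    "\<And>\<zeta>. cmod \<zeta> < 1 \<Longrightarrow> \<exists>T. has_rs_integral (herglotz_kernel \<zeta>) F 0 (2 * pi) T \<and> (\<forall>h g. cinner (T h) g = transform_form \<Phi> \<zeta> h g)"
  proof (rule operator_herglotz[of "transform_form \<Phi>" "K\<^sup>2"])
    show "sesq (transform_form \<Phi> z)" if z: "cmod z < 1" for z
      unfolding transform_form_def[abs_def]
      using bounded_clinear_opI
        by (simp add: sesq_def bounded_clinear_add bounded_clinear_scaleC cinner_add_left cinner_add_right
            cinner_scaleC_left cinner_scaleC_right resolvent_add[OF T[OF z] z] resolvent_scaleC[OF T[OF z] z] algebra_simps)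
    show "(\<lambda>z. transform_form \<Phi> z h g) holomorphic_on ball 0 1" for h g
      unfolding transform_form_def
      by (intro holomorphic_intros resolvent_holomorphic T schur_quotient_limit[OF \<Phi>])
    show "0 \<le> Re (transform_form \<Phi> z h h)" if z: "cmod z < 1" for z h
      using Re_resolvent_nonneg[OF T[OF z] z, of "opI cls h"] by (simp add: transform_form_def cinner_self flip: of_real_power)
    show "cnj (transform_form \<Phi> 0 g h) = transform_form \<Phi> 0 h g" for h g
      unfolding zero by (rule cinner_commute[symmetric])
    show "Re (transform_form \<Phi> 0 h h) \<le> K\<^sup>2 * (norm h)\<^sup>2" for h
    proof -
      have "(norm (opI cls h))\<^sup>2 \<le> (norm h * K)\<^sup>2" using K[of h] by (intro power_mono) auto
      then show ?thesis by (simp add: zero cinner_self power_mult_distrib mult.commute flip: of_real_power)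
    qed
  qed blast
  have rsF: "rs_int F (herglotz_kernel \<zeta>) h = 2 *\<^sub>C cadjoint (opI cls) (resolvent (ext_op (\<Phi> \<zeta>)) \<zeta> (opI cls h)) - S 0 h"
    "has_rs_integral (herglotz_kernel \<zeta>) F 0 (2 * pi) (\<lambda>h. 2 *\<^sub>C cadjoint (opI cls) (resolvent (ext_op (\<Phi> \<zeta>)) \<zeta> (opI cls h)) - S 0 h)"
    if \<zeta>: "cmod \<zeta> < 1" for \<zeta> h
  proof -
    obtain T where T: "has_rs_integral (herglotz_kernel \<zeta>) F 0 (2 * pi) T" "\<And>h g. cinner (T h) g = transform_form \<Phi> \<zeta> h g"
      using F(2)[OF \<zeta>] by blast
    have "T = (\<lambda>h. 2 *\<^sub>C cadjoint (opI cls) (resolvent (ext_op (\<Phi> \<zeta>)) \<zeta> (opI cls h)) - S 0 h)"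
    proof
      fix h show "T h = 2 *\<^sub>C cadjoint (opI cls) (resolvent (ext_op (\<Phi> \<zeta>)) \<zeta> (opI cls h)) - S 0 h"
        by (rule cinner_ext_left) (simp only: T(2) cinner_transform)
    qed
    then show "rs_int F (herglotz_kernel \<zeta>) h = 2 *\<^sub>C cadjoint (opI cls) (resolvent (ext_op (\<Phi> \<zeta>)) \<zeta> (opI cls h)) - S 0 h"
      "has_rs_integral (herglotz_kernel \<zeta>) F 0 (2 * pi) (\<lambda>h. 2 *\<^sub>C cadjoint (opI cls) (resolvent (ext_op (\<Phi> \<zeta>)) \<zeta> (opI cls h)) - S 0 h)"
      using T(1) rs_int_eqI[OF T(1)] by simp_all
  qed
  have "has_rs_integral (\<lambda>t. circ_exp t ^ n) F 0 (2 * pi) (S n)" if n: "n \<le> d" for n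
  proof -
    have "rs_int F (\<lambda>t. circ_exp t ^ n) = S n"
    proof
      fix h show "rs_int F (\<lambda>t. circ_exp t ^ n) h = S n h"
      proof (rule cinner_ext_left)
        fix g show "cinner (rs_int F (\<lambda>t. circ_exp t ^ n) h) g = cinner (S n h) g"
        proof (rule transform_determines_moments[OF F(1) _ n, where c="\<lambda>k. cinner (S k h) g"])
          fix \<zeta> :: complex assume \<zeta>: "0 < cmod \<zeta>" "cmod \<zeta> < 1/2"
          then have "cmod \<zeta> < 1" by simp
          then show "cmod (cinner (rs_int F (herglotz_kernel \<zeta>) h) g - (\<Sum>k\<le>d. (if k = 0 then 1 else 2) * \<zeta> ^ k * cinner (S k h) g))
            \<le> 4 * norm (x_gen h d) * norm (opI cls g) * cmod \<zeta> ^ Suc d"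
            using moment_form_expansion[OF \<Phi> \<zeta>(2), of h g] by (simp only: rsF cinner_transform)
        qed
      qed
    qed
    then show ?thesis using rs_int_props(1)[OF F(1), of "\<lambda>t. circ_exp t ^ n"]
      by (simp add: continuous_on_power continuous_circ_exp)
  qed
  then have "F \<in> solutions d S" using F(1) by (simp add: solutions_iff)
  moreover have "nevanlinna_relation d S cls \<Phi> F" using rsF(2) by (simp add: nevanlinna_relation_iff[OF \<Phi>])
  moreover have "G = F" if G: "G \<in> solutions d S \<and> nevanlinna_relation d S cls \<Phi> G" for G
  proof (rule distribution_fun_eqI)
    show "distribution_fun 0 (2 * pi) G" "distribution_fun 0 (2 * pi) F" using G F(1) by (auto simp: solutions_iff)
    fix \<zeta> :: complex assume \<zeta>: "cmod \<zeta> < 1"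
    then have "rs_int G (herglotz_kernel \<zeta>) = (\<lambda>h. 2 *\<^sub>C cadjoint (opI cls) (resolvent (ext_op (\<Phi> \<zeta>)) \<zeta> (opI cls h)) - S 0 h)"
      using G by (intro rs_int_eqI) (simp add: nevanlinna_relation_iff[OF \<Phi>])
    then show "rs_int G (herglotz_kernel \<zeta>) = rs_int F (herglotz_kernel \<zeta>)" using rsF(1)[OF \<zeta>] by auto
  qed
  ultimately show ?thesis by blast
qed

end

section \<open>From the solution to the parameter\<close>

text \<open>The optimal weight is s = b / a; adding e to both numbers admits a = 0 and b = 0, and
  then e tends to 0.\<close>

lemma scaled_amgm_optimise:
  fixes X C a b :: real
  assumes "\<And>s. 0 < s \<Longrightarrow> X \<le> C / 2 * (s * a\<^sup>2 + b\<^sup>2 / s)" "0 \<le> C" "0 \<le> a" "0 \<le> b"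
  shows "X \<le> C * a * b"
proof (rule tendsto_lowerbound)
  show "((\<lambda>e. C * (a + e) * (b + e)) \<longlongrightarrow> C * a * b) (at_right 0)"
    by (rule tendsto_eq_intros refl | simp)+
  have "X \<le> C * (a + e) * (b + e)" if e: "0 < e" for e
  proof -
    define s where "s = (b + e) / (a + e)"
    have s: "0 < s" using assms e by (simp add: s_def add_nonneg_pos)
    have "s * a\<^sup>2 + b\<^sup>2 / s \<le> s * (a + e)\<^sup>2 + (b + e)\<^sup>2 / s"
      using s assms e by (intro add_mono mult_left_mono divide_right_mono power_mono) auto
    also have "\<dots> = 2 * ((a + e) * (b + e))"
      using assms e add_nonneg_pos[of a e] add_nonneg_pos[of b e] by (simp add: s_def power2_eq_square)
    finally have "C / 2 * (s * a\<^sup>2 + b\<^sup>2 / s) \<le> C / 2 * (2 * ((a + e) * (b + e)))" using assms(2) by (intro mult_left_mono) auto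
    then show ?thesis using assms(1)[OF s] by simp
  qed
  then show "\<forall>\<^sub>F e in at_right 0. X \<le> C * (a + e) * (b + e)"
    by (simp add: eventually_at_filter)
qed simp

context moment_space
begin

section \<open>Density of the classes and equality of operators\<close>

lemma formal_sums_add: "h \<in> formal_sums d \<Longrightarrow> g \<in> formal_sums d \<Longrightarrow> (\<lambda>j. h j + g j) \<in> formal_sums d"
  and formal_sums_scaleC: "h \<in> formal_sums d \<Longrightarrow> (\<lambda>j. c *\<^sub>C h j) \<in> formal_sums d"
  by (auto simp: formal_sums_def scaleC.zero_right)

lemma cls_eq_sum: assumes "h \<in> formal_sums d" shows "cls h = (\<Sum>j\<le>d. x_gen (h j) j)"
proof -
  have "cls (\<lambda>i. if i \<le> m then h i else 0) = (\<Sum>j\<le>m. x_gen (h j) j)" if "m \<le> d" for m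
    using that
  proof (induction m)
    case 0
    have "(\<lambda>i. if i \<le> 0 then h i else 0) = (\<lambda>i. if i = 0 then h 0 else 0)" by auto
    then show ?case by (simp add: gen_def)
  next
    case (Suc m)
    have "(\<lambda>i. if i \<le> Suc m then h i else 0) = (\<lambda>i. (if i \<le> m then h i else 0) + (if i = Suc m then h (Suc m) else 0))"
      by (rule ext) auto
    moreover have "(\<lambda>i. if i \<le> m then h i else 0) \<in> formal_sums d" "(\<lambda>i. if i = Suc m then h (Suc m) else 0) \<in> formal_sums d"
      using Suc.prems by (auto simp: formal_sums_def)
    ultimately show ?case using Suc cls_add by (simp add: gen_def)
  qed
  moreover have "(\<lambda>i. if i \<le> d then h i else 0) = h" using assms by (auto simp: formal_sums_def)
  ultimately show ?thesis by (metis order_refl)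
qed

lemma csubspace_cls: "csubspace (cls ` formal_sums d)"
proof -
  have "0 \<in> cls ` formal_sums d"
  proof (rule image_eqI)
    show z: "(\<lambda>j. 0) \<in> formal_sums d" by (simp add: formal_sums_def)
    show "0 = cls (\<lambda>j. 0)" using cls_scaleC[OF z, of 0] by (simp add: scaleC.zero_right scaleC.zero_left)
  qed
  then show ?thesis
    by (auto simp: csubspace_def cls_add[symmetric] cls_scaleC[symmetric] formal_sums_add formal_sums_scaleC)
qed

lemma dense_pair_induct:
  assumes "closed {p :: 'k \<times> 'k. Q (fst p) (snd p)}" "\<And>h g. h \<in> formal_sums d \<Longrightarrow> g \<in> formal_sums d \<Longrightarrow> Q (cls h) (cls g)"
  shows "Q x y"
proof -
  let ?V = "cls ` formal_sums d"
  have "closure (?V \<times> ?V) \<subseteq> {p. Q (fst p) (snd p)}" using assms by (intro closure_minimal) auto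
  moreover have "(x, y) \<in> closure (?V \<times> ?V)" by (simp add: closure_Times cls_dense)
  ultimately show ?thesis by auto
qed

lemma operator_eqI:
  assumes T: "bounded_clinear T" and T': "bounded_clinear T'"
    and eq: "\<And>h g. h \<in> formal_sums d \<Longrightarrow> g \<in> formal_sums d \<Longrightarrow> cinner (T (cls h)) (cls g) = cinner (T' (cls h)) (cls g)"
  shows "T = T'"
proof
  fix x
  have c: "continuous_on UNIV T" "continuous_on UNIV T'" using T T' by (auto intro: bounded_clinear_continuous)
  have "cinner (T x) y = cinner (T' x) y" for y
  proof (rule dense_pair_induct[where Q="\<lambda>x y. cinner (T x) y = cinner (T' x) y"])
    show "closed {p. cinner (T (fst p)) (snd p) = cinner (T' (fst p)) (snd p)}"
      by (intro closed_Collect_eq cinner.continuous_on continuous_on_compose2[OF c(1)] continuous_on_compose2[OF c(2)] continuous_intros) auto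
  qed (rule eq)
  then show "T x = T' x" by (rule cinner_ext_left)
qed

lemma operator_eqI_gen:
  assumes T: "bounded_clinear T" and T': "bounded_clinear T'"
    and eq: "\<And>j k h g. j \<le> d \<Longrightarrow> k \<le> d \<Longrightarrow> cinner (T (x_gen h j)) (x_gen g k) = cinner (T' (x_gen h j)) (x_gen g k)"
  shows "T = T'"
proof (rule operator_eqI[OF T T'])
  fix h g :: "nat \<Rightarrow> 'h" assume "h \<in> formal_sums d" "g \<in> formal_sums d"
  then show "cinner (T (cls h)) (cls g) = cinner (T' (cls h)) (cls g)"
    using T T' eq by (simp add: cls_eq_sum bounded_clinear_sum cinner.sum_left cinner.sum_right)
qed

text \<open>The adjoint of T inverts A on R, since A is isometric and the values of the parameter
  are orthogonal to R. This provides the recursion in the second argument of the resolvent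
  form.\<close>

lemma ext_op_cinner_A:
  assumes \<phi>: "\<phi> \<in> contractions N N'" and u: "u \<in> D"
  shows "cinner (ext_op \<phi> y) (A u) = cinner y u"
proof -
  have "cinner (\<phi> (y - P y)) (A u) = 0"
    using param_in[OF \<phi> P_diff[of y]] A_in_R[OF u] by (auto simp: ocompl_def)
  moreover have "cinner (y - P y) u = 0" using P_diff[of y] u by (auto simp: ocompl_def)
  ultimately show ?thesis by (simp add: ext_op_def cinner.add_left A_cinner[OF P_in u] cinner.diff_left)
qed

lemma resolvent_form_gen_right:
  assumes \<phi>: "\<phi> \<in> contractions N N'" and z: "cmod z < 1" and k: "k < d"
  shows "cinner (resolvent (ext_op \<phi>) z x) (x_gen g (Suc k)) = cinner x (x_gen g (Suc k)) + z * cinner (resolvent (ext_op \<phi>) z x) (x_gen g k)"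
proof -
  let ?R = "resolvent (ext_op \<phi>) z x"
  have "cinner (ext_op \<phi> ?R) (x_gen g (Suc k)) = cinner ?R (x_gen g k)"
    using ext_op_cinner_A[OF \<phi> gen_in_D(1)[OF k]] gen_in_D(2)[OF k] by metis
  moreover have "cinner ?R (x_gen g (Suc k)) = cinner (x + z *\<^sub>C ext_op \<phi> ?R) (x_gen g (Suc k))"
    using resolvent_rec[OF contraction_ext_op[OF \<phi>] z, of x] by (rule arg_cong)
  ultimately show ?thesis by (simp add: cinner.add_left cinner_scaleC_left)
qed

text \<open>The forms are given for indices (0, 0). Raising the left index divides by z, hence z is
  nonzero; raising the right index only multiplies by z. The classes are dense, so the resolvents
  agree, and T is recovered from 1 - z T after another division by z.\<close>

lemma transform_determines_param:
  assumes \<phi>: "\<phi> \<in> contractions N N'" and \<psi>: "\<psi> \<in> contractions N N'" and z: "cmod z < 1" "z \<noteq> 0"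
    and eq: "\<And>h g. cinner (resolvent (ext_op \<phi>) z (opI cls h)) (opI cls g) = cinner (resolvent (ext_op \<psi>) z (opI cls h)) (opI cls g)"
  shows "ext_op \<phi> = ext_op \<psi>"
proof -
  note C = contraction_ext_op[OF \<phi>] contraction_ext_op[OF \<psi>]
  let ?R = "resolvent (ext_op \<phi>) z" and ?R' = "resolvent (ext_op \<psi>) z"
  have left: "cinner (?R (x_gen h j)) (x_gen g 0) = cinner (?R' (x_gen h j)) (x_gen g 0)" if "j \<le> d" for j h g
    using that
  proof (induction j)
    case 0
    then show ?case using eq[of h g] by (simp add: opI_def)
  next
    case (Suc j)
    then have j: "j < d" by simp
    have "z * cinner (?R (x_gen h (Suc j))) (x_gen g 0) = z * cinner (?R' (x_gen h (Suc j))) (x_gen g 0)"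
      using Suc.IH j resolvent_generators[OF C(1) ext_op_D[OF \<phi>] z(1) j, of h] resolvent_generators[OF C(2) ext_op_D[OF \<psi>] z(1) j, of h]
      by (simp add: cinner.add_left cinner_scaleC_left)
    then show ?case using z(2) by simp
  qed
  have "cinner (?R (x_gen h j)) (x_gen g k) = cinner (?R' (x_gen h j)) (x_gen g k)" if "j \<le> d" "k \<le> d" for j k h g
    using that(2)
  proof (induction k)
    case (Suc k)
    then show ?case by (simp add: resolvent_form_gen_right[OF \<phi> z(1)] resolvent_form_gen_right[OF \<psi> z(1)])
  qed (rule left[OF that(1)])
  then have R: "?R = ?R'"
    by (intro operator_eqI_gen bounded_clinear_resolvent C z(1))
  show ?thesis
  proof
    fix v
    have "?R (v - z *\<^sub>C ext_op \<phi> v) = v" by (rule resolvent_eqI[OF C(1) z(1) refl])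
    then have "v - z *\<^sub>C ext_op \<psi> v = v - z *\<^sub>C ext_op \<phi> v"
      using resolvent_eq[OF C(2) z(1), of "v - z *\<^sub>C ext_op \<phi> v"] by (simp add: R)
    then have "inverse z *\<^sub>C (z *\<^sub>C ext_op \<psi> v) = inverse z *\<^sub>C (z *\<^sub>C ext_op \<phi> v)" by simp
    then show "ext_op \<phi> v = ext_op \<psi> v" using z(2) by (simp add: scaleC_scaleC)
  qed
qed

text \<open>At z = 0 the resolvent is the identity and does not show the parameter; strong
  continuity, a consequence of differentiability, supplies its value there.\<close>

lemma schur_eqI:
  assumes \<Phi>: "\<Phi> \<in> schur_class N N'" and \<Psi>: "\<Psi> \<in> schur_class N N'"
    and eq: "\<And>z. cmod z < 1 \<Longrightarrow> z \<noteq> 0 \<Longrightarrow> ext_op (\<Phi> z) = ext_op (\<Psi> z)"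
  shows "\<Phi> = \<Psi>"
proof -
  have lim: "((\<lambda>w. ext_op (\<Phi> w) u) \<longlongrightarrow> ext_op (\<Phi> 0) u) (at 0)" if \<Phi>: "\<Phi> \<in> schur_class N N'" for \<Phi> u
  proof -
    obtain t where t: "((\<lambda>w. inverse (w - 0) *\<^sub>C (ext_op (\<Phi> w) u - ext_op (\<Phi> 0) u)) \<longlongrightarrow> t) (at 0)"
      using schur_quotient_limit[OF \<Phi>, of 0 u] by auto
    have "((\<lambda>w. w *\<^sub>C (inverse (w - 0) *\<^sub>C (ext_op (\<Phi> w) u - ext_op (\<Phi> 0) u))) \<longlongrightarrow> 0 *\<^sub>C t) (at 0)"
      by (intro scaleC.tendsto tendsto_ident_at t)
    moreover have "\<forall>\<^sub>F w in at 0. w *\<^sub>C (inverse (w - 0) *\<^sub>C (ext_op (\<Phi> w) u - ext_op (\<Phi> 0) u)) = ext_op (\<Phi> w) u - ext_op (\<Phi> 0) u"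
      by (simp add: eventually_at_filter scaleC_scaleC)
    ultimately have "((\<lambda>w. ext_op (\<Phi> w) u - ext_op (\<Phi> 0) u) \<longlongrightarrow> 0) (at 0)"
      by (auto intro: Lim_transform_eventually simp: scaleC.zero_left)
    then show ?thesis by (simp add: LIM_zero_iff)
  qed
  have all: "ext_op (\<Phi> z) u = ext_op (\<Psi> z) u" if z: "cmod z < 1" for z u
  proof (cases "z = 0")
    case True
    have "\<forall>\<^sub>F w in at (0::complex). cmod w < 1"
      using order_tendstoD(2)[OF tendsto_norm[OF tendsto_ident_at], of "0::complex" 1] by simp
    moreover have "\<forall>\<^sub>F w in at (0::complex). w \<noteq> 0" by (simp add: eventually_at_filter)
    ultimately have "\<forall>\<^sub>F w in at 0. ext_op (\<Phi> w) u = ext_op (\<Psi> w) u" by eventually_elim (simp add: eq)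
    from Lim_transform_eventually[OF lim[OF \<Phi>] this] have "((\<lambda>w. ext_op (\<Psi> w) u) \<longlongrightarrow> ext_op (\<Phi> 0) u) (at 0)" .
    then have "ext_op (\<Phi> 0) u = ext_op (\<Psi> 0) u" using lim[OF \<Psi>] by (rule tendsto_unique[OF at_neq_bot])
    then show ?thesis by (simp add: True)
  qed (simp add: eq z)
  show ?thesis
  proof (rule PiE_ext)
    show "\<Phi> \<in> ball 0 1 \<rightarrow>\<^sub>E contractions N N'" "\<Psi> \<in> ball 0 1 \<rightarrow>\<^sub>E contractions N N'"
      using \<Phi> \<Psi> by (auto simp: schur_class_def)
    fix z :: complex assume "z \<in> ball 0 1"
    then have z: "cmod z < 1" by simp
    note c = schur_contraction[OF \<Phi> z] schur_contraction[OF \<Psi> z]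
    show "\<Phi> z = \<Psi> z"
    proof (rule PiE_ext)
      show "\<Phi> z \<in> N \<rightarrow>\<^sub>E N'" "\<Psi> z \<in> N \<rightarrow>\<^sub>E N'" using c by (auto simp: contractions_def)
      show "\<Phi> z x = \<Psi> z x" if "x \<in> N" for x
        using all[OF z, of x] that by (simp add: ext_op_N[OF c(1)] ext_op_N[OF c(2)])
    qed
  qed
qed

theorem parameter_unique:
  assumes \<Phi>: "\<Phi> \<in> schur_class N N'" "nevanlinna_relation d S cls \<Phi> F"
    and \<Psi>: "\<Psi> \<in> schur_class N N'" "nevanlinna_relation d S cls \<Psi> F"
  shows "\<Phi> = \<Psi>"
proof (rule schur_eqI[OF \<Phi>(1) \<Psi>(1)])
  fix z :: complex assume z: "cmod z < 1" "z \<noteq> 0"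
  have "(\<lambda>h. 2 *\<^sub>C cadjoint (opI cls) (resolvent (ext_op (\<Phi> z)) z (opI cls h)) - S 0 h)
    = (\<lambda>h. 2 *\<^sub>C cadjoint (opI cls) (resolvent (ext_op (\<Psi> z)) z (opI cls h)) - S 0 h)"
    using \<Phi> \<Psi> z by (intro has_rs_integral_unique[of 0 "2 * pi" "herglotz_kernel z" F]) (auto simp: nevanlinna_relation_iff)
  then have "transform_form \<Phi> z h g = transform_form \<Psi> z h g" for h g
    unfolding cinner_transform[symmetric] by (rule fun_cong[THEN arg_cong])
  then show "ext_op (\<Phi> z) = ext_op (\<Psi> z)"
    using \<Phi>(1) \<Psi>(1) z by (intro transform_determines_param schur_contraction) (simp_all add: transform_form_def)
qed

end

section \<open>Multiplication operators compressed to the moment space\<close>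

locale moment_solution = moment_space d S cls
  for d :: nat and S :: "nat \<Rightarrow> 'h::chilbert_space \<Rightarrow> 'h" and cls :: "(nat \<Rightarrow> 'h) \<Rightarrow> 'k::chilbert_space" +
  fixes F :: "real \<Rightarrow> 'h \<Rightarrow> 'h"
  assumes sol: "F \<in> solutions d S"
begin

lemma dist: "distribution_fun 0 (2 * pi) F"
  and moments: "n \<le> d \<Longrightarrow> has_rs_integral (\<lambda>t. circ_exp t ^ n) F 0 (2 * pi) (S n)"
  using sol by (auto simp: solutions_iff)

abbreviation "cont_circ f \<equiv> continuous_on {0..2 * pi} (f :: real \<Rightarrow> complex)"

lemma cont_powi: "cont_circ f \<Longrightarrow> cont_circ (\<lambda>t. f t * circ_exp t powi n)"
  by (intro continuous_intros continuous_circ_exp_powi)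

text \<open>\<open>wform f h g\<close> is the integral of \<open>f(t) (dF(t) h(t), g(t))\<close> for the trigonometric polynomials
  \<open>h(t)\<close>, \<open>g(t)\<close> with coefficients \<open>h\<close>, \<open>g\<close>.\<close>

definition wform :: "(real \<Rightarrow> complex) \<Rightarrow> (nat \<Rightarrow> 'h) \<Rightarrow> (nat \<Rightarrow> 'h) \<Rightarrow> complex"
  where "wform f h g =
    (\<Sum>j\<le>d. \<Sum>k\<le>d. cinner (rs_int F (\<lambda>t. f t * circ_exp t powi (int j - int k)) (h j)) (g k))"

definition vpoly :: "(nat \<Rightarrow> 'h) \<Rightarrow> real \<Rightarrow> 'h"
  where "vpoly h t = (\<Sum>j\<le>d. circ_exp t ^ j *\<^sub>C h j)"

text \<open>A Riemann sum in which the polynomials are frozen at the tag together with f. Each term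
  is f(t) times the non-negative form of an increment of F at two vectors, so pointwise inequalities
  apply to it.\<close>

definition wsum :: "(real \<Rightarrow> complex) \<Rightarrow> (nat \<Rightarrow> 'h) \<Rightarrow> (nat \<Rightarrow> 'h) \<Rightarrow> (real \<times> real set) set \<Rightarrow> complex"
  where "wsum f h g p = (\<Sum>(t, K)\<in>p. f t * cinner (F (Sup K) (vpoly h t) - F (Inf K) (vpoly h t)) (vpoly g t))"

lemma increment_vpoly:
  assumes "u \<in> {0..2 * pi}" "v \<in> {0..2 * pi}"
  shows "cinner (F v (vpoly h t) - F u (vpoly h t)) (vpoly g t) =
    (\<Sum>j\<le>d. \<Sum>k\<le>d. circ_exp t powi (int j - int k) * cinner (F v (h j) - F u (h j)) (g k))"
proof -
  note b = distribution_clinear[OF dist assms(1)] distribution_clinear[OF dist assms(2)]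
  have e: "circ_exp t ^ j * cnj (circ_exp t) ^ k = circ_exp t powi (int j - int k)" for j k
    by (simp add: circ_exp_reflect(3) power_int_diff power_inverse divide_inverse)
  have "F v (vpoly h t) - F u (vpoly h t) = (\<Sum>j\<le>d. circ_exp t ^ j *\<^sub>C (F v (h j) - F u (h j)))"
    by (simp add: vpoly_def bounded_clinear_sum[OF b(1)] bounded_clinear_sum[OF b(2)] bounded_clinear_scaleC[OF b(1)]
        bounded_clinear_scaleC[OF b(2)] scaleC.diff_right sum_subtractf)
  then have "cinner (F v (vpoly h t) - F u (vpoly h t)) (vpoly g t) =
      (\<Sum>j\<le>d. cinner (circ_exp t ^ j *\<^sub>C (F v (h j) - F u (h j))) (vpoly g t))"
    by (simp only: cinner.sum_left)
  also have "\<dots> = (\<Sum>j\<le>d. \<Sum>k\<le>d. circ_exp t powi (int j - int k) * cinner (F v (h j) - F u (h j)) (g k))"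
    unfolding vpoly_def cinner.sum_right
    by (intro sum.cong refl) (simp add: cinner_scaleC_left cinner_scaleC_right e[symmetric] mult_ac)
  finally show ?thesis .
qed

lemma tagged_division_endpoints:
  assumes "p tagged_division_of {0..2 * pi}" "(t, K) \<in> p"
  shows "0 \<le> Inf K" "Inf K \<le> Sup K" "Sup K \<le> 2 * pi" "t \<in> {0..2 * pi}"
proof -
  note dv = tagged_division_ofD[OF assms(1)]
  obtain u v where K: "K = {u..v}" using dv(4)[OF assms(2)] by auto
  have "t \<in> K" "K \<subseteq> {0..2 * pi}" using dv(2,3)[OF assms(2)] by auto
  then show "0 \<le> Inf K" "Inf K \<le> Sup K" "Sup K \<le> 2 * pi" "t \<in> {0..2 * pi}" using K by auto
qed

text \<open>Expanding both polynomials at the tag leaves finitely many ordinary Riemann sums, with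
  integrands f(t) e^(i(j-k)t).\<close>

lemma wsum_tendsto:
  assumes f: "cont_circ f"
  shows "(wsum f h g \<longlongrightarrow> wform f h g) (rs_filter 0 (2 * pi))"
proof -
  let ?e = "\<lambda>j k t. circ_exp t powi (int j - int k)"
  have "((\<lambda>p. \<Sum>j\<le>d. \<Sum>k\<le>d. \<Sum>(t, K)\<in>p. (f t * ?e j k t) * cinner (F (Sup K) (h j) - F (Inf K) (h j)) (g k))
    \<longlongrightarrow> wform f h g) (rs_filter 0 (2 * pi))"
    unfolding wform_def
    by (intro tendsto_sum has_rs_integral_form rs_int_props(1)[OF dist] cont_powi f)
  moreover have "\<forall>\<^sub>F p in rs_filter 0 (2 * pi).
      (\<Sum>j\<le>d. \<Sum>k\<le>d. \<Sum>(t, K)\<in>p. (f t * ?e j k t) * cinner (F (Sup K) (h j) - F (Inf K) (h j)) (g k)) = wsum f h g p"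
    using eventually_rs_filter_division
  proof eventually_elim
    case (elim p)
    have "wsum f h g p = (\<Sum>(t, K)\<in>p. \<Sum>j\<le>d. \<Sum>k\<le>d. (f t * ?e j k t) * cinner (F (Sup K) (h j) - F (Inf K) (h j)) (g k))"
      unfolding wsum_def
    proof (rule sum.cong[OF refl])
      fix x assume "x \<in> p"
      moreover obtain t K where x: "x = (t, K)" by (cases x)
      ultimately have "(t, K) \<in> p" by simp
      note e = tagged_division_endpoints[OF elim this]
      then have "Inf K \<in> {0..2 * pi}" "Sup K \<in> {0..2 * pi}" unfolding atLeastAtMost_iff by linarith+
      then have "f t * cinner (F (Sup K) (vpoly h t) - F (Inf K) (vpoly h t)) (vpoly g t) =
        (\<Sum>j\<le>d. \<Sum>k\<le>d. (f t * ?e j k t) * cinner (F (Sup K) (h j) - F (Inf K) (h j)) (g k))"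
        by (simp only: increment_vpoly sum_distrib_left mult.assoc)
      then show "(case x of (t, K) \<Rightarrow> f t * cinner (F (Sup K) (vpoly h t) - F (Inf K) (vpoly h t)) (vpoly g t)) =
        (case x of (t, K) \<Rightarrow> \<Sum>j\<le>d. \<Sum>k\<le>d. (f t * ?e j k t) * cinner (F (Sup K) (h j) - F (Inf K) (h j)) (g k))"
        by (simp only: x prod.case)
    qed
    also have "\<dots> = (\<Sum>j\<le>d. \<Sum>(t, K)\<in>p. \<Sum>k\<le>d. (f t * ?e j k t) * cinner (F (Sup K) (h j) - F (Inf K) (h j)) (g k))"
      unfolding case_prod_unfold by (rule sum.swap)
    also have "\<dots> = (\<Sum>j\<le>d. \<Sum>k\<le>d. \<Sum>(t, K)\<in>p. (f t * ?e j k t) * cinner (F (Sup K) (h j) - F (Inf K) (h j)) (g k))"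
      unfolding case_prod_unfold by (intro sum.cong refl sum.swap)
    finally show ?case by simp
  qed
  ultimately show ?thesis by (rule Lim_transform_eventually)
qed

text \<open>Increments of F are non-negative forms, so an inequality valid at each t for all such
  forms can be summed over a division and passed to the limit.\<close>

lemma wform_dominated:
  assumes f: "cont_circ f" and u: "cont_circ u" and v: "cont_circ v"
    and dom: "\<And>t B a b. t \<in> {0..2 * pi} \<Longrightarrow> psd B \<Longrightarrow> cmod (f t * B a (b :: 'h)) \<le> Re (u t * B a a) + Re (v t * B b b)"
  shows "cmod (wform f h g) \<le> Re (wform u h h) + Re (wform v g g)"
proof (rule tendsto_le[OF rs_filter_nonbot])
  show "((\<lambda>p. Re (wsum u h h p) + Re (wsum v g g p)) \<longlongrightarrow> Re (wform u h h) + Re (wform v g g)) (rs_filter 0 (2 * pi))"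
    by (intro tendsto_intros wsum_tendsto u v)
  show "((\<lambda>p. cmod (wsum f h g p)) \<longlongrightarrow> cmod (wform f h g)) (rs_filter 0 (2 * pi))"
    by (intro tendsto_intros wsum_tendsto f)
  show "\<forall>\<^sub>F p in rs_filter 0 (2 * pi). cmod (wsum f h g p) \<le> Re (wsum u h h p) + Re (wsum v g g p)"
    using eventually_rs_filter_division
  proof eventually_elim
    case (elim p)
    have "cmod (wsum f h g p) \<le> (\<Sum>(t, K)\<in>p. Re (u t * cinner (F (Sup K) (vpoly h t) - F (Inf K) (vpoly h t)) (vpoly h t))
        + Re (v t * cinner (F (Sup K) (vpoly g t) - F (Inf K) (vpoly g t)) (vpoly g t)))"
      unfolding wsum_def case_prod_unfold
    proof (rule sum_norm_le)
      fix x assume "x \<in> p"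
      then have x: "(fst x, snd x) \<in> p" by simp
      note e = tagged_division_endpoints[OF elim x]
      have "psd (\<lambda>h g. cinner (F (Sup (snd x)) h - F (Inf (snd x)) h) g)"
        using mono_formsD[OF distribution_mono_forms[OF dist] e(1-3)] by (simp add: cinner.diff_left)
      from dom[OF e(4) this]
      show "cmod (f (fst x) * cinner (F (Sup (snd x)) (vpoly h (fst x)) - F (Inf (snd x)) (vpoly h (fst x))) (vpoly g (fst x)))
        \<le> Re (u (fst x) * cinner (F (Sup (snd x)) (vpoly h (fst x)) - F (Inf (snd x)) (vpoly h (fst x))) (vpoly h (fst x)))
        + Re (v (fst x) * cinner (F (Sup (snd x)) (vpoly g (fst x)) - F (Inf (snd x)) (vpoly g (fst x))) (vpoly g (fst x)))" .
    qed
    also have "\<dots> = Re (wsum u h h p) + Re (wsum v g g p)"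
      by (simp only: wsum_def case_prod_unfold sum.distrib Re_sum)
    finally show ?case .
  qed
qed simp

lemma rs_int_moment:
  assumes "j \<le> d" "k \<le> d"
  shows "cinner (rs_int F (\<lambda>t. circ_exp t powi (int j - int k)) h) g = cinner (moment_op S (int j - int k) h) g"
proof -
  have m: "rs_int F (\<lambda>t. circ_exp t powi int n) = S n" if "n \<le> d" for n
    using rs_int_eqI[OF moments[OF that]] by simp
  show ?thesis
  proof (cases "k \<le> j")
    case True
    then have e: "int j - int k = int (j - k)" by simp
    have le: "j - k \<le> d" using assms by simp
    show ?thesis unfolding e m[OF le] by (simp add: moment_op_def)
  next
    case False
    define n where "n = k - j"
    have n: "int j - int k = - int n" "n \<le> d" "0 < n" using False assms by (auto simp: n_def)
    have "cinner (rs_int F (\<lambda>t. circ_exp t powi (- int n)) h) g = cnj (cinner (S n g) h)"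
      unfolding rs_int_powi_neg[OF dist] m[OF n(2)] ..
    also have "\<dots> = cnj (cinner g (cadjoint (S n) h))" by (simp add: cadjoint_cinner[OF S[OF n(2)]])
    also have "\<dots> = cinner (cadjoint (S n) h) g" by (rule cinner_commute[symmetric])
    finally show ?thesis using n by (simp add: moment_op_def)
  qed
qed

lemma wform_one: "h \<in> formal_sums d \<Longrightarrow> g \<in> formal_sums d \<Longrightarrow> wform (\<lambda>t. 1) h g = cinner (cls h) (cls g)"
  by (simp add: wform_def cls_cinner moment_form_def rs_int_moment)

lemma wform_const: "h \<in> formal_sums d \<Longrightarrow> g \<in> formal_sums d \<Longrightarrow> wform (\<lambda>t. c) h g = c * cinner (cls h) (cls g)"
proof -
  assume "h \<in> formal_sums d" "g \<in> formal_sums d"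
  moreover have "wform (\<lambda>t. c) h g = c * wform (\<lambda>t. 1) h g"
    by (simp add: wform_def rs_int_mult[OF dist continuous_circ_exp_powi] cinner_scaleC_left sum_distrib_left)
  ultimately show ?thesis by (simp add: wform_one)
qed

text \<open>Domination with the constant weights c s / 2 and c / (2 s), optimised over s. It bounds
  the compression of multiplication by f by any bound c of |f|.\<close>

lemma wform_bound:
  assumes f: "cont_circ f" and c: "\<And>t. t \<in> {0..2 * pi} \<Longrightarrow> cmod (f t) \<le> c"
    and h: "h \<in> formal_sums d" and g: "g \<in> formal_sums d"
  shows "cmod (wform f h g) \<le> c * norm (cls h) * norm (cls g)"
proof (rule scaled_amgm_optimise)
  show c0: "0 \<le> c" using order_trans[OF norm_ge_zero c[of 0]] by simp
  fix s :: real assume s: "0 < s"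
  have "cmod (wform f h g) \<le> Re (wform (\<lambda>t. of_real (c / 2 * s)) h h) + Re (wform (\<lambda>t. of_real (c / 2 / s)) g g)"
  proof (rule wform_dominated[OF f])
    fix t :: real and B :: "'h \<Rightarrow> 'h \<Rightarrow> complex" and a b assume t: "t \<in> {0..2 * pi}" and B: "psd B"
    have "cmod (f t) * cmod (B a b) \<le> c * ((s * Re (B a a) + Re (B b b) / s) / 2)"
      using c[OF t] c0 by (intro mult_mono psd_amgm_scaled[OF B s]) auto
    then show "cmod (f t * B a b) \<le> Re (of_real (c / 2 * s) * B a a) + Re (of_real (c / 2 / s) * B b b)"
      by (simp only: norm_mult Re_complex_of_real Im_complex_of_real times_complex.sel) (simp add: field_simps)
  qed auto
  then show "cmod (wform f h g) \<le> c / 2 * (s * (norm (cls h))\<^sup>2 + (norm (cls g))\<^sup>2 / s)"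
    using s by (simp add: wform_const h g cinner_self field_simps flip: of_real_power)
qed simp_all

lemma wform_add_left: "cont_circ f \<Longrightarrow> wform f (\<lambda>j. h j + h' j) g = wform f h g + wform f h' g"
  by (simp add: wform_def bounded_clinear_add[OF rs_int_props(2)[OF dist cont_powi]] cinner.add_left sum.distrib)

lemma wform_add_right: "wform f h (\<lambda>j. g j + g' j) = wform f h g + wform f h g'"
  by (simp add: wform_def cinner.add_right sum.distrib)

lemma wform_scaleC_left: "cont_circ f \<Longrightarrow> wform f (\<lambda>j. c *\<^sub>C h j) g = c * wform f h g"
  by (simp add: wform_def bounded_clinear_scaleC[OF rs_int_props(2)[OF dist cont_powi]] cinner_scaleC_left sum_distrib_left)

lemma wform_scaleC_right: "wform f h (\<lambda>j. c *\<^sub>C g j) = cnj c * wform f h g"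
  by (simp add: wform_def cinner_scaleC_right sum_distrib_left)

text \<open>The bound by the norms of the classes annihilates a difference of two representatives,
  so the form descends to classes.\<close>

lemma wform_cls_cong:
  assumes f: "cont_circ f" and hg: "h \<in> formal_sums d" "h' \<in> formal_sums d" "g \<in> formal_sums d" "g' \<in> formal_sums d"
    and eq: "cls h = cls h'" "cls g = cls g'"
  shows "wform f h g = wform f h' g'"
proof -
  obtain c where c: "\<And>t. t \<in> {0..2 * pi} \<Longrightarrow> cmod (f t) \<le> c" using continuous_bounded_Icc[OF f] by blast
  have m: "(\<lambda>j. (- 1) *\<^sub>C k j) \<in> formal_sums d" if "k \<in> formal_sums d" for k by (rule formal_sums_scaleC[OF that])
  have "cls (\<lambda>j. h j + (- 1) *\<^sub>C h' j) = 0"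
    by (simp only: cls_add[OF hg(1) m[OF hg(2)]] cls_scaleC[OF hg(2)] eq) (simp add: scaleC_minus_one)
  then have "cmod (wform f (\<lambda>j. h j + (- 1) *\<^sub>C h' j) g) \<le> 0"
    using wform_bound[OF f c formal_sums_add[OF hg(1) m[OF hg(2)]] hg(3)] by simp
  then have 1: "wform f h g = wform f h' g" by (simp only: wform_add_left[OF f] wform_scaleC_left[OF f]) simp
  have "cls (\<lambda>j. g j + (- 1) *\<^sub>C g' j) = 0"
    by (simp only: cls_add[OF hg(3) m[OF hg(4)]] cls_scaleC[OF hg(4)] eq) (simp add: scaleC_minus_one)
  then have "cmod (wform f h' (\<lambda>j. g j + (- 1) *\<^sub>C g' j)) \<le> 0"
    using wform_bound[OF f c hg(2) formal_sums_add[OF hg(3) m[OF hg(4)]]] by simp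
  then have "wform f h' g = wform f h' g'" by (simp only: wform_add_right wform_scaleC_right) simp
  with 1 show ?thesis by simp
qed

lemma mom_op_exists:
  assumes f: "cont_circ f" and c: "\<And>t. t \<in> {0..2 * pi} \<Longrightarrow> cmod (f t) \<le> c"
  shows "\<exists>T. bounded_clinear T \<and> (\<forall>h\<in>formal_sums d. \<forall>g\<in>formal_sums d. cinner (T (cls h)) (cls g) = wform f h g)
    \<and> (\<forall>x. norm (T x) \<le> c * norm x)"
proof -
  let ?V = "cls ` formal_sums d"
  \<comment> \<open>The chosen representatives need not be linear in x; \<open>radd\<close> and
    \<open>rsc\<close> give linearity up to equality of classes, which the form does not
    distinguish.\<close>
  define rep where "rep x = (SOME h. h \<in> formal_sums d \<and> cls h = x)" for x
  have rep: "rep x \<in> formal_sums d" "cls (rep x) = x" if "x \<in> ?V" for x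
    using someI_ex[of "\<lambda>h. h \<in> formal_sums d \<and> cls h = x"] that unfolding rep_def by blast+
  note V = csubspace_add[OF csubspace_cls] csubspace_scaleC[OF csubspace_cls]
  have radd: "cls (rep (x + y)) = cls (\<lambda>j. rep x j + rep y j)" if "x \<in> ?V" "y \<in> ?V" for x y
    using cls_add[OF rep(1)[OF that(1)] rep(1)[OF that(2)]] rep(2)[OF V(1)[OF that]] rep(2)[OF that(1)] rep(2)[OF that(2)] by simp
  have rsc: "cls (rep (a *\<^sub>C x)) = cls (\<lambda>j. a *\<^sub>C rep x j)" if "x \<in> ?V" for a x
    using cls_scaleC[OF rep(1)[OF that]] rep(2)[OF V(2)[OF that]] rep(2)[OF that] by simp
  have c0: "0 \<le> c" using order_trans[OF norm_ge_zero c[of 0]] by simp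
  have "\<exists>T. bounded_clinear T \<and> (\<forall>x\<in>?V. \<forall>y\<in>?V. cinner (T x) y = wform f (rep x) (rep y)) \<and> (\<forall>x. norm (T x) \<le> c * norm x)"
  proof (rule form_operator_dense[OF csubspace_cls cls_dense])
    show "wform f (rep (x + y)) (rep z) = wform f (rep x) (rep z) + wform f (rep y) (rep z)" if "x \<in> ?V" "y \<in> ?V" "z \<in> ?V" for x y z
      unfolding wform_add_left[OF f, symmetric]
      by (intro wform_cls_cong[OF f] rep(1) formal_sums_add V radd refl that)
    show "wform f (rep x) (rep (y + z)) = wform f (rep x) (rep y) + wform f (rep x) (rep z)" if "x \<in> ?V" "y \<in> ?V" "z \<in> ?V" for x y z
      unfolding wform_add_right[symmetric]
      by (intro wform_cls_cong[OF f] rep(1) formal_sums_add V radd refl that)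
    show "wform f (rep (a *\<^sub>C x)) (rep y) = a * wform f (rep x) (rep y)" if "x \<in> ?V" "y \<in> ?V" for a x y
      unfolding wform_scaleC_left[OF f, symmetric]
      by (intro wform_cls_cong[OF f] rep(1) formal_sums_scaleC V rsc refl that)
    show "wform f (rep x) (rep (a *\<^sub>C y)) = cnj a * wform f (rep x) (rep y)" if "x \<in> ?V" "y \<in> ?V" for a x y
      unfolding wform_scaleC_right[symmetric]
      by (intro wform_cls_cong[OF f] rep(1) formal_sums_scaleC V rsc refl that)
    show "cmod (wform f (rep x) (rep y)) \<le> c * norm x * norm y" if "x \<in> ?V" "y \<in> ?V" for x y
      using wform_bound[OF f c rep(1)[OF that(1)] rep(1)[OF that(2)]] that by (simp add: rep)
  qed (rule c0)
  then obtain T where T: "bounded_clinear T" "\<And>x y. x \<in> ?V \<Longrightarrow> y \<in> ?V \<Longrightarrow> cinner (T x) y = wform f (rep x) (rep y)"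
    "\<And>x. norm (T x) \<le> c * norm x" by blast
  have "cinner (T (cls h)) (cls g) = wform f h g" if "h \<in> formal_sums d" "g \<in> formal_sums d" for h g
  proof -
    have "cls h \<in> ?V" "cls g \<in> ?V" using that by auto
    then show ?thesis
      unfolding T(2)[OF \<open>cls h \<in> ?V\<close> \<open>cls g \<in> ?V\<close>] using that by (intro wform_cls_cong[OF f] rep)
  qed
  then show ?thesis using T(1,3) by blast
qed

section \<open>The compressed multiplication operators\<close>

definition mom_op :: "(real \<Rightarrow> complex) \<Rightarrow> 'k \<Rightarrow> 'k"
  where "mom_op f = (SOME T. bounded_clinear T \<and>
    (\<forall>h\<in>formal_sums d. \<forall>g\<in>formal_sums d. cinner (T (cls h)) (cls g) = wform f h g))"

lemma mom_op:
  assumes f: "cont_circ f"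
  shows "bounded_clinear (mom_op f)"
    "h \<in> formal_sums d \<Longrightarrow> g \<in> formal_sums d \<Longrightarrow> cinner (mom_op f (cls h)) (cls g) = wform f h g"
proof -
  obtain c where c: "\<And>t. t \<in> {0..2 * pi} \<Longrightarrow> cmod (f t) \<le> c" using continuous_bounded_Icc[OF f] by blast
  have "\<exists>T. bounded_clinear T \<and> (\<forall>h\<in>formal_sums d. \<forall>g\<in>formal_sums d. cinner (T (cls h)) (cls g) = wform f h g)"
    using mom_op_exists[OF f c] by blast
  from someI_ex[OF this] show "bounded_clinear (mom_op f)"
    "h \<in> formal_sums d \<Longrightarrow> g \<in> formal_sums d \<Longrightarrow> cinner (mom_op f (cls h)) (cls g) = wform f h g"
    unfolding mom_op_def by blast+
qed

lemma mom_op_eqI: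
  assumes "cont_circ f" "bounded_clinear T"
    "\<And>h g. h \<in> formal_sums d \<Longrightarrow> g \<in> formal_sums d \<Longrightarrow> cinner (T (cls h)) (cls g) = wform f h g"
  shows "mom_op f = T"
  by (rule operator_eqI[OF mom_op(1)[OF assms(1)] assms(2)]) (simp add: mom_op(2)[OF assms(1)] assms(3))

lemma norm_mom_op:
  assumes f: "cont_circ f" and c: "\<And>t. t \<in> {0..2 * pi} \<Longrightarrow> cmod (f t) \<le> c"
  shows "norm (mom_op f x) \<le> c * norm x"
proof -
  obtain T where "bounded_clinear T" "\<And>h g. h \<in> formal_sums d \<Longrightarrow> g \<in> formal_sums d \<Longrightarrow> cinner (T (cls h)) (cls g) = wform f h g"
    "\<And>x. norm (T x) \<le> c * norm x" using mom_op_exists[OF f c] by blast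
  then show ?thesis using mom_op_eqI[OF f] by metis
qed

lemma mom_op_one: "mom_op (\<lambda>t. 1) x = x"
proof -
  have "bounded_clinear (\<lambda>x::'k. x)" by (rule bounded_clinearI[of _ 1]) auto
  then have "mom_op (\<lambda>t. 1) = (\<lambda>x. x)" by (intro mom_op_eqI) (simp_all add: wform_one)
  then show ?thesis by simp
qed

lemma bounded_clinear_plus: "bounded_clinear T \<Longrightarrow> bounded_clinear T' \<Longrightarrow> bounded_clinear (\<lambda>x. T x + T' x)"
  by (simp add: bounded_clinear_def bounded_linear_add scaleC_add_right)

lemma bounded_clinear_times: "bounded_clinear T \<Longrightarrow> bounded_clinear (\<lambda>x. c *\<^sub>C T x)"
proof -
  assume T: "bounded_clinear T"
  obtain K where K: "\<And>x. norm (T x) \<le> norm x * K" using bounded_clinear_bound[OF T] by metis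
  show ?thesis
  proof (rule bounded_clinearI[of _ "cmod c * K"])
    show "norm (c *\<^sub>C T x) \<le> norm x * (cmod c * K)" for x
      using mult_left_mono[OF K[of x], of "cmod c"] by (simp add: mult_ac)
  qed (use T in \<open>auto simp: bounded_clinear_add bounded_clinear_scaleC scaleC_add_right scaleC_scaleC mult.commute\<close>)
qed

lemma mom_op_add:
  assumes f: "cont_circ f" and g: "cont_circ g"
  shows "mom_op (\<lambda>t. f t + g t) x = mom_op f x + mom_op g x"
proof -
  have "wform (\<lambda>t. f t + g t) h k = wform f h k + wform g h k" for h k
    by (simp add: wform_def distrib_right rs_int_add[OF dist cont_powi[OF f] cont_powi[OF g]] cinner.add_left sum.distrib)
  then have "mom_op (\<lambda>t. f t + g t) = (\<lambda>x. mom_op f x + mom_op g x)"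
    by (intro mom_op_eqI bounded_clinear_plus mom_op(1) f g continuous_on_add)
      (simp add: mom_op(2)[OF f] mom_op(2)[OF g] cinner.add_left)
  then show ?thesis by simp
qed

lemma mom_op_mult:
  assumes f: "cont_circ f"
  shows "mom_op (\<lambda>t. c * f t) x = c *\<^sub>C mom_op f x"
proof -
  have "wform (\<lambda>t. c * f t) h k = c * wform f h k" for h k
    by (simp add: wform_def mult.assoc rs_int_mult[OF dist cont_powi[OF f]] cinner_scaleC_left sum_distrib_left)
  then have "mom_op (\<lambda>t. c * f t) = (\<lambda>x. c *\<^sub>C mom_op f x)"
    by (intro mom_op_eqI bounded_clinear_times mom_op(1) f continuous_on_mult continuous_on_const)
      (simp add: mom_op(2)[OF f] cinner_scaleC_left)
  then show ?thesis by simp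
qed

lemma mom_op_diff:
  assumes f: "cont_circ f" and g: "cont_circ g"
  shows "mom_op (\<lambda>t. f t - g t) x = mom_op f x - mom_op g x"
proof -
  have "cont_circ (\<lambda>t. (- 1) * g t)" by (intro continuous_intros g)
  from mom_op_add[OF f this, of x] show ?thesis by (simp only: mom_op_mult[OF g]) (simp add: scaleC_minus_one)
qed

lemma cinner_mom_op_gen:
  assumes f: "cont_circ f" and j: "j \<le> d" and k: "k \<le> d"
  shows "cinner (mom_op f (x_gen h j)) (x_gen g k) = cinner (rs_int F (\<lambda>t. f t * circ_exp t powi (int j - int k)) h) g"
proof -
  have "cinner (mom_op f (x_gen h j)) (x_gen g k) = wform f (\<lambda>i. if i = j then h else 0) (\<lambda>i. if i = k then g else 0)"
    unfolding gen_def by (rule mom_op(2)[OF f single_formal[OF j] single_formal[OF k]])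
  also have "\<dots> = (\<Sum>a\<le>d. \<Sum>b\<le>d. if a = j then if b = k then cinner (rs_int F (\<lambda>t. f t * circ_exp t powi (int j - int k)) h) g else 0 else 0)"
    unfolding wform_def
    by (intro sum.cong refl) (simp add: bounded_clinear_0[OF rs_int_props(2)[OF dist cont_powi[OF f]]] cinner.zero_left cinner.zero_right)
  also have "\<dots> = (\<Sum>a\<le>d. if a = j then \<Sum>b\<le>d. if b = k then cinner (rs_int F (\<lambda>t. f t * circ_exp t powi (int j - int k)) h) g else 0 else 0)"
    by (intro sum.cong refl) simp
  also have "\<dots> = cinner (rs_int F (\<lambda>t. f t * circ_exp t powi (int j - int k)) h) g" using j k by simp
  finally show ?thesis .
qed

text \<open>The case of multiplicativity that survives compression: a factor e is absorbed by
  raising the index of a generator, as long as the index stays at most d.\<close>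

lemma mom_op_gen_Suc:
  assumes f: "cont_circ f" and j: "j < d"
  shows "mom_op f (x_gen h (Suc j)) = mom_op (\<lambda>t. f t * circ_exp t) (x_gen h j)"
proof -
  have fe: "cont_circ (\<lambda>t. f t * circ_exp t)" by (intro continuous_intros f continuous_circ_exp)
  have e: "f t * circ_exp t powi (int (Suc j) - int k) = f t * circ_exp t * circ_exp t powi (int j - int k)" for t k
  proof -
    have "int (Suc j) - int k = 1 + (int j - int k)" by simp
    then show ?thesis by (simp only: power_int_add circ_exp_nonzero simp_thms power_int_1_right mult.assoc)
  qed
  have gens: "cinner (mom_op f (x_gen h (Suc j))) (x_gen g k) = cinner (mom_op (\<lambda>t. f t * circ_exp t) (x_gen h j)) (x_gen g k)"
    if "k \<le> d" for g k
    using j that by (simp only: cinner_mom_op_gen[OF f] cinner_mom_op_gen[OF fe] Suc_leI less_imp_le e)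
  have "cinner x (mom_op f (x_gen h (Suc j))) = cinner x (mom_op (\<lambda>t. f t * circ_exp t) (x_gen h j))"
    if x: "x \<in> cls ` formal_sums d" for x
  proof -
    obtain g where g: "g \<in> formal_sums d" "x = cls g" using x by blast
    have "cinner (mom_op f (x_gen h (Suc j))) (cls g) = cinner (mom_op (\<lambda>t. f t * circ_exp t) (x_gen h j)) (cls g)"
      by (simp add: cls_eq_sum[OF g(1)] cinner.sum_right gens)
    then show ?thesis unfolding g(2) by (metis cinner_commute)
  qed
  then show ?thesis by (intro cinner_closure_eq[OF _ _ csubspace_cls]) (auto simp: cls_dense)
qed

lemma mom_op_cnj:
  assumes f: "cont_circ f"
  shows "cinner (mom_op (\<lambda>t. cnj (f t)) x) y = cnj (cinner (mom_op f y) x)"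
proof (rule dense_pair_induct[where Q="\<lambda>x y. cinner (mom_op (\<lambda>t. cnj (f t)) x) y = cnj (cinner (mom_op f y) x)"])
  have cf: "cont_circ (\<lambda>t. cnj (f t))" by (intro continuous_intros f)
  have c: "continuous_on UNIV (mom_op f)" "continuous_on UNIV (mom_op (\<lambda>t. cnj (f t)))"
    using mom_op(1)[OF f] mom_op(1)[OF cf] by (auto intro: bounded_clinear_continuous)
  show "closed {p. cinner (mom_op (\<lambda>t. cnj (f t)) (fst p)) (snd p) = cnj (cinner (mom_op f (snd p)) (fst p))}"
    by (intro closed_Collect_eq continuous_on_cnj cinner.continuous_on continuous_on_compose2[OF c(1)]
        continuous_on_compose2[OF c(2)] continuous_intros) auto
  fix h g :: "nat \<Rightarrow> 'h" assume hg: "h \<in> formal_sums d" "g \<in> formal_sums d"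
  have "cinner (rs_int F (\<lambda>t. cnj (f t) * circ_exp t powi (int j - int k)) a) b =
      cnj (cinner (rs_int F (\<lambda>t. f t * circ_exp t powi (int k - int j)) b) a)" for j k a b
  proof -
    have "(\<lambda>t. cnj (f t) * circ_exp t powi (int j - int k)) = (\<lambda>t. cnj (f t * circ_exp t powi (int k - int j)))"
      using power_int_minus[of "circ_exp _" "int k - int j"] by (simp add: circ_exp_reflect(3) power_int_inverse)
    then show ?thesis by (simp only: rs_int_cnj[OF dist cont_powi[OF f]])
  qed
  then have "wform (\<lambda>t. cnj (f t)) h g = cnj (wform f g h)"
    unfolding wform_def cnj_sum by (subst sum.swap) simp
  then show "cinner (mom_op (\<lambda>t. cnj (f t)) (cls h)) (cls g) = cnj (cinner (mom_op f (cls g)) (cls h))"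
    by (simp add: mom_op(2)[OF f] mom_op(2)[OF cf] hg)
qed

text \<open>For a compression W of multiplication operators this is the inequality between the
  square |W_f|^2 and W_{|f|^2}. The domination behind it compares B(f a, b) with half of B(f a, f a)
  + B(b, b).\<close>

lemma mom_op_Schwarz:
  assumes f: "cont_circ f"
  shows "(norm (mom_op f x))\<^sup>2 \<le> Re (cinner (mom_op (\<lambda>t. of_real ((cmod (f t))\<^sup>2)) x) x)"
proof -
  let ?u = "\<lambda>t. of_real ((cmod (f t))\<^sup>2) :: complex"
  have u: "cont_circ ?u" by (intro continuous_intros f)
  have c: "continuous_on UNIV (mom_op f)" "continuous_on UNIV (mom_op ?u)"
    using mom_op(1)[OF f] mom_op(1)[OF u] by (auto intro: bounded_clinear_continuous)
  have "cmod (cinner (mom_op f x) y) \<le> (Re (cinner (mom_op ?u x) x) + (norm y)\<^sup>2) / 2" for y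
  proof (rule dense_pair_induct[where Q="\<lambda>x y. cmod (cinner (mom_op f x) y) \<le> (Re (cinner (mom_op ?u x) x) + (norm y)\<^sup>2) / 2"])
    show "closed {p. cmod (cinner (mom_op f (fst p)) (snd p)) \<le> (Re (cinner (mom_op ?u (fst p)) (fst p)) + (norm (snd p))\<^sup>2) / 2}"
      by (intro closed_Collect_le cinner.continuous_on continuous_on_compose2[OF c(1)]
          continuous_on_compose2[OF c(2)] continuous_intros) auto
    fix h g :: "nat \<Rightarrow> 'h" assume hg: "h \<in> formal_sums d" "g \<in> formal_sums d"
    have "cmod (wform f h g) \<le> Re (wform (\<lambda>t. 1/2 * ?u t) h h) + Re (wform (\<lambda>t. 1/2) g g)"
    proof (rule wform_dominated[OF f])
      show "cont_circ (\<lambda>t. 1/2 * ?u t)" by (intro continuous_intros f)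
      fix t :: real and B :: "'h \<Rightarrow> 'h \<Rightarrow> complex" and a b assume B: "psd B"
      note s = sesqD[OF psd_sesq[OF B]]
      have "f t * cnj (f t) = ?u t" by (simp add: complex_norm_square[symmetric])
      then have BB: "B (f t *\<^sub>C a) (f t *\<^sub>C a) = ?u t * B a a"
        by (simp add: s mult.assoc[symmetric] mult.commute[of "cnj (f t)"])
      then show "cmod (f t * B a b) \<le> Re (1/2 * ?u t * B a a) + Re (1/2 * B b b)"
        using psd_amgm[OF B, of "f t *\<^sub>C a" b] unfolding BB s(3) by (simp add: mult.assoc)
    qed auto
    moreover have wu: "wform (\<lambda>t. 1/2 * ?u t) h h = 1/2 * cinner (mom_op ?u (cls h)) (cls h)"
    proof -
      have "cont_circ (\<lambda>t. 1/2 * ?u t)" by (intro continuous_intros f)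
      from mom_op(2)[OF this hg(1) hg(1)] show ?thesis by (simp only: mom_op_mult[OF u] cinner_scaleC_left)
    qed
    moreover have "Re (1/2 * cinner (mom_op ?u (cls h)) (cls h)) = Re (cinner (mom_op ?u (cls h)) (cls h)) / 2" by simp
    moreover have "Re (wform (\<lambda>t. 1/2) g g) = (norm (cls g))\<^sup>2 / 2"
      by (simp add: wform_const hg cinner_self flip: of_real_power)
    ultimately show "cmod (cinner (mom_op f (cls h)) (cls g)) \<le> (Re (cinner (mom_op ?u (cls h)) (cls h)) + (norm (cls g))\<^sup>2) / 2"
      unfolding mom_op(2)[OF f hg] wu by argo
  qed
  \<comment> \<open>At y = W_f x the left-hand side is |y|^2, which absorbs the |y|^2 / 2 on the
    right.\<close>
  from this[of "mom_op f x"] show ?thesis by (simp add: cinner_self norm_power)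
qed

end

section \<open>The parameter of a solution\<close>

context moment_solution
begin

definition rker :: "complex \<Rightarrow> real \<Rightarrow> complex"
  where "rker z t = 1 / (1 - z * circ_exp t)"

definition qker :: "complex \<Rightarrow> real \<Rightarrow> complex"
  where "qker z t = circ_exp t / (1 - z * circ_exp t)"

definition Rop :: "complex \<Rightarrow> 'k \<Rightarrow> 'k"
  where "Rop z = mom_op (rker z)"

definition Qop :: "complex \<Rightarrow> 'k \<Rightarrow> 'k"
  where "Qop z = mom_op (qker z)"

text \<open>With \<open>W f\<close> the compression of multiplication by \<open>f\<close>, the operator \<open>R\<close> plays the part of
  \<open>(1 - z T)\<^sup>-\<^sup>1\<close>, which forces \<open>T = Q R\<^sup>-\<^sup>1\<close>.\<close>

definition Top :: "complex \<Rightarrow> 'k \<Rightarrow> 'k"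
  where "Top z x = Qop z (inv (Rop z) x)"

section \<open>The contraction attached to a solution at a fixed z\<close>

lemma norm_kernels:
  assumes "cmod z < 1" shows "cmod (rker z t) \<le> 1 / (1 - cmod z)" "cmod (qker z t) \<le> 1 / (1 - cmod z)"
  using one_minus_circ_exp_bound(1)[OF assms, of t] assms
  by (auto simp: rker_def qker_def norm_divide intro!: divide_left_mono mult_pos_pos)

context
  fixes z :: complex
  assumes z: "cmod z < 1"
begin

lemma cont_kernels: "cont_circ (rker z)" "cont_circ (qker z)"
  unfolding rker_def[abs_def] qker_def[abs_def]
  using one_minus_circ_exp_bound(2)[OF z] by (intro continuous_intros continuous_circ_exp; auto)+

lemma clinear_kernels: "bounded_clinear (Rop z)" "bounded_clinear (Qop z)"
  unfolding Rop_def Qop_def by (rule mom_op(1)[OF cont_kernels(1)], rule mom_op(1)[OF cont_kernels(2)])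

lemma Rop_eq: "Rop z x = x + z *\<^sub>C Qop z x"
proof -
  have "rker z = (\<lambda>t. 1 + z * qker z t)"
    using one_minus_circ_exp_bound(2)[OF z] by (auto simp: rker_def qker_def field_simps)
  moreover have "cont_circ (\<lambda>t. z * qker z t)" by (intro continuous_intros cont_kernels)
  ultimately have "Rop z x = mom_op (\<lambda>t. 1) x + mom_op (\<lambda>t. z * qker z t) x"
    unfolding Rop_def by (simp only: mom_op_add[OF continuous_on_const])
  then show ?thesis by (simp only: mom_op_one mom_op_mult[OF cont_kernels(2)] Qop_def)
qed

text \<open>With w = z e the kernel identity is 1/(1 - w) + 1/(1 - cnj w) - 1 = (1 - |w|^2) / |1 -
  w|^2, the Poisson kernel, where |w| = |z|.\<close>

lemma Re_Rop: "2 * Re (cinner (Rop z x) x) - (norm x)\<^sup>2 = (1 - (cmod z)\<^sup>2) * Re (cinner (mom_op (\<lambda>t. of_real ((cmod (qker z t))\<^sup>2)) x) x)"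
proof -
  let ?u = "\<lambda>t. of_real ((cmod (qker z t))\<^sup>2) :: complex"
  have u: "cont_circ ?u" by (intro continuous_intros cont_kernels)
  have cr: "cont_circ (\<lambda>t. cnj (rker z t))" by (intro continuous_intros cont_kernels)
  have "rker z t + cnj (rker z t) - 1 = of_real (1 - (cmod z)\<^sup>2) * ?u t" for t
  proof -
    define w where "w = z * circ_exp t"
    have w: "1 - w \<noteq> 0" "1 - cnj w \<noteq> 0"
      using one_minus_circ_exp_bound(2)[OF z, of t] complex_cnj_cancel_iff[of "1 - w" 0] by (auto simp: w_def)
    have zw: "z * cnj z = w * cnj w"
      by (simp add: w_def circ_exp_reflect(3))
    have "qker z t * cnj (qker z t) = 1 / ((1 - w) * (1 - cnj w))"
      by (simp add: qker_def w_def circ_exp_reflect(3))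
    then have "of_real (1 - (cmod z)\<^sup>2) * ?u t = (1 - w * cnj w) * (1 / ((1 - w) * (1 - cnj w)))"
      by (simp only: of_real_diff of_real_1 complex_norm_square zw)
    also have "\<dots> = 1 / (1 - w) + 1 / (1 - cnj w) - 1"
      using w by (simp add: divide_simps) (simp add: algebra_simps)
    finally show ?thesis by (simp add: rker_def w_def)
  qed
  then have "(\<lambda>t. rker z t + cnj (rker z t) - 1) = (\<lambda>t. of_real (1 - (cmod z)\<^sup>2) * ?u t)" by (rule ext)
  then have "mom_op (\<lambda>t. rker z t + cnj (rker z t) - 1) x = of_real (1 - (cmod z)\<^sup>2) *\<^sub>C mom_op ?u x"
    by (simp only: mom_op_mult[OF u])
  moreover have "mom_op (\<lambda>t. rker z t + cnj (rker z t) - 1) x = Rop z x + mom_op (\<lambda>t. cnj (rker z t)) x - x"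
    using cont_kernels cr
    by (simp add: mom_op_diff mom_op_add mom_op_one Rop_def continuous_on_add)
  ultimately have "cinner (Rop z x + mom_op (\<lambda>t. cnj (rker z t)) x - x) x = of_real (1 - (cmod z)\<^sup>2) * cinner (mom_op ?u x) x"
    by (simp only: cinner_scaleC_left)
  moreover have "cinner (mom_op (\<lambda>t. cnj (rker z t)) x) x = cnj (cinner (Rop z x) x)"
    using mom_op_cnj[OF cont_kernels(1)] by (simp only: Rop_def)
  ultimately have "cinner (Rop z x) x + cnj (cinner (Rop z x) x) - cinner x x = of_real (1 - (cmod z)\<^sup>2) * cinner (mom_op ?u x) x"
    by (simp only: cinner.add_left cinner.diff_left)
  from arg_cong[OF this, of Re]
  have "Re (cinner (Rop z x) x) + Re (cinner (Rop z x) x) - Re (cinner x x) = (1 - (cmod z)\<^sup>2) * Re (cinner (mom_op ?u x) x)"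
    by (simp only: minus_complex.sel plus_complex.sel cnj.sel times_complex.sel Re_complex_of_real Im_complex_of_real mult_zero_left diff_zero)
  moreover have "Re (cinner x x) = (norm x)\<^sup>2" by (simp add: cinner_self flip: of_real_power)
  ultimately show ?thesis by linarith
qed

text \<open>From R = 1 + z Q it follows that |R x|^2 - |z|^2 |Q x|^2 = 2 Re (R x, x) - |x|^2, and
  the right-hand side is at least (1 - |z|^2) |Q x|^2.\<close>

lemma norm_Qop_le: "norm (Qop z x) \<le> norm (Rop z x)"
proof -
  have z2: "0 \<le> 1 - (cmod z)\<^sup>2" using z by (simp add: power_le_one)
  have "(1 - (cmod z)\<^sup>2) * (norm (Qop z x))\<^sup>2 \<le> 2 * Re (cinner (Rop z x) x) - (norm x)\<^sup>2"
    unfolding Re_Rop Qop_def using z2 by (intro mult_left_mono mom_op_Schwarz cont_kernels)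
  moreover have "(norm (Rop z x))\<^sup>2 = (norm x)\<^sup>2 + 2 * Re (cinner x (z *\<^sub>C Qop z x)) + (cmod z)\<^sup>2 * (norm (Qop z x))\<^sup>2"
    unfolding Rop_eq[of x] by (simp add: norm_add_cinner power_mult_distrib)
  moreover have "Re (cinner (Rop z x) x) = (norm x)\<^sup>2 + Re (cinner x (z *\<^sub>C Qop z x))"
  proof -
    have "cinner (Rop z x) x = cinner x x + cnj (cinner x (z *\<^sub>C Qop z x))"
      unfolding Rop_eq[of x] cinner.add_left by (metis cinner_commute)
    then show ?thesis by (simp add: cinner_self flip: of_real_power)
  qed
  ultimately have "(norm (Qop z x))\<^sup>2 \<le> (norm (Rop z x))\<^sup>2" by (simp add: left_diff_distrib)
  then show ?thesis by (rule power2_le_imp_le) simp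
qed

lemma norm_square_le_Rop: "(norm x)\<^sup>2 \<le> 2 * Re (cinner (Rop z x) x)"
proof -
  have "0 \<le> (1 - (cmod z)\<^sup>2) * Re (cinner (mom_op (\<lambda>t. of_real ((cmod (qker z t))\<^sup>2)) x) x)"
    using z mom_op_Schwarz[OF cont_kernels(2), of x] order_trans[OF zero_le_power2]
    by (intro mult_nonneg_nonneg) (auto simp: power_le_one)
  then show ?thesis using Re_Rop[of x] by simp
qed

lemma norm_le_Rop: "norm x \<le> 2 * norm (Rop z x)"
proof -
  have "(norm x)\<^sup>2 \<le> 2 * Re (cinner (Rop z x) x)" by (rule norm_square_le_Rop)
  also have "\<dots> \<le> 2 * (norm (Rop z x) * norm x)" using Re_cinner_le[of "Rop z x" x] by simp
  finally have "norm x * norm x \<le> (2 * norm (Rop z x)) * norm x" by (simp add: power2_eq_square)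
  then show ?thesis by (cases "x = 0") auto
qed

text \<open>The Lax-Milgram argument: coercivity bounds R below, so R is injective with closed
  range, and a vector orthogonal to the range is orthogonal to its own image, hence zero.\<close>

lemma bij_Rop: "bij (Rop z)"
  unfolding bij_def
proof
  show "inj (Rop z)"
  proof (rule injI)
    fix x y assume "Rop z x = Rop z y"
    then show "x = y" using norm_le_Rop[of "x - y"] by (simp add: bounded_clinear_diff[OF clinear_kernels(1)])
  qed
  let ?K = "range (Rop z)"
  have K: "csubspace ?K"
    unfolding csubspace_def
  proof (intro conjI ballI allI)
    show "0 \<in> ?K" by (rule range_eqI[of _ _ 0]) (simp add: bounded_clinear_0[OF clinear_kernels(1)])
    show "x + y \<in> ?K" if "x \<in> ?K" "y \<in> ?K" for x y
      using that by (auto simp: bounded_clinear_add[OF clinear_kernels(1), symmetric])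
    show "c *\<^sub>C x \<in> ?K" if "x \<in> ?K" for c x
      using that by (auto simp: bounded_clinear_scaleC[OF clinear_kernels(1), symmetric])
  qed
  have "complete (Rop z ` UNIV)"
  proof (rule complete_isometric_image[where e="1/2"])
    show "bounded_linear (Rop z)" using clinear_kernels(1) by (simp add: bounded_clinear_def)
    show "\<forall>x\<in>UNIV. 1 / 2 * norm x \<le> norm (Rop z x)"
    proof
      fix x show "1 / 2 * norm x \<le> norm (Rop z x)" using norm_le_Rop[of x] by simp
    qed
  qed (auto simp: complete_UNIV)
  then have Kc: "closed ?K" by (rule complete_imp_closed)
  have "y \<in> ?K" for y
  proof -
    define w where "w = y - oproj ?K y"
    have "w \<in> ocompl ?K" unfolding w_def by (rule oproj_diff[OF K Kc])
    then have "cinner w (Rop z w) = 0" by (auto simp: ocompl_def)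
    then have "cinner (Rop z w) w = 0" by (simp add: cinner_eq_zero_commute)
    then have "w = 0" using norm_square_le_Rop[of w] by simp
    then show ?thesis using oproj_in[OF K Kc, of y] by (simp add: w_def)
  qed
  then show "surj (Rop z)" by blast
qed

lemma Rop_inv: "Rop z (inv (Rop z) x) = x" and inv_Rop: "inv (Rop z) (Rop z x) = x"
  using bij_Rop by (auto simp: bij_def surj_f_inv_f)

lemma Top_Rop: "Top z (Rop z x) = Qop z x"
  by (simp add: Top_def inv_Rop)

lemma contraction_Top: "contraction (Top z)"
proof (rule contractionI)
  have add: "inv (Rop z) (x + y) = inv (Rop z) x + inv (Rop z) y" for x y
    using inv_Rop[of "inv (Rop z) x + inv (Rop z) y"] by (simp add: bounded_clinear_add[OF clinear_kernels(1)] Rop_inv)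
  have scale: "inv (Rop z) (c *\<^sub>C x) = c *\<^sub>C inv (Rop z) x" for c x
    using inv_Rop[of "c *\<^sub>C inv (Rop z) x"] by (simp add: bounded_clinear_scaleC[OF clinear_kernels(1)] Rop_inv)
  show "Top z (x + y) = Top z x + Top z y" for x y
    by (simp add: Top_def add bounded_clinear_add[OF clinear_kernels(2)])
  show "Top z (c *\<^sub>C x) = c *\<^sub>C Top z x" for c x
    by (simp add: Top_def scale bounded_clinear_scaleC[OF clinear_kernels(2)])
  show "norm (Top z x) \<le> norm x" for x
    using norm_Qop_le[of "inv (Rop z) x"] by (simp add: Top_def Rop_inv)
qed

lemma resolvent_Top: "resolvent (Top z) z x = Rop z x"
proof (rule resolvent_eqI[OF contraction_Top z])
  show "Rop z x - z *\<^sub>C Top z (Rop z x) = x" unfolding Top_Rop using Rop_eq[of x] by simp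
qed

text \<open>The vector is (1 - z A) x_{h,j}. Trading the raised index for a factor e produces the
  multiplier 1 - z e, which cancels the denominators of the kernels.\<close>

lemma mom_op_cancel:
  assumes f: "cont_circ f" and g: "\<And>t. f t * (1 - z * circ_exp t) = g t" and j: "j < d"
  shows "mom_op f (x_gen h j - z *\<^sub>C x_gen h (Suc j)) = mom_op g (x_gen h j)"
proof -
  have fe: "cont_circ (\<lambda>t. f t * circ_exp t)" "cont_circ (\<lambda>t. z * (f t * circ_exp t))"
    by (intro continuous_intros f continuous_circ_exp)+
  have "g = (\<lambda>t. f t - z * (f t * circ_exp t))" by (rule ext) (simp add: g[symmetric] algebra_simps)
  then have "mom_op g (x_gen h j) = mom_op f (x_gen h j) - z *\<^sub>C mom_op (\<lambda>t. f t * circ_exp t) (x_gen h j)"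
    by (simp only: mom_op_diff[OF f fe(2)] mom_op_mult[OF fe(1)])
  also have "\<dots> = mom_op f (x_gen h j) - z *\<^sub>C mom_op f (x_gen h (Suc j))"
    by (simp only: mom_op_gen_Suc[OF f j])
  also have "\<dots> = mom_op f (x_gen h j - z *\<^sub>C x_gen h (Suc j))"
    by (simp add: bounded_clinear_diff[OF mom_op(1)[OF f]] bounded_clinear_scaleC[OF mom_op(1)[OF f]])
  finally show ?thesis by simp
qed

lemma Top_gen: assumes j: "j < d" shows "Top z (x_gen h j) = x_gen h (Suc j)"
proof -
  have nz: "1 - z * circ_exp t \<noteq> 0" for t by (rule one_minus_circ_exp_bound(2)[OF z])
  let ?u = "x_gen h j - z *\<^sub>C x_gen h (Suc j)"
  have "Rop z ?u = mom_op (\<lambda>t. 1) (x_gen h j)"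
    unfolding Rop_def by (rule mom_op_cancel[OF cont_kernels(1) _ j]) (use nz in \<open>simp add: rker_def\<close>)
  moreover have "Qop z ?u = mom_op circ_exp (x_gen h j)"
    unfolding Qop_def by (rule mom_op_cancel[OF cont_kernels(2) _ j]) (use nz in \<open>simp add: qker_def\<close>)
  moreover have "mom_op circ_exp (x_gen h j) = x_gen h (Suc j)"
    using mom_op_gen_Suc[OF continuous_on_const j, of 1 h] by (simp add: mom_op_one)
  ultimately show ?thesis using Top_Rop[of ?u] by (simp add: mom_op_one)
qed

lemma Top_D: assumes "x \<in> D" shows "Top z x = A x"
proof -
  have T: "bounded_clinear (Top z)" using contraction_Top by (simp add: contraction_def)
  have "closed {p. Top z (fst p) = snd p}"
    by (intro closed_Collect_eq continuous_on_compose2[OF bounded_clinear_continuous[OF T, of UNIV]] continuous_intros) auto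
  moreover have "pre_graph \<subseteq> {p. Top z (fst p) = snd p}"
    by (auto simp: pre_graph_def bounded_clinear_sum[OF T] Top_gen)
  ultimately have "shift_graph d cls \<subseteq> {p. Top z (fst p) = snd p}"
    unfolding shift_graph_closure by (rule closure_minimal[rotated])
  then show ?thesis using A_graph[OF assms] by auto
qed

text \<open>In \<open>\<Parallel>T (c n + x)\<Parallel> \<le> \<Parallel>c n + x\<Parallel>\<close> the cross term is of first order in \<open>c\<close> and the other
  terms that depend on \<open>c\<close> are of second order.\<close>

lemma Top_N: assumes n: "n \<in> N" shows "Top z n \<in> N'"
proof -
  have T: "bounded_clinear (Top z)" "\<And>x. norm (Top z x) \<le> norm x" using contraction_Top by (auto simp: contraction_def)
  have "cinner (Top z n) (A x) = 0" if x: "x \<in> D" for x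
  proof -
    define a where "a = cinner (Top z n) (A x)"
    define B where "B = (norm n)\<^sup>2"
    have "t * (2 * (cmod a)\<^sup>2) \<le> t * (t * ((cmod a)\<^sup>2 * B))" if t: "0 < t" for t :: real
    proof -
      let ?c = "of_real t * cnj a"
      have "cinner (?c *\<^sub>C n) x = 0" using n x by (auto simp: ocompl_def cinner_scaleC_left)
      then have nx: "(norm (?c *\<^sub>C n + x))\<^sup>2 = (norm (?c *\<^sub>C n))\<^sup>2 + (norm x)\<^sup>2" by (simp add: norm_add_cinner)
      have "Top z (?c *\<^sub>C n + x) = ?c *\<^sub>C Top z n + A x"
        by (simp add: bounded_clinear_add[OF T(1)] bounded_clinear_scaleC[OF T(1)] Top_D[OF x])
      then have "(norm (?c *\<^sub>C Top z n + A x))\<^sup>2 \<le> (norm (?c *\<^sub>C n + x))\<^sup>2"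
        using T(2)[of "?c *\<^sub>C n + x"] by (simp add: power_mono)
      moreover have "(norm (?c *\<^sub>C Top z n + A x))\<^sup>2 = (norm (?c *\<^sub>C Top z n))\<^sup>2 + 2 * Re (?c * a) + (norm x)\<^sup>2"
        by (simp only: norm_add_cinner cinner_scaleC_left a_def norm_A[OF x])
      ultimately have "(norm (?c *\<^sub>C Top z n))\<^sup>2 + 2 * Re (?c * a) + (norm x)\<^sup>2 \<le> (norm (?c *\<^sub>C n))\<^sup>2 + (norm x)\<^sup>2"
        unfolding nx by linarith
      moreover have "Re (?c * a) = t * (cmod a)\<^sup>2"
      proof -
        have "?c * a = of_real t * (a * cnj a)" by simp
        also have "\<dots> = of_real (t * (cmod a)\<^sup>2)" by (simp only: complex_norm_square[symmetric] of_real_mult)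
        finally show ?thesis by (simp only: Re_complex_of_real)
      qed
      moreover have "(norm (?c *\<^sub>C n))\<^sup>2 = t * (t * ((cmod a)\<^sup>2 * B))"
        by (simp add: norm_mult power_mult_distrib B_def) (simp add: power2_eq_square)
      moreover have "0 \<le> (norm (?c *\<^sub>C Top z n))\<^sup>2" by simp
      ultimately show ?thesis by linarith
    qed
    then have le: "2 * (cmod a)\<^sup>2 \<le> t * ((cmod a)\<^sup>2 * B)" if "0 < t" for t
      using that by (simp only: mult_le_cancel_left_pos)
    have B: "0 \<le> B" by (simp add: B_def)
    \<comment> \<open>The choice t = 1 / (B + 1) makes t B at most 1, so 2 |a|^2 <= |a|^2.\<close>
    have "1 / (B + 1) * ((cmod a)\<^sup>2 * B) \<le> (cmod a)\<^sup>2"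
    proof -
      have "(cmod a)\<^sup>2 * (B / (B + 1)) \<le> (cmod a)\<^sup>2 * 1" using B by (intro mult_left_mono) auto
      then show ?thesis by (simp add: mult.commute)
    qed
    moreover have "2 * (cmod a)\<^sup>2 \<le> 1 / (B + 1) * ((cmod a)\<^sup>2 * B)" by (rule le) (use B in simp)
    ultimately have "(cmod a)\<^sup>2 \<le> 0" by linarith
    then show "cinner (Top z n) (A x) = 0" by (simp add: a_def)
  qed
  then show ?thesis by (auto simp: ocompl_def elim!: R_obtains)
qed

lemma Top_contractions: "restrict (Top z) N \<in> contractions N N'"
  using contraction_Top csubspace_add[OF N_sub(1)] csubspace_scaleC[OF N_sub(1)]
  by (auto simp: contractions_def Top_N contraction_def bounded_clinear_add bounded_clinear_scaleC)

lemma ext_op_Top: "ext_op (restrict (Top z) N) = Top z"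
proof
  fix x
  have "Top z (P x) + Top z (x - P x) = Top z x"
    using contraction_Top by (simp add: contraction_def bounded_clinear_diff)
  then show "ext_op (restrict (Top z) N) x = Top z x"
    by (simp add: ext_op_def Top_D[OF P_in] P_diff)
qed

lemma transform_of_solution:
  "rs_int F (herglotz_kernel z) h = 2 *\<^sub>C cadjoint (opI cls) (Rop z (opI cls h)) - S 0 h"
proof (rule cinner_ext_left)
  fix g
  have "herglotz_kernel z = (\<lambda>t. 2 * rker z t - 1)"
    using one_minus_circ_exp_bound(2)[OF z] by (auto simp: herglotz_kernel_def rker_def field_simps)
  moreover have c: "cont_circ (\<lambda>t. 2 * rker z t)" by (intro continuous_intros cont_kernels)
  ultimately have "rs_int F (herglotz_kernel z) h = 2 *\<^sub>C rs_int F (rker z) h - rs_int F (\<lambda>t. 1) h"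
    by (simp only: rs_int_diff[OF dist c continuous_on_const] rs_int_mult[OF dist cont_kernels(1)])
  moreover have "cinner (rs_int F (\<lambda>t. 1) h) g = cinner (S 0 h) g"
    using rs_int_moment[of 0 0 h g] by (simp add: moment_op_def)
  moreover have "cinner (rs_int F (rker z) h) g = cinner (Rop z (opI cls h)) (opI cls g)"
    using cinner_mom_op_gen[OF cont_kernels(1), of 0 0 h g] by (simp add: Rop_def opI_def)
  ultimately show "cinner (rs_int F (herglotz_kernel z) h) g =
      cinner (2 *\<^sub>C cadjoint (opI cls) (Rop z (opI cls h)) - S 0 h) g"
    by (simp add: cinner.diff_left cinner_scaleC_left cadjoint_opI)
qed

end

section \<open>Analyticity of the parameter\<close>

lemma rker_diff: "cmod z < 1 \<Longrightarrow> cmod w < 1 \<Longrightarrow> rker w t - rker z t = (w - z) * (qker w t * rker z t)"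
  and qker_diff: "cmod z < 1 \<Longrightarrow> cmod w < 1 \<Longrightarrow> qker w t - qker z t = (w - z) * (qker w t * qker z t)"
  using one_minus_circ_exp_bound(2)[of z t] one_minus_circ_exp_bound(2)[of w t]
  by (auto simp: rker_def qker_def divide_simps) (auto simp: algebra_simps)

text \<open>Difference quotient of \<open>T\<close>: from \<open>T R = Q\<close> at both points,
  \<open>(T\<^sub>w - T\<^sub>z) R\<^sub>z = (Q\<^sub>w - Q\<^sub>z) - T\<^sub>w (R\<^sub>w - R\<^sub>z)\<close>.\<close>

definition Tquot :: "complex \<Rightarrow> complex \<Rightarrow> 'k \<Rightarrow> 'k"
  where "Tquot z w u = mom_op (\<lambda>t. qker w t * qker z t) u - Top w (mom_op (\<lambda>t. qker w t * rker z t) u)"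

context
  fixes z w :: complex
  assumes z: "cmod z < 1" and w: "cmod w < 1"
begin

lemma cont_products: "cont_circ (\<lambda>t. qker w t * qker z t)" "cont_circ (\<lambda>t. qker w t * rker z t)"
  by (intro continuous_on_mult cont_kernels z w)+

lemma Top_difference: "Top w (Rop z u) - Top z (Rop z u) = (w - z) *\<^sub>C Tquot z w u"
proof -
  have T: "bounded_clinear (Top w)" using contraction_Top[OF w] by (simp add: contraction_def)
  have q: "qker w = (\<lambda>t. qker z t + (w - z) * (qker w t * qker z t))"
    using qker_diff[OF z w] by (intro ext) (simp add: algebra_simps)
  have r: "rker w = (\<lambda>t. rker z t + (w - z) * (qker w t * rker z t))"
    using rker_diff[OF z w] by (intro ext) (simp add: algebra_simps)
  have c: "cont_circ (\<lambda>t. (w - z) * (qker w t * qker z t))" "cont_circ (\<lambda>t. (w - z) * (qker w t * rker z t))"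
    by (intro continuous_on_mult continuous_on_const cont_products)+
  have Q: "Qop w u = Qop z u + (w - z) *\<^sub>C mom_op (\<lambda>t. qker w t * qker z t) u"
    unfolding Qop_def by (subst q) (simp only: mom_op_add[OF cont_kernels(2)[OF z] c(1)] mom_op_mult[OF cont_products(1)])
  have R: "Rop w u = Rop z u + (w - z) *\<^sub>C mom_op (\<lambda>t. qker w t * rker z t) u"
    unfolding Rop_def by (subst r) (simp only: mom_op_add[OF cont_kernels(1)[OF z] c(2)] mom_op_mult[OF cont_products(2)])
  have "Top w (Rop w u) = Top w (Rop z u) + (w - z) *\<^sub>C Top w (mom_op (\<lambda>t. qker w t * rker z t) u)"
    unfolding R by (simp add: bounded_clinear_add[OF T] bounded_clinear_scaleC[OF T])
  then show ?thesis
    unfolding Top_Rop[OF w] Top_Rop[OF z] Q Tquot_def scaleC.diff_right by (simp add: algebra_simps)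
qed

lemma Top_difference': "Top w x - Top z x = (w - z) *\<^sub>C Tquot z w (inv (Rop z) x)"
  using Top_difference[of "inv (Rop z) x"] by (simp add: Rop_inv[OF z])

lemma norm_inv_Rop: "norm (inv (Rop z) x) \<le> 2 * norm x"
  using norm_le_Rop[OF z, of "inv (Rop z) x"] by (simp add: Rop_inv[OF z])

lemma norm_products:
  assumes m: "1 / (1 - cmod z) \<le> m" "1 / (1 - cmod w) \<le> m"
  shows "cmod (qker w t * qker z t) \<le> m * m" "cmod (qker w t * rker z t) \<le> m * m"
proof -
  have m0: "0 \<le> m" using m(1) z order_trans[of 0 "1 / (1 - cmod z)" m] by simp
  note b = order_trans[OF norm_kernels(1)[OF z] m(1)] order_trans[OF norm_kernels(2)[OF z] m(1)] order_trans[OF norm_kernels(2)[OF w] m(2)]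
  show "cmod (qker w t * qker z t) \<le> m * m" "cmod (qker w t * rker z t) \<le> m * m"
    unfolding norm_mult by (intro mult_mono b norm_ge_zero m0)+
qed

lemma norm_Tquot:
  assumes m: "1 / (1 - cmod z) \<le> m" "1 / (1 - cmod w) \<le> m"
  shows "norm (Tquot z w u) \<le> 2 * (m * m) * norm u"
proof -
  have "norm (Top w (mom_op (\<lambda>t. qker w t * rker z t) u)) \<le> norm (mom_op (\<lambda>t. qker w t * rker z t) u)"
    using contraction_Top[OF w] by (simp add: contraction_def)
  also have "\<dots> \<le> m * m * norm u" by (rule norm_mom_op[OF cont_products(2) norm_products(2)[OF m]])
  finally have "norm (Top w (mom_op (\<lambda>t. qker w t * rker z t) u)) \<le> m * m * norm u" .
  moreover have "norm (mom_op (\<lambda>t. qker w t * qker z t) u) \<le> m * m * norm u"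
    by (rule norm_mom_op[OF cont_products(1) norm_products(1)[OF m]])
  ultimately show ?thesis
    unfolding Tquot_def
    using norm_triangle_ineq4[of "mom_op (\<lambda>t. qker w t * qker z t) u" "Top w (mom_op (\<lambda>t. qker w t * rker z t) u)"] by simp
qed

lemma norm_Top_difference:
  assumes m: "1 / (1 - cmod z) \<le> m" "1 / (1 - cmod w) \<le> m"
  shows "norm (Top w x - Top z x) \<le> cmod (w - z) * (4 * (m * m) * norm x)"
proof -
  have "norm (Tquot z w (inv (Rop z) x)) \<le> 2 * (m * m) * norm (inv (Rop z) x)" by (rule norm_Tquot[OF m])
  also have "\<dots> \<le> 2 * (m * m) * (2 * norm x)" by (intro mult_left_mono norm_inv_Rop) simp
  finally show ?thesis unfolding Top_difference' norm_scaleC by (intro mult_left_mono) auto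
qed

text \<open>Decay linear in |w - z| with a constant independent of u, as differentiability in
  operator norm requires. The term 2 m^3 comes from the change of the two product kernels, the term
  4 m^4 from the change of T at a vector of norm at most m^2 |u|.\<close>

lemma norm_Tquot_difference:
  assumes m: "1 / (1 - cmod z) \<le> m" "1 / (1 - cmod w) \<le> m"
  shows "norm (Tquot z w u - Tquot z z u) \<le> cmod (w - z) * ((2 * (m * m * m) + 4 * (m * m * (m * m))) * norm u)"
proof -
  have m0: "0 \<le> m" using m(1) z order_trans[of 0 "1 / (1 - cmod z)" m] by simp
  have T: "bounded_clinear (Top w)" "\<And>x. norm (Top w x) \<le> norm x" using contraction_Top[OF w] by (auto simp: contraction_def)
  let ?f = "\<lambda>t. (qker w t * qker z t) * qker z t" and ?g = "\<lambda>t. (qker w t * qker z t) * rker z t"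
  have cz: "cont_circ (\<lambda>t. qker z t * qker z t)" "cont_circ (\<lambda>t. qker z t * rker z t)"
    by (intro continuous_on_mult cont_kernels z)+
  have cf: "cont_circ ?f" "cont_circ ?g" by (intro continuous_on_mult cont_kernels z w)+
  have bf: "cmod (?f t) \<le> m * m * m" "cmod (?g t) \<le> m * m * m" for t
    unfolding norm_mult[of "_ * _"]
    by (intro mult_mono norm_products[OF m] order_trans[OF norm_kernels(1)[OF z] m(1)] order_trans[OF norm_kernels(2)[OF z] m(1)] norm_ge_zero mult_nonneg_nonneg m0)+
  have c: "cont_circ (\<lambda>t. (w - z) * ?f t)" "cont_circ (\<lambda>t. (w - z) * ?g t)"
    by (intro continuous_on_mult continuous_on_const cf[unfolded mult.assoc] cf)+
  have q: "qker w t * X = qker z t * X + (w - z) * ((qker w t * qker z t) * X)" for t X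
  proof -
    have "qker w t = qker z t + (w - z) * (qker w t * qker z t)" using qker_diff[OF z w, of t] by (simp add: algebra_simps)
    then have "qker w t * X = (qker z t + (w - z) * (qker w t * qker z t)) * X" by (rule arg_cong)
    then show ?thesis by (simp only: distrib_right mult.assoc)
  qed
  have fg: "(\<lambda>t. qker w t * qker z t) = (\<lambda>t. qker z t * qker z t + (w - z) * ?f t)"
    "(\<lambda>t. qker w t * rker z t) = (\<lambda>t. qker z t * rker z t + (w - z) * ?g t)"
    by (rule ext, rule q)+
  have e: "mom_op (\<lambda>t. qker w t * qker z t) u = mom_op (\<lambda>t. qker z t * qker z t) u + (w - z) *\<^sub>C mom_op ?f u"
    "mom_op (\<lambda>t. qker w t * rker z t) u = mom_op (\<lambda>t. qker z t * rker z t) u + (w - z) *\<^sub>C mom_op ?g u"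
    using arg_cong[OF fg(1), of "\<lambda>f. mom_op f u"] arg_cong[OF fg(2), of "\<lambda>f. mom_op f u"]
    by (simp_all only: mom_op_add[OF cz(1) c(1)] mom_op_add[OF cz(2) c(2)] mom_op_mult[OF cf(1)] mom_op_mult[OF cf(2)])
  let ?v = "mom_op (\<lambda>t. qker z t * rker z t) u"
  have "Tquot z w u - Tquot z z u = (w - z) *\<^sub>C mom_op ?f u - (w - z) *\<^sub>C Top w (mom_op ?g u) - (Top w ?v - Top z ?v)"
    unfolding Tquot_def e by (simp add: bounded_clinear_add[OF T(1)] bounded_clinear_scaleC[OF T(1)])
  then have "norm (Tquot z w u - Tquot z z u) \<le> norm ((w - z) *\<^sub>C mom_op ?f u) + norm ((w - z) *\<^sub>C Top w (mom_op ?g u)) + norm (Top w ?v - Top z ?v)"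
    by (simp only: order_trans[OF norm_triangle_ineq4 add_right_mono[OF norm_triangle_ineq4]])
  also have "norm ((w - z) *\<^sub>C mom_op ?f u) \<le> cmod (w - z) * (m * m * m * norm u)"
    unfolding norm_scaleC by (intro mult_left_mono norm_mom_op[OF cf(1) bf(1)]) simp
  also have "norm ((w - z) *\<^sub>C Top w (mom_op ?g u)) \<le> cmod (w - z) * (m * m * m * norm u)"
    unfolding norm_scaleC by (intro mult_left_mono order_trans[OF T(2) norm_mom_op[OF cf(2) bf(2)]]) simp
  also have "norm (Top w ?v - Top z ?v) \<le> cmod (w - z) * (4 * (m * m) * (m * m * norm u))"
  proof -
    have "norm ?v \<le> m * m * norm u"
    proof (rule norm_mom_op[OF cz(2)])
      show "cmod (qker z t * rker z t) \<le> m * m" for t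
        unfolding norm_mult
        by (intro mult_mono order_trans[OF norm_kernels(1)[OF z] m(1)] order_trans[OF norm_kernels(2)[OF z] m(1)] norm_ge_zero m0)
    qed
    then have "cmod (w - z) * (4 * (m * m) * norm ?v) \<le> cmod (w - z) * (4 * (m * m) * (m * m * norm u))"
      by (intro mult_left_mono) auto
    then show ?thesis using norm_Top_difference[OF m, of ?v] by linarith
  qed
  finally show ?thesis by (simp add: algebra_simps)
qed

end

definition param :: "complex \<Rightarrow> 'k \<Rightarrow> 'k"
  where "param = restrict (\<lambda>z. restrict (Top z) N) (ball 0 1)"

lemma op_analytic_param: "op_analytic_on_disc N param"
  unfolding op_analytic_on_disc_def
proof
  fix z assume "z \<in> ball (0::complex) 1"
  then have z: "cmod z < 1" by simp
  \<comment> \<open>Half the distance from z to the circle: every w within r of z has 1 - |w| > r,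
    so m = 1 / r controls the kernels at both points.\<close>
  define r where "r = (1 - cmod z) / 2"
  have r: "0 < r" using z by (simp add: r_def)
  define m where "m = 1 / r"
  have m0: "0 \<le> m" using r by (simp add: m_def)
  \<comment> \<open>The last factor 2 is the norm bound for the inverse of
    \<open>Rop z\<close>.\<close>
  define C where "C = (2 * (m * m * m) + 4 * (m * m * (m * m))) * 2"
  have C: "0 \<le> C" using m0 by (simp add: C_def)
  show "\<exists>T. \<forall>\<epsilon>>0. \<forall>\<^sub>F w in at z. \<forall>x\<in>N. norm (inverse (w - z) *\<^sub>C (param w x - param z x) - T x) \<le> \<epsilon> * norm x"
  proof (intro exI allI impI)
    fix \<epsilon> :: real assume \<epsilon>: "0 < \<epsilon>"
    \<comment> \<open>The derivative at z is the quotient \<open>Tquot\<close> at w = z, composed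
      with the inverse of \<open>Rop z\<close>.\<close>
    show "\<forall>\<^sub>F w in at z. \<forall>x\<in>N. norm (inverse (w - z) *\<^sub>C (param w x - param z x) - Tquot z z (inv (Rop z) x)) \<le> \<epsilon> * norm x"
      unfolding eventually_at
    proof (intro exI[of _ "min r (\<epsilon> / (C + 1))"] conjI ballI impI)
      show "0 < min r (\<epsilon> / (C + 1))" using r \<epsilon> C by simp
      fix w x assume wz: "w \<noteq> z \<and> dist w z < min r (\<epsilon> / (C + 1))" and x: "x \<in> N"
      have d: "cmod (w - z) < r" "cmod (w - z) \<le> \<epsilon> / (C + 1)" using wz by (auto simp: dist_norm)
      have zr: "1 - cmod z = 2 * r" by (simp add: r_def)
      have "cmod w \<le> cmod (w - z) + cmod z" using norm_triangle_ineq[of "w - z" z] by simp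
      then have wr: "cmod w < 1 - r" using d(1) zr by linarith
      then have w: "cmod w < 1" using r by simp
      have m: "1 / (1 - cmod z) \<le> m" "1 / (1 - cmod w) \<le> m"
        unfolding m_def using r wr zr by (simp_all add: frac_le)
      let ?u = "inv (Rop z) x"
      have "inverse (w - z) *\<^sub>C (param w x - param z x) = Tquot z w ?u"
        using x w z wz by (simp add: param_def Top_difference'[OF z w] scaleC_scaleC)
      then have "norm (inverse (w - z) *\<^sub>C (param w x - param z x) - Tquot z z ?u)
          \<le> cmod (w - z) * ((2 * (m * m * m) + 4 * (m * m * (m * m))) * norm ?u)"
        using norm_Tquot_difference[OF z w m, of ?u] by simp
      also have "\<dots> \<le> cmod (w - z) * ((2 * (m * m * m) + 4 * (m * m * (m * m))) * (2 * norm x))"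
        using m0 norm_inv_Rop[OF z w, of x] by (intro mult_left_mono) auto
      also have "\<dots> = cmod (w - z) * (C * norm x)" by (simp add: C_def)
      also have "\<dots> \<le> \<epsilon> / (C + 1) * (C * norm x)" using d(2) C by (intro mult_right_mono) auto
      also have "\<dots> = \<epsilon> * norm x * (C / (C + 1))" by simp
      also have "\<dots> \<le> \<epsilon> * norm x * 1" using \<epsilon> C by (intro mult_left_mono) auto
      finally show "norm (inverse (w - z) *\<^sub>C (param w x - param z x) - Tquot z z ?u) \<le> \<epsilon> * norm x" by simp
    qed
  qed
qed

theorem solution_to_parameter:
  "\<exists>\<Phi>. \<Phi> \<in> schur_class N N' \<and> nevanlinna_relation d S cls \<Phi> F"
proof (intro exI conjI)
  show \<Phi>: "param \<in> schur_class N N'"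
    using op_analytic_param by (auto simp: schur_class_def param_def Top_contractions)
  have "has_rs_integral (herglotz_kernel \<zeta>) F 0 (2 * pi)
      (\<lambda>h. 2 *\<^sub>C cadjoint (opI cls) (resolvent (ext_op (param \<zeta>)) \<zeta> (opI cls h)) - S 0 h)" if \<zeta>: "cmod \<zeta> < 1" for \<zeta>
  proof -
    have "(\<lambda>h. 2 *\<^sub>C cadjoint (opI cls) (resolvent (ext_op (param \<zeta>)) \<zeta> (opI cls h)) - S 0 h) = rs_int F (herglotz_kernel \<zeta>)"
      using \<zeta> by (intro ext) (simp add: param_def ext_op_Top[OF \<zeta>] resolvent_Top[OF \<zeta>] transform_of_solution[OF \<zeta>])
    then show ?thesis using rs_int_props(1)[OF dist continuous_herglotz_kernel[OF \<zeta>]] by simp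
  qed
  then show "nevanlinna_relation d S cls param F" by (simp add: nevanlinna_relation_iff[OF \<Phi>])
qed

end

text \<open>The two bijectivity clauses make \<open>inv_into\<close> a true inverse in
  \<open>bfA\<close> and in \<open>nevanlinna_relation\<close>; the two clauses of unique existence
  together are the one-to-one correspondence.\<close>

theorem theorem2:
  fixes d :: nat
    and S :: "nat \<Rightarrow> 'h::chilbert_space \<Rightarrow> 'h"
    and cls :: "(nat \<Rightarrow> 'h) \<Rightarrow> 'k::chilbert_space"
  assumes "1 \<le> d"
    and "\<And>n. n \<le> d \<Longrightarrow> bounded_clinear (S n)"
    and "\<And>h :: nat \<Rightarrow> 'h.
      (\<Sum>k\<le>d. \<Sum>l\<le>d. cinner (moment_op S (int l - int k) (h l)) (h k)) \<in> \<real>\<^sub>\<ge>\<^sub>0"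
    and "is_moment_space d S cls"
  shows "(\<forall>\<zeta>\<in>ball 0 1. bij_betw (preA d cls \<zeta>) (domA d cls) (domA d cls)) \<and>
    (\<forall>\<Phi>\<in>schur_class (ocompl (domA d cls)) (ocompl (ranA d cls)). \<forall>\<zeta>\<in>ball 0 1.
      bij_betw (denom d cls \<Phi> \<zeta>) (ocompl (domA d cls)) (ocompl (domA d cls))) \<and>
    (\<forall>\<Phi>\<in>schur_class (ocompl (domA d cls)) (ocompl (ranA d cls)).
      \<exists>!F. F \<in> solutions d S \<and> nevanlinna_relation d S cls \<Phi> F) \<and>
    (\<forall>F\<in>solutions d S.
      \<exists>!\<Phi>. \<Phi> \<in> schur_class (ocompl (domA d cls)) (ocompl (ranA d cls)) \<and>
        nevanlinna_relation d S cls \<Phi> F)"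
proof -
  interpret moment_space d S cls using assms(1,2,4) by unfold_locales
  have bij: "bij_betw (preA d cls \<zeta>) D D" if "\<zeta> \<in> ball 0 1" for \<zeta>
    using that by (intro preA_bij) simp
  have denom: "bij_betw (denom d cls \<Phi> \<zeta>) N N" if "\<Phi> \<in> schur_class N N'" "\<zeta> \<in> ball 0 1" for \<Phi> \<zeta>
    using that by (intro denom_bij schur_contraction) simp_all
  have "\<exists>!\<Phi>. \<Phi> \<in> schur_class N N' \<and> nevanlinna_relation d S cls \<Phi> F" if F: "F \<in> solutions d S" for F
  proof -
    interpret moment_solution d S cls F using F by unfold_locales
    show ?thesis using solution_to_parameter parameter_unique by blast
  qed
  then show ?thesis using bij denom parameter_to_solution by blast
qed

end
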